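(* Let $A$ and $B$ be sectorial operators in a complex Banach space $X$ with dense domain and dense range, of angles $\omega_A$ and $\omega_B$, with $\omega_A+\omega_B<\pi$, whose resolvents commute, and let $\rho\in(\omega_A,\pi-\omega_B)$. Let $p\in[1,\infty]$ and assume that for some $\phi\in H^\infty_0(\Sigma_\rho)\setminus\{0\}$ one has the equivalence of norms $$\big\|t\mapsto\phi(tA)x\big\|_{L^p((0,\infty),\frac{dt}{t};X)}\simeq\|x\|_X,\qquad x\in X.$$ Then $A+B$ with $D(A+B)=D(A)\cap D(B)$ is closed, and $A(A+B)^{-1}$ extends to a bounded operator on $X$.
   Context: Sectors: $\Sigma_\sigma=\{z\in\mathbb C\setminus\{0\}:|\arg z|<\sigma\}$ for $\sigma\in(0,\pi)$, $\Sigma_0=(0,\infty)$. $R(\lambda,A)=(\lambda-A)^{-1}$. A closed operator $A$ is sectorial of angle $\omega_A\in[0,\pi)$ if its spectrum is contained in $\overline{\Sigma_{\omega_A}}$ and $\sup\{\|\lambda R(\lambda,A)\|:\lambda\in\mathbb C\setminus\overline{\Sigma_\sigma}\}<\infty$ for every $\sigma\in(\omega_A,\pi)$. $H^\infty_0(\Sigma_\sigma)$ is the space of holomorphic $\phi:\Sigma_\sigma\to\mathbb C$ with $|\phi(z)|\le C\min\{|z|^\varepsilon,|z|^{-\varepsilon}\}$ for some $C,\varepsilon>0$; $\phi(tA)$ is defined by the usual holomorphic (Dunford–Riesz) functional calculus of sectorial operators. The symbol $\simeq$ means two-sided estimates with constants independent of $x$. *)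

theory Defs
  imports "HOL-Complex_Analysis.Complex_Analysis" "HOL-Probability.Essential_Supremum"
begin

class complex_banach = banach +
  fixes scaleC :: "complex \<Rightarrow> 'a \<Rightarrow> 'a"  (infixr \<open>*\<^sub>C\<close> 75)
  assumes scaleC_add_right: "c *\<^sub>C (x + y) = c *\<^sub>C x + c *\<^sub>C y"
    and scaleC_add_left: "(c + d) *\<^sub>C x = c *\<^sub>C x + d *\<^sub>C x"
    and scaleC_scaleC: "c *\<^sub>C d *\<^sub>C x = (c * d) *\<^sub>C x"
    and scaleC_of_real: "complex_of_real r *\<^sub>C x = r *\<^sub>R x"
    and norm_scaleC: "norm (c *\<^sub>C x) = cmod c * norm x"

instantiation complex :: complex_banach
begin
definition scaleC_complex :: "complex \<Rightarrow> complex \<Rightarrow> complex" where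
  "scaleC_complex c x = c * x"
instance
  by standard (simp_all add: scaleC_complex_def algebra_simps norm_mult scaleR_conv_of_real)
end

definition bounded_clinear :: "('a::complex_banach \<Rightarrow> 'a) \<Rightarrow> bool" where
  "bounded_clinear T \<longleftrightarrow> bounded_linear T \<and> (\<forall>c x. T (c *\<^sub>C x) = c *\<^sub>C T x)"

text \<open>An unbounded operator is given by its domain \<open>D\<close> and a total function \<open>A\<close>
  of which only the values on \<open>D\<close> are relevant.\<close>

definition linear_operator :: "'a::complex_banach set \<Rightarrow> ('a \<Rightarrow> 'a) \<Rightarrow> bool" where
  "linear_operator D A \<longleftrightarrow>
     0 \<in> D \<and>
     (\<forall>x\<in>D. \<forall>y\<in>D. x + y \<in> D \<and> A (x + y) = A x + A y) \<and>
     (\<forall>c. \<forall>x\<in>D. c *\<^sub>C x \<in> D \<and> A (c *\<^sub>C x) = c *\<^sub>C A x)"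

definition closed_operator :: "'a::complex_banach set \<Rightarrow> ('a \<Rightarrow> 'a) \<Rightarrow> bool" where
  "closed_operator D A \<longleftrightarrow> linear_operator D A \<and> closed {(x, A x) | x. x \<in> D}"

definition resolvent :: "'a::complex_banach set \<Rightarrow> ('a \<Rightarrow> 'a) \<Rightarrow> complex \<Rightarrow> 'a \<Rightarrow> 'a" where
  "resolvent D A l = the_inv_into D (\<lambda>x. l *\<^sub>C x - A x)"

definition resolvent_set :: "'a::complex_banach set \<Rightarrow> ('a \<Rightarrow> 'a) \<Rightarrow> complex set" where
  "resolvent_set D A =
     {l. bij_betw (\<lambda>x. l *\<^sub>C x - A x) D UNIV \<and> bounded_clinear (resolvent D A l)}"

definition spectrum :: "'a::complex_banach set \<Rightarrow> ('a \<Rightarrow> 'a) \<Rightarrow> complex set" where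
  "spectrum D A = - resolvent_set D A"

definition resolvents_commute ::
    "'a::complex_banach set \<Rightarrow> ('a \<Rightarrow> 'a) \<Rightarrow> 'a set \<Rightarrow> ('a \<Rightarrow> 'a) \<Rightarrow> bool" where
  "resolvents_commute DA A DB B \<longleftrightarrow>
     (\<forall>l\<in>resolvent_set DA A. \<forall>m\<in>resolvent_set DB B.
        resolvent DA A l \<circ> resolvent DB B m = resolvent DB B m \<circ> resolvent DA A l)"

definition sector :: "real \<Rightarrow> complex set" where
  "sector \<sigma> =
     (if \<sigma> = 0 then complex_of_real ` {0<..} else {z. z \<noteq> 0 \<and> \<bar>Arg z\<bar> < \<sigma>})"

definition sectorial :: "'a::complex_banach set \<Rightarrow> ('a \<Rightarrow> 'a) \<Rightarrow> real \<Rightarrow> bool" where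
  "sectorial D A \<omega> \<longleftrightarrow>
     closed_operator D A \<and> 0 \<le> \<omega> \<and> \<omega> < pi \<and>
     spectrum D A \<subseteq> closure (sector \<omega>) \<and>
     (\<forall>\<sigma>\<in>{\<omega><..<pi}.
        bdd_above ((\<lambda>l. onorm (\<lambda>x. l *\<^sub>C resolvent D A l x)) ` (- closure (sector \<sigma>))))"

definition H_inf_0 :: "real \<Rightarrow> (complex \<Rightarrow> complex) set" where
  "H_inf_0 \<sigma> =
     {\<phi>. \<phi> holomorphic_on sector \<sigma> \<and>
         (\<exists>C>0. \<exists>\<epsilon>>0. \<forall>z\<in>sector \<sigma>.
            cmod (\<phi> z) \<le> C * min (cmod z powr \<epsilon>) (cmod z powr (- \<epsilon>)))}"

text \<open>The Dunford--Riesz integral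
  \<open>\<phi>(A) x = (1 / 2 \<pi> i) \<integral>\<^bsub>\<Gamma>\<^esub> \<phi>(z) R(z, A) x dz\<close>,
  where \<open>\<Gamma>\<close> is the boundary of the sector of half-angle \<open>\<nu>\<close>, oriented so that
  the sector lies on its left: inwards along the upper ray, outwards along the lower one.
  It is independent of \<open>\<nu>\<close> as long as \<open>\<nu>\<close> lies strictly between the angle of
  the operator and the half-angle of the sector on which \<open>\<phi>\<close> is given.
  The integrals are Henstock--Kurzweil integrals because the Bochner integral of the library is
  restricted to separable spaces; the integrands are continuous with integrable norm.\<close>

definition ray_integral ::
    "real \<Rightarrow> 'a::complex_banach set \<Rightarrow> ('a \<Rightarrow> 'a) \<Rightarrow> (complex \<Rightarrow> complex) \<Rightarrow> 'a \<Rightarrow> 'a" where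
  "ray_integral \<theta> D A \<phi> x =
     integral {0<..} (\<lambda>r::real.
       (\<phi> (of_real r * cis \<theta>) * cis \<theta>) *\<^sub>C resolvent D A (of_real r * cis \<theta>) x)"

definition dunford ::
    "real \<Rightarrow> 'a::complex_banach set \<Rightarrow> ('a \<Rightarrow> 'a) \<Rightarrow> (complex \<Rightarrow> complex) \<Rightarrow> 'a \<Rightarrow> 'a" where
  "dunford \<nu> D A \<phi> x =
     (1 / (2 * of_real pi * \<i>)) *\<^sub>C (ray_integral (- \<nu>) D A \<phi> x - ray_integral \<nu> D A \<phi> x)"

definition dt_over_t :: "real measure" where
  "dt_over_t = density (restrict_space lborel {0<..}) (\<lambda>t. ennreal (1 / t))"

text \<open>The \<open>L\<^sup>p\<close> norm with values in \<open>[0,\<infinity>]\<close>, for \<open>1 \<le> p \<le> \<infinity>\<close>.\<close>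

definition Lp_norm :: "ennreal \<Rightarrow> 'b measure \<Rightarrow> ('b \<Rightarrow> 'a::real_normed_vector) \<Rightarrow> ennreal" where
  "Lp_norm p M f =
     (if p = \<infinity> then esssup M (\<lambda>t. ennreal (norm (f t)))
      else let I = \<integral>\<^sup>+ t. ennreal (norm (f t) powr enn2real p) \<partial>M
           in if I = \<infinity> then \<infinity> else ennreal (enn2real I powr (1 / enn2real p)))"

end

theory Submission
  imports Defs
begin

text \<open>Write \<open>\<phi>\<^sub>t(A)\<close> for \<open>\<phi>(t A)\<close>. If \<open>y = A x + B x\<close>, then \<open>z R(z, A) A x = z R(z, A) z (z + B)\<^sup>-\<^sup>1 y - z (z + B)\<^sup>-\<^sup>1 B x\<close>. The
  last term is holomorphic in the sector and contributes nothing to Dunford--Riesz integrals, so \<open>A x\<close>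
  enters \<open>h(A) A x\<close> only through \<open>y\<close>. With \<open>\<psi>(z)\<close> the conjugate of \<open>\<phi>\<close> at the conjugate of \<open>z\<close>, the integral of
  \<open>\<psi>\<^sub>s \<phi>\<^sub>s\<close> with respect to \<open>ds / s\<close> is a nonzero constant, hence \<open>\<phi>\<^sub>t(A) A x\<close> is a multiple of the integral of
  \<open>(\<phi>\<^sub>t \<psi>\<^sub>s)(A) \<phi>\<^sub>s(A) A x\<close>, which is bounded by a convolution of \<open>\<parallel>\<phi>\<^sub>s(A) y\<parallel>\<close> with an integrable kernel.
  Young's inequality and the norm equivalence give \<open>\<parallel>A x\<parallel> \<le> M \<parallel>y\<parallel>\<close>; so \<open>A + B\<close> is closed and injective and
  \<open>A (A + B)\<^sup>-\<^sup>1\<close> is bounded on the range of \<open>A + B\<close>. This range is dense: it contains \<open>g(A) y\<close> for \<open>g\<close> decaying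
  fast at \<open>0\<close> and \<open>\<infinity>\<close>, and for \<open>g\<close> tending to \<open>1\<close> the norm equivalence yields \<open>g(A) y \<rightarrow> y\<close> for \<open>y\<close> in the
  dense range of \<open>A (1 + A)\<^sup>-\<^sup>2\<close>. All integrals are written in the coordinate \<open>a\<close> with \<open>z = exp a\<close>.\<close>

text \<open>Formally \<open>A (A + B)\<^sup>-\<^sup>1\<close> is the value at \<open>A\<close> of
  the function \<open>z (z + B)\<^sup>-\<^sup>1\<close>, which is bounded but has no decay, so that
  its Dunford--Riesz integral need not converge absolutely. The reproducing formula repairs this:
  the factor \<open>\<phi>\<^sub>s\<close> is spent on the vector, where the norm equivalence
  controls it, and \<open>\<phi>\<^sub>t \<psi>\<^sub>s\<close> stays under the integral, where a
  uniform bound on the remaining factors suffices. In the coordinate \<open>a\<close> dilations are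
  translations, and the two functions decay exponentially away from \<open>Re a = - t\<close> and
  \<open>Re a = - s\<close>; their overlap is of size
  \<open>exp (- (e / 2) * \<bar>t - s\<bar>)\<close>, the integrable kernel. The conjugate is taken
  in \<psi> because the constant is then the integral of a squared modulus. Two heights \<nu> <
  \<mu> occur because a product of two integrals is computed from the resolvent equation, whose
  denominator vanishes where the contours meet. Both lie between the angle of \<open>A\<close> and
  \<pi> minus that of \<open>B\<close>: the resolvent of \<open>A\<close> exists on the lines, and
  \<open>z (z + B)\<^sup>-\<^sup>1\<close> is holomorphic between them.\<close>

section \<open>Banach-valued integrals over the line\<close>

text \<open>A substitute for dominated convergence of Banach-valued integrands: only the error needs a real
  majorant, and the integrals of the majorants have to tend to \<open>0\<close>.\<close>

lemma has_integral_approximation: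
  fixes f :: "real \<Rightarrow> 'a::banach" and E :: "nat \<Rightarrow> real \<Rightarrow> real"
  assumes F: "\<And>n. (F n has_integral I n) (cbox a b)"
    and E: "\<And>n. (E n has_integral J n) (cbox a b)"
    and J: "J \<longlonglongrightarrow> 0"
    and le: "\<And>n x. x \<in> cbox a b \<Longrightarrow> norm (f x - F n x) \<le> E n x"
  shows "f integrable_on cbox a b"
proof -
  have diff: "norm (I n - I m) \<le> J n + J m" for n m
  proof -
    have "norm (integral (cbox a b) (\<lambda>x. F n x - F m x)) \<le> integral (cbox a b) (\<lambda>x. E n x + E m x)"
    proof (rule integral_norm_bound_integral)
      show "(\<lambda>x. F n x - F m x) integrable_on cbox a b"
        using has_integral_diff[OF F[of n] F[of m]] by blast
      show "(\<lambda>x. E n x + E m x) integrable_on cbox a b"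
        using has_integral_add[OF E[of n] E[of m]] by blast
      show "norm (F n x - F m x) \<le> E n x + E m x" if "x \<in> cbox a b" for x
      proof -
        have "norm (F n x - F m x) \<le> norm (f x - F n x) + norm (f x - F m x)"
          using norm_triangle_ineq4[of "f x - F m x" "f x - F n x"] by (simp add: add.commute)
        then show ?thesis using le[OF that, of n] le[OF that, of m] by linarith
      qed
    qed
    then show ?thesis
      using has_integral_diff[OF F[of n] F[of m]] has_integral_add[OF E[of n] E[of m]]
      by (simp add: integral_unique)
  qed
  have "Cauchy I"
  proof (rule CauchyI)
    fix e :: real assume "0 < e"
    then have "\<forall>\<^sub>F n in sequentially. J n < e/2"
      by (intro order_tendstoD(2)[OF J]) auto
    then obtain M where "\<And>n. n \<ge> M \<Longrightarrow> J n < e/2"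
      by (auto simp: eventually_sequentially)
    then show "\<exists>M. \<forall>m\<ge>M. \<forall>n\<ge>M. norm (I m - I n) < e"
      by (intro exI[of _ M]) (smt (verit) diff field_sum_of_halves)
  qed
  then obtain I' where I': "I \<longlonglongrightarrow> I'"
    using Cauchy_convergent convergent_def by blast
  have "(f has_integral I') (cbox a b)"
    unfolding has_integral
  proof (intro allI impI)
    fix e :: real assume e: "0 < e"
    have "\<forall>\<^sub>F n in sequentially. J n < e/4 \<and> dist (I n) I' < e/4"
      using e by (intro eventually_conj order_tendstoD(2)[OF J] tendstoD[OF I']) auto
    then obtain N where N: "J N < e/4" "dist (I N) I' < e/4"
      by (auto simp: eventually_sequentially)
    obtain g where g: "gauge g" "\<And>D. D tagged_division_of cbox a b \<Longrightarrow> g fine D \<Longrightarrow>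
        norm ((\<Sum>(x, k)\<in>D. measure lborel k *\<^sub>R F N x) - I N) < e/4"
      using F[of N, unfolded has_integral, rule_format, of "e/4"] e by auto
    obtain h where h: "gauge h" "\<And>D. D tagged_division_of cbox a b \<Longrightarrow> h fine D \<Longrightarrow>
        norm ((\<Sum>(x, k)\<in>D. measure lborel k *\<^sub>R E N x) - J N) < e/4"
      using E[of N, unfolded has_integral, rule_format, of "e/4"] e by auto
    show "\<exists>\<gamma>. gauge \<gamma> \<and> (\<forall>\<D>. \<D> tagged_division_of cbox a b \<and> \<gamma> fine \<D> \<longrightarrow>
        norm ((\<Sum>(x, k)\<in>\<D>. measure lborel k *\<^sub>R f x) - I') < e)"
    proof (intro exI conjI allI impI)
      show "gauge (\<lambda>x. g x \<inter> h x)" using g(1) h(1) by (rule gauge_Int)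
      fix D assume D: "D tagged_division_of cbox a b \<and> (\<lambda>x. g x \<inter> h x) fine D"
      then have fine: "g fine D" "h fine D" by (auto simp: fine_Int)
      have "norm ((\<Sum>(x, k)\<in>D. measure lborel k *\<^sub>R f x) - (\<Sum>(x, k)\<in>D. measure lborel k *\<^sub>R F N x))
          = norm (\<Sum>(x, k)\<in>D. measure lborel k *\<^sub>R (f x - F N x))"
        by (simp add: split_def scaleR_diff_right sum_subtractf)
      also have "\<dots> \<le> (\<Sum>(x, k)\<in>D. measure lborel k *\<^sub>R E N x)"
      proof (rule sum_norm_le, clarify)
        fix x k assume "(x, k) \<in> D"
        then have "x \<in> cbox a b" using D by (meson tag_in_interval)
        then show "norm (measure lborel k *\<^sub>R (f x - F N x)) \<le> measure lborel k *\<^sub>R E N x"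
          using le[of x N] by (auto intro!: mult_left_mono)
      qed
      also have "\<dots> < J N + e/4"
        using h(2)[of D] D fine by (simp add: abs_if split: if_splits)
      finally have 1: "norm ((\<Sum>(x, k)\<in>D. measure lborel k *\<^sub>R f x) - (\<Sum>(x, k)\<in>D. measure lborel k *\<^sub>R F N x)) < e/2"
        using N by simp
      have 2: "norm ((\<Sum>(x, k)\<in>D. measure lborel k *\<^sub>R F N x) - I N) < e/4"
        using g(2)[of D] D fine by simp
      show "norm ((\<Sum>(x, k)\<in>D. measure lborel k *\<^sub>R f x) - I') < e"
        using norm_diff_triangle_less[OF norm_diff_triangle_less[OF 1 2] N(2)[unfolded dist_norm]] by simp
    qed
  qed
  then show ?thesis by blast
qed

text \<open>Cutting \<open>f\<close> off outside \<open>{c..d}\<close> makes the difference one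
  integral, dominated by the part of \<open>b\<close> outside \<open>{c..d}\<close>. The bound does
  not involve \<open>l\<close> and \<open>u\<close>, hence controls all larger windows at
  once.\<close>

lemma integral_tail_dominated:
  fixes f :: "real \<Rightarrow> 'a::banach" and b :: "real \<Rightarrow> real"
  assumes f: "\<And>l u. f integrable_on {l..u}"
    and b: "b integrable_on UNIV"
    and le: "\<And>x. norm (f x) \<le> b x"
    and sub: "{c..d} \<subseteq> {l..u}"
  shows "norm (integral {l..u} f - integral {c..d} f) \<le> integral UNIV b - integral {c..d} b"
proof -
  have b0: "0 \<le> b x" for x using le[of x] norm_ge_zero order_trans by blast
  have bi: "b integrable_on {x..y}" for x y using b by (rule integrable_on_subinterval) simp
  let ?f = "\<lambda>x. if x \<in> {c..d} then f x else 0" and ?b = "\<lambda>x. if x \<in> {c..d} then b x else 0"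
  have eq: "{c..d} \<inter> {l..u} = {c..d}" using sub by blast
  have fi: "?f integrable_on {l..u}" "?b integrable_on {l..u}"
    using f[of c d] bi[of c d] by (simp_all only: integrable_restrict_Int eq)
  have int: "integral {l..u} ?f = integral {c..d} f" "integral {l..u} ?b = integral {c..d} b"
    by (simp_all only: integral_restrict_Int eq)
  note int = int[simplified]
  have "norm (integral {l..u} (\<lambda>x. f x - ?f x)) \<le> integral {l..u} (\<lambda>x. b x - ?b x)"
    by (rule integral_norm_bound_integral) (use f bi fi le in \<open>auto intro!: integrable_diff\<close>)
  also have "\<dots> = integral {l..u} b - integral {c..d} b"
    using bi fi by (simp add: integral_diff int)
  also have "\<dots> \<le> integral UNIV b - integral {c..d} b"
    using integral_subset_le[OF _ bi b] b0 by simp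
  finally show ?thesis using f fi by (simp add: integral_diff int)
qed

lemma integral_UNIV_tendsto:
  fixes b :: "real \<Rightarrow> 'a::banach"
  assumes "b integrable_on UNIV"
  shows "(\<lambda>n. integral {- real n..real n} b) \<longlonglongrightarrow> integral UNIV b"
proof (rule LIMSEQ_I)
  fix e :: real assume "0 < e"
  moreover have "(b has_integral integral UNIV b) UNIV" using assms by blast
  ultimately obtain B where B: "B > 0"
    "\<And>l u. ball 0 B \<subseteq> cbox l u \<Longrightarrow> norm (integral (cbox l u) b - integral UNIV b) < e"
    unfolding has_integral_alt'[of b] by auto
  show "\<exists>no. \<forall>n\<ge>no. norm (integral {- real n..real n} b - integral UNIV b) < e"
  proof (intro exI allI impI)
    fix n assume "n \<ge> nat \<lceil>B\<rceil>"
    then have "B \<le> real n" by linarith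
    then have "ball 0 B \<subseteq> cbox (- real n) (real n)" by (auto simp: dist_real_def)
    from B(2)[OF this] show "norm (integral {- real n..real n} b - integral UNIV b) < e" by simp
  qed
qed

text \<open>The tails of \<open>b\<close> make the integrals of \<open>f\<close> over
  \<open>{- n..n}\<close> a Cauchy sequence, and completeness provides the value.\<close>

lemma integrable_UNIV_dominated:
  fixes f :: "real \<Rightarrow> 'a::banach" and b :: "real \<Rightarrow> real"
  assumes f: "\<And>l u. f integrable_on {l..u}"
    and b: "b integrable_on UNIV"
    and le: "\<And>x. norm (f x) \<le> b x"
  shows "f integrable_on UNIV"
proof -
  note tail = integral_tail_dominated[OF f b le]
  have lim: "(\<lambda>n. integral UNIV b - integral {- real n..real n} b) \<longlonglongrightarrow> 0"
    using tendsto_diff[OF tendsto_const integral_UNIV_tendsto[OF b], of "integral UNIV b"] by simp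
  define I where "I n = integral {- real n..real n} f" for n
  have "Cauchy I"
  proof (rule CauchyI')
    fix e :: real assume "0 < e"
    then obtain M where M: "\<And>n. n \<ge> M \<Longrightarrow> integral UNIV b - integral {- real n..real n} b < e"
      using order_tendstoD(2)[OF lim] by (auto simp: eventually_sequentially)
    have "dist (I m) (I n) < e" if "m \<ge> M" "m < n" for m n
      using tail[of "- real m" "real m" "- real n" "real n"] M[of m] that
      by (simp add: I_def dist_norm norm_minus_commute)
    then show "\<exists>M. \<forall>m\<ge>M. \<forall>n>m. dist (I m) (I n) < e" by blast
  qed
  then obtain I' where I': "I \<longlonglongrightarrow> I'"
    using Cauchy_convergent convergent_def by blast
  have "(f has_integral I') UNIV"
    unfolding has_integral_alt'[of f]
  proof (intro conjI allI impI)
    fix l u :: real show "(\<lambda>x. if x \<in> UNIV then f x else 0) integrable_on cbox l u"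
      using f by simp
  next
    fix e :: real assume e: "0 < e"
    have "\<forall>\<^sub>F n in sequentially. integral UNIV b - integral {- real n..real n} b < e/2 \<and> dist (I n) I' < e/2"
      using e by (intro eventually_conj order_tendstoD(2)[OF lim] tendstoD[OF I']) auto
    then obtain N where N: "integral UNIV b - integral {- real N..real N} b < e/2" "dist (I N) I' < e/2"
      by (auto simp: eventually_sequentially)
    show "\<exists>B>0. \<forall>l u. ball 0 B \<subseteq> cbox l u \<longrightarrow>
        norm (integral (cbox l u) (\<lambda>x. if x \<in> UNIV then f x else 0) - I') < e"
    proof (intro exI conjI allI impI)
      show "0 < real (Suc N)" by simp
      fix l u :: real assume "ball 0 (real (Suc N)) \<subseteq> cbox l u"
      moreover have "- real N \<in> ball 0 (real (Suc N))" "real N \<in> ball 0 (real (Suc N))"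
        by (auto simp: dist_real_def)
      ultimately have "- real N \<in> {l..u}" "real N \<in> {l..u}" by (auto simp only: subset_iff box_real)
      then have "{- real N..real N} \<subseteq> {l..u}" by auto
      from tail[OF this] N
      have "dist (integral {l..u} f) I' < e"
        using dist_triangle[of "integral {l..u} f" I' "I N"] unfolding dist_norm I_def by linarith
      then show "norm (integral (cbox l u) (\<lambda>x. if x \<in> UNIV then f x else 0) - I') < e"
        by (simp add: dist_norm)
    qed
  qed
  then show ?thesis by blast
qed

lemma integral_exp_neg_Icc:
  fixes e :: real assumes "e > 0" "l \<le> 0" "0 \<le> u"
  shows "((\<lambda>x. exp (- e * \<bar>x\<bar>)) has_integral (2 - exp (e * l) - exp (- e * u)) / e) {l..u}"
proof -
  have "((\<lambda>x. exp (- e * \<bar>x\<bar>)) has_integral (exp (e * 0) / e - exp (e * l) / e)) {l..0}"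
  proof (rule has_integral_eq[rotated])
    show "((\<lambda>x. exp (e * x)) has_integral (exp (e * 0) / e - exp (e * l) / e)) {l..0}"
      by (rule fundamental_theorem_of_calculus)
         (use assms in \<open>auto intro!: derivative_eq_intros
            simp flip: has_real_derivative_iff_has_vector_derivative\<close>)
  qed auto
  moreover have "((\<lambda>x. exp (- e * \<bar>x\<bar>)) has_integral (- exp (- e * u) / e - (- exp (- e * 0) / e))) {0..u}"
  proof (rule has_integral_eq[rotated])
    show "((\<lambda>x. exp (- e * x)) has_integral (- exp (- e * u) / e - (- exp (- e * 0) / e))) {0..u}"
      by (rule fundamental_theorem_of_calculus)
         (use assms in \<open>auto intro!: derivative_eq_intros
            simp flip: has_real_derivative_iff_has_vector_derivative\<close>)
  qed auto
  ultimately have "((\<lambda>x. exp (- e * \<bar>x\<bar>)) has_integral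
      (exp (e * 0) / e - exp (e * l) / e) + (- exp (- e * u) / e - (- exp (- e * 0) / e))) {l..u}"
    using assms has_integral_combine by blast
  moreover have "(exp (e * 0) / e - exp (e * l) / e) + (- exp (- e * u) / e - (- exp (- e * 0) / e)) =
      (2 - exp (e * l) - exp (- e * u)) / e"
    using assms by (simp add: field_simps)
  ultimately show ?thesis by simp
qed

lemma has_integral_exp_neg_abs:
  fixes e :: real assumes "e > 0"
  shows "((\<lambda>x. exp (- e * \<bar>x\<bar>)) has_integral 2 / e) UNIV"
  unfolding has_integral_alt'[of "\<lambda>x. exp (- e * \<bar>x\<bar>)"]
proof (intro conjI allI impI)
  fix l u :: real
  show "(\<lambda>x. if x \<in> UNIV then exp (- e * \<bar>x\<bar>) else 0) integrable_on cbox l u"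
    by (auto intro!: integrable_continuous_interval continuous_intros)
next
  fix \<epsilon> :: real assume \<epsilon>: "0 < \<epsilon>"
  have "((\<lambda>B. 2 * exp (- e * B) / e) \<longlongrightarrow> 0) at_top"
    using assms by real_asymp
  then have "\<forall>\<^sub>F B in at_top. 2 * exp (- e * B) / e < \<epsilon> \<and> B > 0"
    using \<epsilon> by (intro eventually_conj eventually_gt_at_top order_tendstoD(2)) auto
  then obtain B where B: "B > 0" "2 * exp (- e * B) / e < \<epsilon>"
    by (auto simp: eventually_at_top_linorder)
  show "\<exists>B>0. \<forall>l u. ball 0 B \<subseteq> cbox l u \<longrightarrow>
      norm (integral (cbox l u) (\<lambda>x. if x \<in> UNIV then exp (- e * \<bar>x\<bar>) else 0) - 2 / e) < \<epsilon>"
  proof (intro exI conjI allI impI)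
    show "B > 0" by fact
    fix l u :: real assume sub: "ball 0 B \<subseteq> cbox l u"
    have "{-B<..<B} = ball 0 B" by (auto simp: dist_real_def)
    then have "{-B<..<B} \<subseteq> {l..u}" using sub by auto
    then have lu: "l \<le> - B" "B \<le> u"
      using B(1) by (auto simp: greaterThanLessThan_subseteq_atLeastAtMost_iff)
    then have "integral {l..u} (\<lambda>x. exp (- e * \<bar>x\<bar>)) = (2 - exp (e * l) - exp (- e * u)) / e"
      using integral_exp_neg_Icc[OF assms, of l u] B(1) by (auto intro: integral_unique)
    then have "2 / e - integral {l..u} (\<lambda>x. exp (- e * \<bar>x\<bar>)) = (exp (e * l) + exp (- e * u)) / e"
      using assms by (simp add: field_simps)
    moreover have "exp (e * l) \<le> exp (- e * B)" "exp (- e * u) \<le> exp (- e * B)"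
      using lu assms mult_left_mono[of l "-B" e] by auto
    then have "(exp (e * l) + exp (- e * u)) / e \<le> 2 * exp (- e * B) / e"
      using assms by (intro divide_right_mono) linarith+
    moreover have "0 \<le> (exp (e * l) + exp (- e * u)) / e" using assms by simp
    ultimately show "norm (integral (cbox l u) (\<lambda>x. if x \<in> UNIV then exp (- e * \<bar>x\<bar>) else 0) - 2 / e) < \<epsilon>"
      using B(2) by (simp add: abs_if)
  qed
qed

section \<open>Continuous integrands of exponential decay\<close>

definition exp_decay :: "real \<Rightarrow> real \<Rightarrow> (real \<Rightarrow> 'a::real_normed_vector) \<Rightarrow> bool" where
  "exp_decay C e f \<longleftrightarrow> 0 < e \<and> continuous_on UNIV f \<and> (\<forall>u. norm (f u) \<le> C * exp (- e * \<bar>u\<bar>))"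

lemma exp_decayD:
  assumes "exp_decay C e f"
  shows "0 < e" "continuous_on A f" "norm (f u) \<le> C * exp (- e * \<bar>u\<bar>)"
  using assms continuous_on_subset unfolding exp_decay_def by auto

lemma integral_exp_neg_abs:
  fixes e :: real assumes "e > 0"
  shows "(\<lambda>x. C * exp (- e * \<bar>x\<bar>)) integrable_on UNIV"
    "integral UNIV (\<lambda>x. C * exp (- e * \<bar>x\<bar>)) = C * (2 / e)"
  using has_integral_mult_right[OF has_integral_exp_neg_abs[OF assms], of C]
  by (blast, rule integral_unique)

lemma exp_decay_integrable:
  fixes f :: "real \<Rightarrow> 'a::banach"
  assumes "exp_decay C e f"
  shows "f integrable_on UNIV" "norm (integral UNIV f) \<le> C * (2 / e)"
proof -
  show int: "f integrable_on UNIV"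
    by (rule integrable_UNIV_dominated[OF _ integral_exp_neg_abs(1)[OF exp_decayD(1)[OF assms], of C]])
       (use exp_decayD[OF assms] in \<open>auto intro: integrable_continuous_interval\<close>)
  show "norm (integral UNIV f) \<le> C * (2 / e)"
    using integral_norm_bound_integral[OF int integral_exp_neg_abs(1)[OF exp_decayD(1)[OF assms], of C]]
      exp_decayD(3)[OF assms] integral_exp_neg_abs(2)[OF exp_decayD(1)[OF assms], of C] by simp
qed

text \<open>The estimate holds for all windows \<open>{- m..m}\<close> with \<open>m \<ge> n\<close>
  and passes to the limit. Its explicit form gives convergence that is uniform in parameters on
  which \<open>C\<close> and \<open>e\<close> do not depend.\<close>

lemma exp_decay_tail:
  fixes f :: "real \<Rightarrow> 'a::banach"
  assumes "exp_decay C e f"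
  shows "norm (integral UNIV f - integral {- real n..real n} f) \<le> C * (2 * exp (- e * real n) / e)"
proof -
  have e: "e > 0" using exp_decayD(1)[OF assms] .
  have f: "f integrable_on {l..u}" for l u
    using exp_decayD(2)[OF assms] by (rule integrable_continuous_interval)
  have int: "integral {- real n..real n} (\<lambda>x. C * exp (- e * \<bar>x\<bar>)) =
      C * ((2 - exp (e * - real n) - exp (- e * real n)) / e)"
    by (intro integral_unique has_integral_mult_right integral_exp_neg_Icc) (use e in auto)
  have *: "norm (integral {- real m..real m} f - integral {- real n..real n} f)
      \<le> C * (2 * exp (- e * real n) / e)" if "m \<ge> n" for m
  proof -
    have "norm (integral {- real m..real m} f - integral {- real n..real n} f) \<le>
        C * (2 / e) - C * ((2 - exp (e * - real n) - exp (- e * real n)) / e)"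
      using integral_tail_dominated[OF f integral_exp_neg_abs(1)[OF e, of C] exp_decayD(3)[OF assms],
          of "- real n" "real n" "- real m" "real m"] that
      unfolding int integral_exp_neg_abs(2)[OF e, of C] by simp
    also have "\<dots> = C * (2 * exp (- e * real n) / e)"
      using e by (simp add: field_simps)
    finally show ?thesis .
  qed
  show ?thesis
    by (rule Lim_norm_ubound[OF _ tendsto_diff[OF integral_UNIV_tendsto[OF exp_decay_integrable(1)[OF assms]] tendsto_const]])
       (use * in \<open>auto simp: eventually_sequentially\<close>)
qed

text \<open>The truncated integrals are continuous in \<open>s\<close>, and
  \<open>exp_decay_tail\<close> makes their convergence uniform because \<open>C\<close> and
  \<open>e\<close> are the same for all \<open>s\<close>.\<close>

lemma continuous_on_integral_UNIV:
  fixes G :: "'b::topological_space \<Rightarrow> real \<Rightarrow> 'a::banach"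
  assumes cont: "continuous_on (U \<times> UNIV) (\<lambda>(s, u). G s u)"
    and e: "e > 0" and le: "\<And>s u. s \<in> U \<Longrightarrow> norm (G s u) \<le> C * exp (- e * \<bar>u\<bar>)"
  shows "continuous_on U (\<lambda>s. integral UNIV (G s))"
proof (rule uniform_limit_theorem)
  have dec: "exp_decay C e (G s)" if "s \<in> U" for s
    unfolding exp_decay_def
  proof (intro conjI allI)
    have "continuous_on UNIV ((\<lambda>(s, u). G s u) \<circ> Pair s)"
      by (rule continuous_on_compose continuous_intros continuous_on_subset[OF cont])+ (use that in auto)
    then show "continuous_on UNIV (G s)" by (simp add: o_def)
  qed (use e le that in auto)
  show "\<forall>\<^sub>F n in sequentially. continuous_on U (\<lambda>s. integral {- real n..real n} (G s))"
  proof (rule always_eventually, rule allI)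
    fix n show "continuous_on U (\<lambda>s. integral {- real n..real n} (G s))"
      using integral_continuous_on_param[of U "- real n" "real n" G] continuous_on_subset[OF cont]
      by (simp add: Sigma_mono)
  qed
  show "uniform_limit U (\<lambda>n s. integral {- real n..real n} (G s)) (\<lambda>s. integral UNIV (G s)) sequentially"
  proof (rule uniform_limitI)
    fix r :: real assume "0 < r"
    have "(\<lambda>n. C * (2 * exp (- e * real n) / e)) \<longlonglongrightarrow> 0"
      using e by real_asymp
    then have "\<forall>\<^sub>F n in sequentially. C * (2 * exp (- e * real n) / e) < r"
      using \<open>0 < r\<close> by (rule order_tendstoD(2))
    then show "\<forall>\<^sub>F n in sequentially. \<forall>s\<in>U. dist (integral {- real n..real n} (G s)) (integral UNIV (G s)) < r"
    proof eventually_elim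
      case (elim n)
      then show ?case
        using exp_decay_tail[OF dec, of _ n] by (auto simp: dist_norm norm_minus_commute intro: le_less_trans)
    qed
  qed
qed simp

text \<open>Both iterated integrals are the limit of the integrals over the squares with side
  \<open>{- n..n}\<close>, where the order may be exchanged for continuous integrands.\<close>

lemma integral_UNIV_swap:
  fixes G :: "real \<Rightarrow> real \<Rightarrow> 'a::banach"
  assumes cont: "continuous_on UNIV (\<lambda>(s, u). G s u)"
    and e: "e > 0" and le: "\<And>s u. norm (G s u) \<le> C * exp (- e * \<bar>s\<bar>) * exp (- e * \<bar>u\<bar>)"
  shows "integral UNIV (\<lambda>s. integral UNIV (G s)) = integral UNIV (\<lambda>u. integral UNIV (\<lambda>s. G s u))"
proof -
  \<comment> \<open>Stated for arbitrary \<open>H\<close>, since it is applied to \<open>G\<close>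
    and to \<open>G\<close> with exchanged arguments.\<close>
  have half: "((\<lambda>n. integral {- real n..real n} (\<lambda>s. integral {- real n..real n} (H s))) \<longlonglongrightarrow>
      integral UNIV (\<lambda>s. integral UNIV (H s)))"
    if cont: "continuous_on UNIV (\<lambda>(s, u). H s u)"
      and le: "\<And>s u. norm (H s u) \<le> C * exp (- e * \<bar>s\<bar>) * exp (- e * \<bar>u\<bar>)" for H :: "real \<Rightarrow> real \<Rightarrow> 'a"
  proof -
    have C: "C \<ge> 0" using norm_ge_zero[THEN order_trans, OF le[of 0 0]] by simp
    have dec: "exp_decay (C * exp (- e * \<bar>s\<bar>)) e (H s)" for s
      unfolding exp_decay_def
    proof (intro conjI allI)
      have "continuous_on UNIV ((\<lambda>(s, u). H s u) \<circ> Pair s)"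
        by (rule continuous_on_compose continuous_intros continuous_on_subset[OF cont])+ auto
      then show "continuous_on UNIV (H s)" by (simp add: o_def)
    qed (use e le in auto)
    have outer: "exp_decay (C * (2 / e)) e (\<lambda>s. integral UNIV (H s))"
      unfolding exp_decay_def
    proof (intro conjI allI)
      show "continuous_on UNIV (\<lambda>s. integral UNIV (H s))"
      proof (rule continuous_on_integral_UNIV)
        show "norm (H s u) \<le> C * exp (- e * \<bar>u\<bar>)" for s u
        proof -
          have "C * exp (- e * \<bar>s\<bar>) * exp (- e * \<bar>u\<bar>) \<le> C * 1 * exp (- e * \<bar>u\<bar>)"
            using C e by (intro mult_right_mono mult_left_mono) auto
          then show ?thesis using le[of s u] by simp
        qed
      qed (use e cont in auto)
      show "norm (integral UNIV (H s)) \<le> C * (2 / e) * exp (- e * \<bar>s\<bar>)" for s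
        using exp_decay_integrable(2)[OF dec[of s]] by (simp add: mult_ac)
    qed (use e in auto)
    have lim1: "(\<lambda>n. integral {- real n..real n} (\<lambda>s. integral UNIV (H s))) \<longlonglongrightarrow>
        integral UNIV (\<lambda>s. integral UNIV (H s))"
      by (rule integral_UNIV_tendsto[OF exp_decay_integrable(1)[OF outer]])
    have contn: "continuous_on S (\<lambda>s. integral {- real n..real n} (H s))" for n S
      using integral_continuous_on_param[of S "- real n" "real n" H] continuous_on_subset[OF cont]
      by (simp add: Sigma_mono)
    \<comment> \<open>The inner tails are integrated over an interval of length
      \<open>2 * real n\<close>; exponential decay outweighs this factor.\<close>
    have "norm (integral {- real n..real n} (\<lambda>s. integral UNIV (H s)) -
        integral {- real n..real n} (\<lambda>s. integral {- real n..real n} (H s))) \<le>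
        C * (2 * exp (- e * real n) / e) * (2 * real n)" for n
    proof -
      have 1: "norm (integral UNIV (H s) - integral {- real n..real n} (H s)) \<le> C * (2 * exp (- e * real n) / e)" for s
      proof -
        have "C * exp (- e * \<bar>s\<bar>) * (2 * exp (- e * real n) / e) \<le> C * 1 * (2 * exp (- e * real n) / e)"
          using C e by (intro mult_right_mono mult_left_mono) auto
        then show ?thesis using exp_decay_tail[OF dec[of s], of n] by simp
      qed
      have "norm (integral (cbox (- real n) (real n)) (\<lambda>s. integral UNIV (H s) - integral {- real n..real n} (H s)))
          \<le> C * (2 * exp (- e * real n) / e) * measure lborel (cbox (- real n) (real n))"
        using 1 C e contn exp_decayD(2)[OF outer]
        by (intro integrable_bound) (auto intro!: integrable_diff integrable_continuous_interval continuous_on_diff)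
      then show ?thesis
        using contn exp_decayD(2)[OF outer]
        by (subst integral_diff[symmetric]) (auto intro!: integrable_continuous_interval)
    qed
    moreover have "(\<lambda>n. C * (2 * exp (- e * real n) / e) * (2 * real n)) \<longlonglongrightarrow> 0"
      using e by real_asymp
    ultimately have "(\<lambda>n. integral {- real n..real n} (\<lambda>s. integral UNIV (H s)) -
        integral {- real n..real n} (\<lambda>s. integral {- real n..real n} (H s))) \<longlonglongrightarrow> 0"
      by (rule Lim_null_comparison[OF always_eventually[OF allI]])
    from tendsto_diff[OF lim1 this] show ?thesis by simp
  qed
  have cont': "continuous_on UNIV (\<lambda>(u, s). G s u)"
  proof -
    have "continuous_on UNIV ((\<lambda>(s, u). G s u) \<circ> prod.swap)"
      by (rule continuous_on_compose continuous_on_swap continuous_on_subset[OF cont])+ auto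
    then show ?thesis by (simp add: o_def split_def)
  qed
  have sw: "integral {- real n..real n} (\<lambda>s. integral {- real n..real n} (G s)) =
      integral {- real n..real n} (\<lambda>u. integral {- real n..real n} (\<lambda>s. G s u))" for n
    using integral_swap_continuous[of "- real n" "- real n" "real n" "real n" G] continuous_on_subset[OF cont]
    by simp
  have "(\<lambda>n. integral {- real n..real n} (\<lambda>s. integral {- real n..real n} (G s))) \<longlonglongrightarrow>
      integral UNIV (\<lambda>u. integral UNIV (\<lambda>s. G s u))"
  proof -
    have "norm (G u s) \<le> C * exp (- e * \<bar>s\<bar>) * exp (- e * \<bar>u\<bar>)" for s u
      using le[of u s] by (simp only: mult_ac)
    from half[of "\<lambda>u s. G s u", OF cont' this] show ?thesis by (simp only: sw)
  qed
  from LIMSEQ_unique[OF half[OF cont le] this] show ?thesis .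
qed

lemma has_integral_UNIV_translation:
  fixes f :: "real \<Rightarrow> 'a::banach"
  assumes "(f has_integral I) UNIV"
  shows "((\<lambda>u. f (u + c)) has_integral I) UNIV"
  unfolding has_integral_alt'[of "\<lambda>u. f (u + c)"]
proof (intro conjI allI impI)
  note f = assms[unfolded has_integral_alt'[of f], simplified]
  fix l u :: real
  show "(\<lambda>x. if x \<in> UNIV then f (x + c) else 0) integrable_on cbox l u"
    using f integrable_shift_real_ivl[of f "l + c" "u + c" c] by simp
next
  note f = assms[unfolded has_integral_alt'[of f], simplified]
  fix e :: real assume "0 < e"
  then obtain B where B: "B > 0" "\<And>l u. ball 0 B \<subseteq> {l..u} \<Longrightarrow> norm (integral {l..u} f - I) < e"
    using f by auto
  show "\<exists>B>0. \<forall>l u. ball 0 B \<subseteq> cbox l u \<longrightarrow>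
      norm (integral (cbox l u) (\<lambda>x. if x \<in> UNIV then f (x + c) else 0) - I) < e"
  proof (intro exI conjI allI impI)
    show "0 < B + \<bar>c\<bar>" using B by simp
    fix l u :: real assume sub: "ball 0 (B + \<bar>c\<bar>) \<subseteq> cbox l u"
    have "ball 0 B \<subseteq> {l + c..u + c}"
    proof
      fix x :: real assume "x \<in> ball 0 B"
      then have "x - c \<in> ball 0 (B + \<bar>c\<bar>)" by (auto simp: dist_real_def)
      then show "x \<in> {l + c..u + c}" using sub by auto
    qed
    from B(2)[OF this] show "norm (integral (cbox l u) (\<lambda>x. if x \<in> UNIV then f (x + c) else 0) - I) < e"
      using integral_shift_real_ivl[of "l + c" c "u + c" f] by simp
  qed
qed

lemma integral_UNIV_translation:
  fixes f :: "real \<Rightarrow> 'a::banach"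
  shows "integral UNIV (\<lambda>u. f (u + c)) = integral UNIV f"
proof (cases "f integrable_on UNIV")
  case True
  then show ?thesis
    using has_integral_UNIV_translation[OF integrable_integral, of f c] by (simp add: integral_unique)
next
  case False
  moreover have "\<not> (\<lambda>u. f (u + c)) integrable_on UNIV"
    using False has_integral_UNIV_translation[OF integrable_integral, of "\<lambda>u. f (u + c)" "- c"]
    by (auto simp: integrable_on_def)
  ultimately show ?thesis by (simp add: not_integrable_integral)
qed

section \<open>Complex scalars, substitution and shifts of the line of integration\<close>

lemma scaleC_zero_left [simp]: "0 *\<^sub>C (x::'a::complex_banach) = 0"
  using norm_scaleC[of 0 x] by simp

lemma scaleC_zero_right [simp]: "c *\<^sub>C (0::'a::complex_banach) = 0"
  using norm_scaleC[of c "0::'a"] by simp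

lemma scaleC_one [simp]: "1 *\<^sub>C (x::'a::complex_banach) = x"
  using scaleC_of_real[of 1 x] by simp

lemma scaleC_scaleR: "c *\<^sub>C (r *\<^sub>R (x::'a::complex_banach)) = r *\<^sub>R (c *\<^sub>C x)"
  by (simp add: scaleC_scaleC mult.commute flip: scaleC_of_real)

lemma bounded_bilinear_scaleC: "bounded_bilinear (scaleC :: complex \<Rightarrow> 'a::complex_banach \<Rightarrow> 'a)"
proof (intro bounded_bilinear.intro exI allI)
  fix r c and x :: 'a
  show "(r *\<^sub>R c) *\<^sub>C x = r *\<^sub>R (c *\<^sub>C x)"
    by (simp add: scaleR_conv_of_real scaleC_scaleC flip: scaleC_of_real)
  show "norm (c *\<^sub>C x) \<le> norm c * norm x * 1" by (simp add: norm_scaleC)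
qed (simp_all add: scaleC_add_left scaleC_add_right scaleC_scaleR)

interpretation scaleC: bounded_bilinear "scaleC :: complex \<Rightarrow> 'a::complex_banach \<Rightarrow> 'a"
  by (rule bounded_bilinear_scaleC)

lemmas continuous_on_scaleC [continuous_intros] = scaleC.continuous_on
lemmas tendsto_scaleC [tendsto_intros] = scaleC.tendsto
lemmas scaleC_simps = scaleC_add_left scaleC_add_right scaleC.diff_left scaleC.diff_right
  scaleC.minus_left scaleC.minus_right scaleC_scaleC

lemma bounded_clinear_simps:
  assumes "bounded_clinear T"
  shows "T (x + y) = T x + T y" "T (x - y) = T x - T y" "T 0 = 0" "T (- x) = - T x"
    "T (c *\<^sub>C x) = c *\<^sub>C T x" "T (r *\<^sub>R x) = r *\<^sub>R T x"
  using assms linear_simps[of T] unfolding bounded_clinear_def by blast+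

lemma bounded_clinearD: "bounded_clinear T \<Longrightarrow> bounded_linear T"
  by (simp add: bounded_clinear_def)

lemma integral_bounded_clinear:
  fixes f :: "real \<Rightarrow> 'a::complex_banach"
  assumes "f integrable_on S" "bounded_clinear T"
  shows "integral S (\<lambda>u. T (f u)) = T (integral S f)"
  using integral_linear[OF assms(1) bounded_clinearD[OF assms(2)]] by (simp add: o_def)

lemma integral_scaleC:
  fixes f :: "real \<Rightarrow> 'a::complex_banach"
  assumes "f integrable_on S"
  shows "integral S (\<lambda>u. c *\<^sub>C f u) = c *\<^sub>C integral S f"
  using integral_linear[OF assms scaleC.bounded_linear_right] by (simp add: o_def)

lemma integral_scaleC_left:
  fixes x :: "'a::complex_banach"
  assumes "f integrable_on S"
  shows "integral S (\<lambda>u. f u *\<^sub>C x) = integral S f *\<^sub>C x"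
  using integral_linear[OF assms scaleC.bounded_linear_left] by (simp add: o_def)

text \<open>This is the majorant \<open>C * exp (- e * \<bar>v\<bar>)\<close> carried over by
  \<open>r = exp v\<close>. It equals \<open>C * r powr (e - 1)\<close> for \<open>r\<close> up to
  \<open>1\<close> and \<open>C * r powr (- e - 1)\<close> beyond.\<close>

lemma exp_decay_substitution_bound:
  fixes C e :: real assumes "e > 0"
  defines "b \<equiv> \<lambda>r. if r > 0 then C / r * exp (- e * \<bar>ln r\<bar>) else 0"
  shows "(b has_integral 2 * C / e) UNIV"
proof -
  have "((\<lambda>r. C * r powr (e - 1)) has_integral C * (1 powr (e - 1 + 1) / (e - 1 + 1))) {0..1}"
    using assms has_integral_powr_from_0[of "e - 1" 1] by (intro has_integral_mult_right) auto
  then have 1: "(b has_integral C / e) {0..1}"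
  proof (rule has_integral_eq[rotated, THEN back_subst[of "\<lambda>i. (b has_integral i) {0..1}"]])
    show "C * r powr (e - 1) = b r" if "r \<in> {0..1}" for r
      using that by (cases "r = 0") (auto simp: b_def powr_def abs_if exp_diff algebra_simps)
  qed simp
  have "((\<lambda>r. C * r powr (- e - 1)) has_integral C * (- (1 powr (- e - 1 + 1)) / (- e - 1 + 1))) {1..}"
    by (intro has_integral_mult_right has_integral_powr_to_inf) (use assms(1) in auto)
  then have 2: "(b has_integral C / e) {1..}"
  proof (rule has_integral_eq[rotated, THEN back_subst[of "\<lambda>i. (b has_integral i) {1..}"]])
    show "C * r powr (- e - 1) = b r" if "r \<in> {1..}" for r
      using that by (auto simp: b_def powr_def exp_diff exp_minus algebra_simps)
  qed (use assms in auto)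
  have "(b has_integral C / e + C / e) ({0..1} \<union> {1..})"
    by (rule has_integral_Un[OF 1 2]) (auto intro: negligible_subset[of "{1}"])
  moreover have "{0..1} \<union> {1..} = {0::real..}" by auto
  ultimately have "(b has_integral 2 * C / e) {0..}" by simp
  then have "((\<lambda>r. if r \<in> {0..} then b r else 0) has_integral 2 * C / e) UNIV"
    by (simp only: has_integral_restrict_UNIV)
  moreover have "(\<lambda>r. if r \<in> {0..} then b r else 0) = b"
    by (auto simp: b_def)
  ultimately show ?thesis by simp
qed

lemma integral_exp_substitution_Icc:
  fixes g :: "real \<Rightarrow> 'a::banach"
  assumes "continuous_on {0<..} g" "l \<le> u"
  shows "((\<lambda>v. exp v *\<^sub>R g (exp v)) has_integral integral {exp l..exp u} g) {l..u}"
proof -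
  have c: "continuous_on {exp l..exp u} g"
    using assms(1) by (rule continuous_on_subset) (auto intro: less_le_trans[OF exp_gt_zero])
  define F where "F r = integral {exp l..r} g" for r
  have F: "(F has_vector_derivative g r) (at r within {exp l..exp u})" if "r \<in> {exp l..exp u}" for r
    unfolding F_def using integral_has_vector_derivative[OF c that] .
  have "((\<lambda>v. exp v *\<^sub>R g (exp v)) has_integral ((F \<circ> exp) u - (F \<circ> exp) l)) {l..u}"
  proof (rule fundamental_theorem_of_calculus[OF assms(2)])
    fix v assume v: "v \<in> {l..u}"
    have im: "exp ` {l..u} \<subseteq> {exp l..exp u}" by auto
    have "(F has_vector_derivative g (exp v)) (at (exp v) within exp ` {l..u})"
      using has_vector_derivative_within_subset[OF F im] v by simp
    moreover have "(exp has_vector_derivative exp v) (at v within {l..u})"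
      by (auto intro!: derivative_eq_intros simp flip: has_real_derivative_iff_has_vector_derivative)
    ultimately show "((F \<circ> exp) has_vector_derivative exp v *\<^sub>R g (exp v)) (at v within {l..u})"
      by (rule vector_diff_chain_within[rotated])
  qed
  then show ?thesis by (simp add: F_def)
qed

text \<open>\<open>g\<close> may be unbounded at \<open>0\<close>, so its integrability there has to
  be shown first. Afterwards both sides are limits over windows that correspond to each other,
  \<open>{exp (- n)..exp n}\<close> and \<open>{- n..n}\<close>.\<close>

lemma integral_exp_substitution:
  fixes g :: "real \<Rightarrow> 'a::banach"
  assumes cont: "continuous_on {0<..} g" and dec: "exp_decay C e (\<lambda>v. exp v *\<^sub>R g (exp v))"
  shows "integral {0<..} g = integral UNIV (\<lambda>v. exp v *\<^sub>R g (exp v))"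
proof -
  have e: "e > 0" using exp_decayD(1)[OF dec] .
  define f where "f r = (if r \<in> {0<..} then g r else 0)" for r
  define b where "b = (\<lambda>r. if r > 0 then C / r * exp (- e * \<bar>ln r\<bar>) else 0)"
  have C: "C \<ge> 0" using norm_ge_zero[THEN order_trans, OF exp_decayD(3)[OF dec, of 0]] by simp
  have bi: "(b has_integral 2 * C / e) UNIV"
    using exp_decay_substitution_bound[OF e, of C] by (simp add: b_def)
  have fb: "norm (f r) \<le> b r" for r
    using exp_decayD(3)[OF dec, of "ln r"] by (auto simp: f_def b_def field_simps)
  have fpos: "f integrable_on {l..u}" if "l > 0" for l u
  proof -
    have "g integrable_on {l..u}"
      using that by (intro integrable_continuous_interval continuous_on_subset[OF cont]) auto
    then show ?thesis
      by (rule integrable_eq) (use that in \<open>auto simp: f_def\<close>)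
  qed
  \<comment> \<open>The function is approximated by its restrictions to
    \<open>{\<delta> n..u}\<close>; the error is dominated by \<open>C * r powr (e - 1)\<close> on
    \<open>{0..\<delta> n}\<close>, whose integral tends to \<open>0\<close>.\<close>
  have f0: "f integrable_on {0..u}" if u: "u > 0" for u
  proof -
    define \<delta> where "\<delta> n = u / real (Suc n)" for n
    have \<delta>: "0 < \<delta> n" "\<delta> n \<le> u" for n using u by (auto simp: \<delta>_def field_simps)
    have "f integrable_on cbox 0 u"
    proof (rule has_integral_approximation)
      fix n
      have "(f has_integral integral {\<delta> n..u} f) {\<delta> n..u}" using fpos[OF \<delta>(1)] by blast
      then show "((\<lambda>r. if r \<in> cbox (\<delta> n) u then f r else 0) has_integral integral {\<delta> n..u} f) (cbox 0 u)"
        using \<delta>[of n] by (intro has_integral_restrict_closed_subinterval) auto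
      have "((\<lambda>r. C * r powr (e - 1)) has_integral C * (\<delta> n powr (e - 1 + 1) / (e - 1 + 1))) {0..\<delta> n}"
        using e \<delta>[of n] has_integral_powr_from_0[of "e - 1" "\<delta> n"] by (intro has_integral_mult_right) auto
      then show "((\<lambda>r. if r \<in> cbox 0 (\<delta> n) then C * r powr (e - 1) else 0) has_integral
          C * (\<delta> n powr (e - 1 + 1) / (e - 1 + 1))) (cbox 0 u)"
        using \<delta>[of n] by (intro has_integral_restrict_closed_subinterval) auto
      fix r assume r: "r \<in> cbox 0 u"
      have "b r \<le> C * r powr (e - 1)" if "r > 0"
      proof -
        have "- e * \<bar>ln r\<bar> \<le> e * ln r" using e by (auto simp: abs_if mult_left_mono)
        then have "C * exp (- e * \<bar>ln r\<bar>) / r \<le> C * exp (e * ln r) / r"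
          using that C by (intro divide_right_mono mult_left_mono) auto
        then show ?thesis using that by (simp add: b_def powr_def exp_diff algebra_simps)
      qed
      then show "norm (f r - (if r \<in> cbox (\<delta> n) u then f r else 0)) \<le>
          (if r \<in> cbox 0 (\<delta> n) then C * r powr (e - 1) else 0)"
        using fb[of r] r C by (cases "r = 0") (auto simp: f_def)
    next
      have "(\<lambda>n. C * ((u / real (Suc n)) powr (e - 1 + 1) / (e - 1 + 1))) \<longlonglongrightarrow> 0"
        using u e by real_asymp
      then show "(\<lambda>n. C * (\<delta> n powr (e - 1 + 1) / (e - 1 + 1))) \<longlonglongrightarrow> 0"
        by (simp only: \<delta>_def)
    qed
    then show ?thesis by simp
  qed
  have fi: "f integrable_on {l..u}" for l u
  proof -
    have "f integrable_on {- \<bar>l\<bar>..0}" by (rule integrable_eq[OF integrable_0]) (auto simp: f_def)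
    moreover have "f integrable_on {0..\<bar>u\<bar> + 1}" by (rule f0) auto
    ultimately have "f integrable_on {- \<bar>l\<bar>..\<bar>u\<bar> + 1}" using Henstock_Kurzweil_Integration.integrable_combine[of "- \<bar>l\<bar>" 0 "\<bar>u\<bar> + 1" f] by simp
    then show ?thesis by (rule integrable_on_subinterval) auto
  qed
  have fU: "f integrable_on UNIV"
    using integrable_UNIV_dominated[OF fi _ fb] bi by blast
  let ?h = "\<lambda>v. exp v *\<^sub>R g (exp v)"
  have bound: "norm (integral UNIV f - integral {- real n..real n} ?h) \<le> 2 * C * exp (- e * real n) / e" for n
  proof -
    have sub: "{exp (- real n)..exp (real n)} \<subseteq> {- real m..real m}" if "m \<ge> nat \<lceil>exp (real n)\<rceil>" for m
    proof -
      have "exp (real n) \<le> real m" using that by linarith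
      moreover have "- real m \<le> exp (- real n)"
        using order_trans[of "- real m" 0 "exp (- real n)"] by simp
      ultimately show ?thesis by simp
    qed
    have eq: "integral {exp (- real n)..exp (real n)} f = integral {- real n..real n} ?h"
    proof -
      have "integral {exp (- real n)..exp (real n)} f = integral {exp (- real n)..exp (real n)} g"
        by (rule integral_cong) (auto simp: f_def intro: less_le_trans[OF exp_gt_zero])
      then show ?thesis
        using integral_exp_substitution_Icc[OF cont, of "- real n" "real n"] by (simp add: integral_unique)
    qed
    have eqb: "integral {exp (- real n)..exp (real n)} b = C * ((2 - exp (e * - real n) - exp (- e * real n)) / e)"
    proof -
      have "((\<lambda>v. exp v *\<^sub>R b (exp v)) has_integral integral {exp (- real n)..exp (real n)} b) {- real n..real n}"
      proof (rule integral_exp_substitution_Icc)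
        have "continuous_on {0<..} (\<lambda>r. C / r * exp (- e * \<bar>ln r\<bar>))"
          by (intro continuous_intros) auto
        then show "continuous_on {0<..} b" by (rule continuous_on_eq) (auto simp: b_def)
      qed simp
      moreover have "((\<lambda>v. exp v *\<^sub>R b (exp v)) has_integral C * ((2 - exp (e * - real n) - exp (- e * real n)) / e)) {- real n..real n}"
        by (rule has_integral_eq[OF _ has_integral_mult_right[OF integral_exp_neg_Icc[OF e]]]) (auto simp: b_def)
      ultimately show ?thesis by (rule has_integral_unique)
    qed
    have "norm (integral {- real m..real m} f - integral {- real n..real n} ?h) \<le> 2 * C * exp (- e * real n) / e"
      if "m \<ge> nat \<lceil>exp (real n)\<rceil>" for m
    proof -
      have "norm (integral {- real m..real m} f - integral {- real n..real n} ?h) \<le>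
          2 * C / e - C * ((2 - exp (e * - real n) - exp (- e * real n)) / e)"
        using integral_tail_dominated[OF fi has_integral_integrable[OF bi] fb sub[OF that]]
        unfolding eq eqb integral_unique[OF bi] .
      also have "\<dots> = 2 * C * exp (- e * real n) / e" using e by (simp add: field_simps)
      finally show ?thesis .
    qed
    then have "\<forall>\<^sub>F m in sequentially.
        norm (integral {- real m..real m} f - integral {- real n..real n} ?h) \<le> 2 * C * exp (- e * real n) / e"
      unfolding eventually_sequentially by blast
    then show ?thesis
      by (rule Lim_norm_ubound[rotated 2])
         (auto intro!: tendsto_diff tendsto_const integral_UNIV_tendsto[OF fU])
  qed
  have "(\<lambda>n. 2 * C * exp (- e * real n) / e) \<longlonglongrightarrow> 0" using e by real_asymp
  then have "(\<lambda>n. integral UNIV f - integral {- real n..real n} ?h) \<longlonglongrightarrow> 0"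
    by (rule Lim_null_comparison[OF always_eventually[OF allI[OF bound]]])
  from tendsto_diff[OF tendsto_const[of "integral UNIV f"] this]
  have "(\<lambda>n. integral {- real n..real n} ?h) \<longlonglongrightarrow> integral UNIV f" by simp
  then have "integral UNIV f = integral UNIV ?h"
    using integral_UNIV_tendsto[OF exp_decay_integrable(1)[OF dec]] LIMSEQ_unique by blast
  then show ?thesis unfolding f_def by (simp add: integral_restrict_UNIV[of "{0<..}" g, simplified])
qed

text \<open>Cauchy's theorem for rectangles from the fundamental theorem of calculus in both
  directions: the difference of the horizontal integrals is a double integral of
  \<open>\<i> *\<^sub>C H'\<close>, and integrating first along \<open>u\<close> leaves values of
  \<open>H\<close> on the vertical sides, which decay.\<close>

lemma integral_line_shift:
  fixes H H' :: "complex \<Rightarrow> 'a::complex_banach"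
  assumes t: "t0 \<le> t1"
    and der: "\<And>z. t0 \<le> Im z \<Longrightarrow> Im z \<le> t1 \<Longrightarrow> (H has_derivative (\<lambda>h. h *\<^sub>C H' z)) (at z)"
    and cont: "continuous_on {z. t0 \<le> Im z \<and> Im z \<le> t1} H'"
    and e: "e > 0" and le: "\<And>z. t0 \<le> Im z \<Longrightarrow> Im z \<le> t1 \<Longrightarrow> norm (H z) \<le> C * exp (- e * \<bar>Re z\<bar>)"
  shows "integral UNIV (\<lambda>u. H (Complex u t0)) = integral UNIV (\<lambda>u. H (Complex u t1))"
proof -
  let ?S = "{z. t0 \<le> Im z \<and> Im z \<le> t1}"
  have contH: "continuous_on ?S H"
    using der has_derivative_continuous by (fastforce intro!: continuous_at_imp_continuous_on)
  have C: "C \<ge> 0" using norm_ge_zero[THEN order_trans, OF le[of "Complex 0 t0"]] t by simp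
  have line: "exp_decay C e (\<lambda>u. H (Complex u s))" if "t0 \<le> s" "s \<le> t1" for s
    unfolding exp_decay_def using that e le[of "Complex _ s"]
    by (auto intro!: continuous_on_compose2[OF contH] continuous_intros simp: Complex_eq)
  have vert: "integral {t0..t1} (\<lambda>s. \<i> *\<^sub>C H' (Complex u s)) = H (Complex u t1) - H (Complex u t0)" for u
  proof (intro integral_unique fundamental_theorem_of_calculus[OF t])
    fix s assume "s \<in> {t0..t1}"
    have "((\<lambda>s. H (Complex u s)) has_derivative (\<lambda>h. (h *\<^sub>R \<i>) *\<^sub>C H' (Complex u s))) (at s within {t0..t1})"
      unfolding Complex_eq using \<open>s \<in> {t0..t1}\<close>
      by (intro has_derivative_compose[of _ _ _ _ H, OF _ der] derivative_eq_intros)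
         (auto simp: scaleR_conv_of_real mult.commute)
    then show "((\<lambda>s. H (Complex u s)) has_vector_derivative \<i> *\<^sub>C H' (Complex u s)) (at s within {t0..t1})"
      by (simp add: has_vector_derivative_def scaleC.scaleR_left)
  qed
  have hor: "integral {l..r} (\<lambda>u. \<i> *\<^sub>C H' (Complex u s)) = \<i> *\<^sub>C (H (Complex r s) - H (Complex l s))"
    if "s \<in> {t0..t1}" "l \<le> r" for l r s
  proof -
    have "((\<lambda>u. H' (Complex u s)) has_integral (H (Complex r s) - H (Complex l s))) {l..r}"
    proof (rule fundamental_theorem_of_calculus[OF that(2)])
      fix u assume "u \<in> {l..r}"
      have "((\<lambda>u. H (Complex u s)) has_derivative (\<lambda>h. (h *\<^sub>R 1) *\<^sub>C H' (Complex u s))) (at u within {l..r})"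
        unfolding Complex_eq using \<open>s \<in> {t0..t1}\<close>
        by (intro has_derivative_compose[of _ _ _ _ H, OF _ der] derivative_eq_intros)
           (auto simp: scaleR_conv_of_real)
      then show "((\<lambda>u. H (Complex u s)) has_vector_derivative H' (Complex u s)) (at u within {l..r})"
        by (simp only: has_vector_derivative_def scaleC.scaleR_left scaleC_one)
    qed
    then show ?thesis using integral_scaleC[of "\<lambda>u. H' (Complex u s)" "{l..r}" \<i>] by (auto simp: integral_unique)
  qed
  have int: "(\<lambda>u. H (Complex u s)) integrable_on {l..r}" if "t0 \<le> s" "s \<le> t1" for l r s
    using exp_decayD(2)[OF line[OF that]] by (rule integrable_continuous_interval)
  have bound: "norm (integral {- real n..real n} (\<lambda>u. H (Complex u t1)) - integral {- real n..real n} (\<lambda>u. H (Complex u t0)))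
      \<le> 2 * C * exp (- e * real n) * (t1 - t0)" for n
  proof -
    have "integral {- real n..real n} (\<lambda>u. H (Complex u t1)) - integral {- real n..real n} (\<lambda>u. H (Complex u t0))
        = integral {- real n..real n} (\<lambda>u. integral {t0..t1} (\<lambda>s. \<i> *\<^sub>C H' (Complex u s)))"
      unfolding vert using t by (subst integral_diff) (auto intro: int)
    also have "\<dots> = integral {t0..t1} (\<lambda>s. integral {- real n..real n} (\<lambda>u. \<i> *\<^sub>C H' (Complex u s)))"
    proof -
      have "continuous_on (cbox (- real n, t0) (real n, t1)) (\<lambda>(u, s). \<i> *\<^sub>C H' (Complex u s))"
        unfolding split_def Complex_eq
        by (intro continuous_intros continuous_on_compose2[OF cont]) (auto simp: cbox_Pair_eq)
      from integral_swap_continuous[OF this] show ?thesis by simp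
    qed
    also have "\<dots> = integral {t0..t1} (\<lambda>s. \<i> *\<^sub>C (H (Complex (real n) s) - H (Complex (- real n) s)))"
      by (rule integral_cong) (auto simp: hor)
    also have "norm \<dots> \<le> 2 * C * exp (- e * real n) * measure lborel (cbox t0 t1)"
      unfolding box_real(2)[symmetric]
    proof (rule integrable_bound)
      show "(\<lambda>s. \<i> *\<^sub>C (H (Complex (real n) s) - H (Complex (- real n) s))) integrable_on cbox t0 t1"
        unfolding box_real(2) Complex_eq
        by (intro integrable_continuous_interval continuous_intros continuous_on_compose2[OF contH]) auto
      show "norm (\<i> *\<^sub>C (H (Complex (real n) s) - H (Complex (- real n) s))) \<le> 2 * C * exp (- e * real n)"
        if "s \<in> cbox t0 t1" for s
        using that le[of "Complex (real n) s"] le[of "Complex (- real n) s"]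
          norm_triangle_ineq4[of "H (Complex (real n) s)" "H (Complex (- real n) s)"]
        by (simp add: norm_scaleC)
    qed (use C in simp)
    finally show ?thesis using t by simp
  qed
  have "(\<lambda>n. 2 * C * exp (- e * real n) * (t1 - t0)) \<longlonglongrightarrow> 0" using e by real_asymp
  then have "(\<lambda>n. integral {- real n..real n} (\<lambda>u. H (Complex u t1)) - integral {- real n..real n} (\<lambda>u. H (Complex u t0))) \<longlonglongrightarrow> 0"
    by (rule Lim_null_comparison[OF always_eventually[OF allI[OF bound]]])
  moreover have "(\<lambda>n. integral {- real n..real n} (\<lambda>u. H (Complex u t1)) - integral {- real n..real n} (\<lambda>u. H (Complex u t0)))
      \<longlonglongrightarrow> integral UNIV (\<lambda>u. H (Complex u t1)) - integral UNIV (\<lambda>u. H (Complex u t0))"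
    using t by (intro tendsto_diff integral_UNIV_tendsto exp_decay_integrable(1)[OF line]) auto
  ultimately show ?thesis using LIMSEQ_unique by fastforce
qed

section \<open>The Cauchy kernel in logarithmic coordinates\<close>

text \<open>With \<open>z = exp b\<close> and \<open>w = exp a\<close> one has \<open>z / (z - w) = exp_kernel (b - a)\<close>.\<close>

definition exp_kernel :: "complex \<Rightarrow> complex" where
  "exp_kernel c = 1 / (1 - exp (- c))"

text \<open>The hypotheses keep \<theta> at distance \<delta> from \<open>0\<close>,
  \<open>2 * pi\<close> and \<open>- 2 * pi\<close>, where \<open>cos\<close> is
  \<open>1\<close>.\<close>

lemma cos_le_of_gap:
  assumes "0 < \<delta>" "\<delta> \<le> pi" "\<delta> \<le> \<bar>\<theta>\<bar>" "\<bar>\<theta>\<bar> \<le> 2 * pi - \<delta>"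
  shows "cos \<theta> \<le> cos \<delta>"
proof (cases "\<bar>\<theta>\<bar> \<le> pi")
  case True
  then show ?thesis using assms cos_mono_le_eq[of "\<bar>\<theta>\<bar>" \<delta>] by simp
next
  case False
  have "cos (2 * pi - \<bar>\<theta>\<bar>) \<le> cos \<delta>"
    using assms False by (subst cos_mono_le_eq) auto
  then show ?thesis by (simp add: cos_diff)
qed

text \<open>With \<open>\<rho> = exp (- Re c)\<close> the squared modulus is
  \<open>1 - 2 \<rho> cos (Im c) + \<rho>\<^sup>2\<close>. Replacing \<open>Im c\<close> by \<delta>
  does not increase it, and the remaining gap is
  \<open>(cos (\<delta> / 2))\<^sup>2 (1 - \<rho>)\<^sup>2\<close>.\<close>

lemma cmod_one_minus_exp_ge:
  assumes "0 < \<delta>" "\<delta> \<le> pi" "\<delta> \<le> \<bar>Im c\<bar>" "\<bar>Im c\<bar> \<le> 2 * pi - \<delta>"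
  shows "sin (\<delta> / 2) * (1 + exp (- Re c)) \<le> cmod (1 - exp (- c))"
proof (rule power2_le_imp_le)
  define \<rho> where "\<rho> = exp (- Re c)"
  have \<rho>: "\<rho> > 0" by (simp add: \<rho>_def)
  have half: "(sin (\<delta> / 2))\<^sup>2 = (1 - cos \<delta>) / 2"
    using cos_double_sin[of "\<delta> / 2"] by simp
  have "(cmod (1 - exp (- c)))\<^sup>2 = (1 - \<rho> * cos (Im c))\<^sup>2 + (\<rho> * sin (Im c))\<^sup>2"
    by (simp add: cmod_power2 Re_exp Im_exp \<rho>_def)
  also have "\<dots> = 1 - 2 * \<rho> * cos (Im c) + \<rho>\<^sup>2 * ((cos (Im c))\<^sup>2 + (sin (Im c))\<^sup>2)"
    by algebra
  also have "\<dots> = 1 - 2 * \<rho> * cos (Im c) + \<rho>\<^sup>2" by simp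
  finally have eq: "(cmod (1 - exp (- c)))\<^sup>2 = 1 - 2 * \<rho> * cos (Im c) + \<rho>\<^sup>2" .
  have "\<rho> * cos (Im c) \<le> \<rho> * cos \<delta>"
    using cos_le_of_gap[OF assms] \<rho> by (intro mult_left_mono) auto
  moreover have "(1 - cos \<delta>) / 2 * (1 + \<rho>)\<^sup>2 \<le> 1 - 2 * \<rho> * cos \<delta> + \<rho>\<^sup>2"
  proof -
    have "1 - 2 * \<rho> * cos \<delta> + \<rho>\<^sup>2 - (1 - cos \<delta>) / 2 * (1 + \<rho>)\<^sup>2 = (1 + cos \<delta>) / 2 * (1 - \<rho>)\<^sup>2"
      by (simp add: field_simps power2_eq_square)
    moreover have "0 \<le> (1 + cos \<delta>) / 2 * (1 - \<rho>)\<^sup>2"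
      using cos_ge_minus_one[of \<delta>] by (intro mult_nonneg_nonneg divide_nonneg_nonneg) (linarith, simp_all)
    ultimately show ?thesis by linarith
  qed
  ultimately show "(sin (\<delta> / 2) * (1 + exp (- Re c)))\<^sup>2 \<le> (cmod (1 - exp (- c)))\<^sup>2"
    unfolding eq power_mult_distrib half \<rho>_def[symmetric] by linarith
qed simp

lemma sin_half_pos: "0 < \<delta> \<Longrightarrow> \<delta> \<le> pi \<Longrightarrow> 0 < sin (\<delta> / 2)"
  by (rule sin_gt_zero) auto

text \<open>The weight \<open>1 + exp (- Re c)\<close> in the second bound records the decay of the
  kernel as \<open>Re c\<close> tends to minus infinity; \<open>cmod_logistic_le\<close> relies on
  it.\<close>

lemma cmod_exp_kernel_le:
  assumes "0 < \<delta>" "\<delta> \<le> pi" "\<delta> \<le> \<bar>Im c\<bar>" "\<bar>Im c\<bar> \<le> 2 * pi - \<delta>"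
  shows "1 - exp (- c) \<noteq> 0" "cmod (exp_kernel c) * (1 + exp (- Re c)) \<le> 1 / sin (\<delta> / 2)"
    "cmod (exp_kernel c) \<le> 1 / sin (\<delta> / 2)"
proof -
  have s: "0 < sin (\<delta> / 2)" using assms sin_half_pos by blast
  have p: "0 < 1 + exp (- Re c)" by (simp add: add_pos_pos)
  have le: "sin (\<delta> / 2) * (1 + exp (- Re c)) \<le> cmod (1 - exp (- c))"
    by (rule cmod_one_minus_exp_ge[OF assms])
  then have pos: "0 < cmod (1 - exp (- c))" using mult_pos_pos[OF s p] by linarith
  then show "1 - exp (- c) \<noteq> 0" by auto
  show *: "cmod (exp_kernel c) * (1 + exp (- Re c)) \<le> 1 / sin (\<delta> / 2)"
    using le s pos by (simp add: exp_kernel_def norm_divide field_simps)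
  have "cmod (exp_kernel c) * 1 \<le> cmod (exp_kernel c) * (1 + exp (- Re c))"
    by (intro mult_left_mono) auto
  with * show "cmod (exp_kernel c) \<le> 1 / sin (\<delta> / 2)" by linarith
qed

text \<open>For the vertical sides of rectangles, where \<open>Im c\<close> may be \<open>0\<close>
  and the real part alone keeps \<open>c\<close> away from the pole.\<close>

lemma cmod_exp_kernel_le_2:
  assumes "1 \<le> \<bar>Re c\<bar>"
  shows "cmod (exp_kernel c) \<le> 2"
proof -
  have e: "2 \<le> exp (1::real)" using exp_ge_add_one_self[of 1] by simp
  have "1/2 \<le> \<bar>1 - exp (- Re c)\<bar>"
  proof (cases "Re c \<ge> 1")
    case True
    then have "exp (- Re c) \<le> exp (- 1)" by simp
    also have "\<dots> \<le> 1/2" using e by (simp add: exp_minus field_simps)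
    finally show ?thesis by linarith
  next
    case False
    then have "exp 1 \<le> exp (- Re c)" using assms by auto
    then show ?thesis using e by linarith
  qed
  also have "\<dots> \<le> cmod (1 - exp (- c))"
    using norm_triangle_ineq3[of 1 "exp (- c)"] by (simp add: norm_exp_eq_Re)
  finally show ?thesis unfolding exp_kernel_def by (simp add: norm_divide divide_simps)
qed

lemma exp_eq_1_small:
  assumes "exp (- c) = (1::complex)" "\<bar>Im c\<bar> < 2 * pi"
  shows "c = 0"
proof -
  obtain n :: int where n: "Re (- c) = 0" "Im (- c) = of_int (2 * n) * pi"
    using assms(1) unfolding exp_eq_1 by auto
  have "\<bar>of_int (2 * n) * pi\<bar> < 2 * pi" using n(2) assms(2) by simp
  then have "\<bar>real_of_int n\<bar> < 1" by (simp add: abs_mult)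
  then have "n = 0" by linarith
  then show ?thesis using n by (simp add: complex_eq_iff)
qed

text \<open>In this strip \<open>0\<close> is the only pole of \<open>exp_kernel\<close>; it is
  simple with residue \<open>1\<close>, so the factor \<open>c\<close> removes it.\<close>

lemma holomorphic_mult_exp_kernel:
  "(\<lambda>c. if c = 0 then 1 else c * exp_kernel c) holomorphic_on {c. \<bar>Im c\<bar> < 2 * pi}" (is "?q holomorphic_on ?S")
proof (rule no_isolated_singularity'[of "{0}"])
  have S: "?S = {c. Im c < 2 * pi} \<inter> {c. - (2 * pi) < Im c}" by auto
  show "open ?S" unfolding S by (intro open_Int open_halfspace_Im_lt open_halfspace_Im_gt)
  have "(\<lambda>c. c * exp_kernel c) holomorphic_on (?S - {0})"
    unfolding exp_kernel_def using exp_eq_1_small by (intro holomorphic_intros) force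
  then show "?q holomorphic_on (?S - {0})"
    by (rule holomorphic_transform) auto
  fix z :: complex assume "z \<in> {0}"
  have "((\<lambda>c. 1 - exp (- c)) has_field_derivative 1) (at (0::complex))"
    by (auto intro!: derivative_eq_intros)
  then have "((\<lambda>c. (1 - exp (- c)) / c) \<longlongrightarrow> 1) (at (0::complex))"
    by (simp add: has_field_derivative_iff[where f = "\<lambda>c::complex. 1 - exp (- c)"])
  then have "((\<lambda>c. inverse ((1 - exp (- c)) / c)) \<longlongrightarrow> inverse 1) (at (0::complex))"
    by (rule tendsto_inverse) simp
  then have "((\<lambda>c. inverse ((1 - exp (- c)) / c)) \<longlongrightarrow> 1) (at (0::complex))" by simp
  then have "(?q \<longlongrightarrow> 1) (at 0)"
    by (rule Lim_transform_eventually) (auto simp: eventually_at exp_kernel_def intro: exI[of _ 1])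
  then show "(?q \<longlongrightarrow> ?q z) (at z within ?S)"
    using \<open>z \<in> {0}\<close> by (auto intro: tendsto_within_subset)
qed simp

lemma contour_integral_linepath_same_Im:
  assumes "l < r"
  shows "contour_integral (linepath (Complex l t) (Complex r t)) f = integral {l..r} (\<lambda>x. f (Complex x t))"
proof -
  have "contour_integral (linepath (Complex l t) (Complex r t)) f =
      of_real (r - l) * integral {0..1} (\<lambda>x. f (linepath (Complex l t) (Complex r t) x))"
  proof -
    have "Complex r t - Complex l t = of_real (r - l)" by (simp add: complex_eq_iff)
    then show ?thesis by (simp add: contour_integral_integral)
  qed
  also have "integral {0..1} (\<lambda>x. f (linepath (Complex l t) (Complex r t) x)) =
      integral {0..(r - l) / (r - l)} (\<lambda>x. f (Complex (l + (r - l) * x) t))"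
  proof -
    have "linepath (Complex l t) (Complex r t) x = Complex (l + (r - l) * x) t" for x
      by (simp add: linepath_def complex_eq_iff algebra_simps)
    then show ?thesis using assms by simp
  qed
  also have "{0..(r - l) / (r - l)} = (\<lambda>x. x / (r - l)) ` {0..r - l}"
    using assms by simp
  also have "integral \<dots> (\<lambda>x. f (Complex (l + (r - l) * x) t)) =
      integral {l - l..r - l} (\<lambda>x. f (Complex (x + l) t)) / of_real (r - l)"
    using assms by (subst integral_stretch_real) (auto simp: scaleR_conv_of_real add_ac field_simps)
  also have "\<dots> = integral {l..r} (\<lambda>x. f (Complex x t)) / of_real (r - l)"
    by (subst integral_shift_real_ivl) auto
  finally show ?thesis using assms by simp
qed

lemma closed_segment_Im: "z \<in> closed_segment a b \<Longrightarrow> Im z \<in> closed_segment (Im a) (Im b)"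
  and closed_segment_Re: "z \<in> closed_segment a b \<Longrightarrow> Re z \<in> closed_segment (Re a) (Re b)"
  by (auto simp: closed_segment_def)

text \<open>The residue of \<open>exp_kernel (w - a)\<close> at \<open>w = a\<close> is
  \<open>1\<close>, so Cauchy's formula applies to rectangles, and their vertical sides contribute
  nothing in the limit. The bound \<open>r \<le> pi\<close> keeps
  \<open>\<bar>Im (w - a)\<bar>\<close> below \<open>2 * pi\<close>, which excludes the other poles
  of the kernel.\<close>

lemma Cauchy_formula_two_lines:
  assumes h: "h holomorphic_on {z. \<bar>Im z\<bar> < r}" and r: "\<nu> < r" "r \<le> pi" and a: "\<bar>Im a\<bar> < \<nu>"
    and e: "e > 0" and le: "\<And>z. \<bar>Im z\<bar> < r \<Longrightarrow> cmod (h z) \<le> C * exp (- e * \<bar>Re z\<bar>)"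
    and int: "(\<lambda>u. h (Complex u (- \<nu>)) * exp_kernel (Complex u (- \<nu>) - a)) integrable_on UNIV"
      "(\<lambda>u. h (Complex u \<nu>) * exp_kernel (Complex u \<nu> - a)) integrable_on UNIV"
  shows "integral UNIV (\<lambda>u. h (Complex u (- \<nu>)) * exp_kernel (Complex u (- \<nu>) - a)) -
      integral UNIV (\<lambda>u. h (Complex u \<nu>) * exp_kernel (Complex u \<nu> - a)) = 2 * pi * \<i> * h a"
proof -
  let ?S = "{z. \<bar>Im z\<bar> < r}"
  let ?g = "\<lambda>w. h w * exp_kernel (w - a)"
  define q where "q c = (if c = 0 then 1 else c * exp_kernel c)" for c
  define f where "f w = h w * q (w - a)" for w
  have C: "C \<ge> 0" using norm_ge_zero[THEN order_trans, OF le[of 0]] r a by simp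
  have S: "?S = {c. Im c < r} \<inter> {c. - r < Im c}" by auto
  have opS: "open ?S" unfolding S by (intro open_Int open_halfspace_Im_lt open_halfspace_Im_gt)
  have cvS: "convex ?S" unfolding S by (intro convex_Int convex_halfspace_Im_lt convex_halfspace_Im_gt)
  have holf: "f holomorphic_on ?S"
    unfolding f_def q_def
  proof (intro holomorphic_on_mult h)
    have "(\<lambda>c. if c = 0 then 1 else c * exp_kernel c) \<circ> (\<lambda>w. w - a) holomorphic_on ?S"
      by (rule holomorphic_on_compose_gen[OF _ holomorphic_mult_exp_kernel])
         (use a r in \<open>auto intro!: holomorphic_intros\<close>)
    then show "(\<lambda>w. if w - a = 0 then 1 else (w - a) * exp_kernel (w - a)) holomorphic_on ?S"
      by (simp add: o_def)
  qed
  have contg: "continuous_on (?S - {a}) ?g"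
  proof -
    have "continuous_on (?S - {a}) (\<lambda>w. f w / (w - a))"
      by (intro continuous_intros continuous_on_subset[OF holomorphic_on_imp_continuous_on[OF holf]]) auto
    then show ?thesis by (rule continuous_on_eq) (auto simp: f_def q_def)
  qed
  define V where "V n = contour_integral (linepath (Complex (real n) (- \<nu>)) (Complex (real n) \<nu>)) ?g +
      contour_integral (linepath (Complex (- real n) \<nu>) (Complex (- real n) (- \<nu>))) ?g" for n
  define L where "L t n = integral {- real n..real n} (\<lambda>u. ?g (Complex u t))" for t n
  \<comment> \<open>Vertical sides with \<open>n \<ge> N\<close> are at distance at least
    \<open>1\<close> from \<open>a\<close>, as \<open>cmod_exp_kernel_le_2\<close> demands.\<close>
  define N where "N = nat \<lceil>\<bar>Re a\<bar>\<rceil> + 1"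
  have N: "\<bar>Re a\<bar> + 1 \<le> real n" if "n \<ge> N" for n
    using that unfolding N_def by linarith
  have eq: "L (- \<nu>) n - L \<nu> n + V n = 2 * pi * \<i> * h a" if n: "n \<ge> N" for n
  proof -
    let ?a1 = "Complex (- real n) (- \<nu>)" and ?a2 = "Complex (real n) (- \<nu>)"
      and ?a3 = "Complex (real n) \<nu>" and ?a4 = "Complex (- real n) \<nu>"
    have Ra: "- real n < Re a" "Re a < real n" using N[OF n] by auto
    have box: "a \<in> box ?a1 ?a3" using Ra a by (auto simp: in_box_complex_iff)
    have pim: "path_image (rectpath ?a1 ?a3) \<subseteq> ?S - {a}"
      using r a Ra by (auto simp: path_image_rectpath)
    have "((\<lambda>w. f w / (w - a)) has_contour_integral (2*pi * \<i> * winding_number (rectpath ?a1 ?a3) a * f a)) (rectpath ?a1 ?a3)"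
      by (rule Cauchy_integral_formula_convex_simple[OF cvS holf])
         (use opS a r pim in \<open>auto simp: interior_open\<close>)
    then have "((\<lambda>w. f w / (w - a)) has_contour_integral (2*pi * \<i> * h a)) (rectpath ?a1 ?a3)"
      using winding_number_rectpath[OF box] by (simp add: f_def q_def)
    then have "(?g has_contour_integral (2*pi * \<i> * h a)) (rectpath ?a1 ?a3)"
      by (rule has_contour_integral_eq) (use pim in \<open>auto simp: f_def q_def\<close>)
    then have total: "contour_integral (rectpath ?a1 ?a3) ?g = 2*pi * \<i> * h a"
      by (rule contour_integral_unique)
    have seg: "closed_segment x y \<subseteq> ?S - {a}" if "(x, y) \<in> {(?a1, ?a2), (?a2, ?a3), (?a3, ?a4), (?a4, ?a1), (?a1, ?a4), (?a2, ?a1), (?a4, ?a3)}" for x y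
    proof
      fix z assume z: "z \<in> closed_segment x y"
      show "z \<in> ?S - {a}"
        using closed_segment_Im[OF z] closed_segment_Re[OF z] that r a Ra
        by (auto simp: closed_segment_eq_real_ivl split: if_splits)
    qed
    have ci: "?g contour_integrable_on linepath x y" if "(x, y) \<in> {(?a1, ?a2), (?a2, ?a3), (?a3, ?a4), (?a4, ?a1), (?a1, ?a4), (?a2, ?a1), (?a4, ?a3)}" for x y
      using seg[OF that] by (intro contour_integrable_continuous_linepath continuous_on_subset[OF contg])
    have "contour_integral (rectpath ?a1 ?a3) ?g =
        contour_integral (linepath ?a1 ?a2) ?g + (contour_integral (linepath ?a2 ?a3) ?g +
        (contour_integral (linepath ?a3 ?a4) ?g + contour_integral (linepath ?a4 ?a1) ?g))"
      unfolding rectpath_def Let_def complex.sel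
      by (simp add: ci contour_integrable_joinI)
    also have "contour_integral (linepath ?a3 ?a4) ?g = - contour_integral (linepath ?a4 ?a3) ?g"
      using contour_integral_reverse_linepath[of ?a3 ?a4 ?g]
        continuous_on_subset[OF contg seg[of ?a3 ?a4]] by simp
    also have "contour_integral (linepath ?a1 ?a2) ?g = L (- \<nu>) n"
      unfolding L_def using Ra by (intro contour_integral_linepath_same_Im) auto
    also have "contour_integral (linepath ?a4 ?a3) ?g = L \<nu> n"
      unfolding L_def using Ra by (intro contour_integral_linepath_same_Im) auto
    finally show ?thesis using total by (simp add: V_def algebra_simps)
  qed
  have vb: "norm (V n) \<le> 8 * \<nu> * C * exp (- e * real n)" if n: "n \<ge> N" for n
  proof -
    have one: "norm (contour_integral (linepath (Complex x s) (Complex x t)) ?g) \<le> (2 * C * exp (- e * real n)) * (2 * \<nu>)"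
      if x: "\<bar>x\<bar> = real n" and st: "(s, t) \<in> {(\<nu>, - \<nu>), (- \<nu>, \<nu>)}" for x s t
    proof -
      have sub: "closed_segment (Complex x s) (Complex x t) \<subseteq> {z. \<bar>Re z\<bar> = real n \<and> \<bar>Im z\<bar> < r}"
      proof
        fix z assume z: "z \<in> closed_segment (Complex x s) (Complex x t)"
        show "z \<in> {z. \<bar>Re z\<bar> = real n \<and> \<bar>Im z\<bar> < r}"
          using closed_segment_Im[OF z] closed_segment_Re[OF z] x st r a
          by (auto simp: closed_segment_eq_real_ivl split: if_splits)
      qed
      have "norm (contour_integral (linepath (Complex x s) (Complex x t)) ?g) \<le>
          (2 * C * exp (- e * real n)) * norm (Complex x t - Complex x s)"
      proof (rule contour_integral_bound_linepath)
        show "?g contour_integrable_on linepath (Complex x s) (Complex x t)"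
          using sub N[OF n] by (intro contour_integrable_continuous_linepath continuous_on_subset[OF contg]) auto
        fix z assume "z \<in> closed_segment (Complex x s) (Complex x t)"
        then have z: "\<bar>Re z\<bar> = real n" "\<bar>Im z\<bar> < r" using sub by auto
        have "cmod (h z) \<le> C * exp (- e * real n)" using le[OF z(2)] z(1) by simp
        moreover have "cmod (exp_kernel (z - a)) \<le> 2"
          using z(1) N[OF n] by (intro cmod_exp_kernel_le_2) auto
        ultimately have "cmod (h z) * cmod (exp_kernel (z - a)) \<le> (C * exp (- e * real n)) * 2"
          using C by (intro mult_mono) auto
        then show "norm (h z * exp_kernel (z - a)) \<le> 2 * C * exp (- e * real n)"
          by (simp add: norm_mult)
      qed (use C in auto)
      also have "norm (Complex x t - Complex x s) = 2 * \<nu>"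
        using st a by (auto simp: cmod_def)
      finally show ?thesis .
    qed
    show ?thesis unfolding V_def
      using norm_triangle_mono[OF one[of "real n" "- \<nu>" \<nu>] one[of "- real n" \<nu> "- \<nu>"]] by (simp add: mult_ac)
  qed
  have "(\<lambda>n. 8 * \<nu> * C * exp (- e * real n)) \<longlonglongrightarrow> 0" using e by real_asymp
  moreover have "\<forall>\<^sub>F n in sequentially. norm (V n) \<le> 8 * \<nu> * C * exp (- e * real n)"
    unfolding eventually_sequentially using vb by blast
  ultimately have V: "V \<longlonglongrightarrow> 0" by (rule Lim_null_comparison[rotated])
  have L: "(\<lambda>n. L (- \<nu>) n - L \<nu> n + V n) \<longlonglongrightarrow>
      integral UNIV (\<lambda>u. ?g (Complex u (- \<nu>))) - integral UNIV (\<lambda>u. ?g (Complex u \<nu>)) + 0"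
    unfolding L_def by (intro tendsto_intros V integral_UNIV_tendsto int)
  have "(\<lambda>n. L (- \<nu>) n - L \<nu> n + V n) \<longlonglongrightarrow> 2 * pi * \<i> * h a"
    by (rule tendsto_eventually) (use eq in \<open>auto simp: eventually_sequentially\<close>)
  from LIMSEQ_unique[OF L this] show ?thesis by simp
qed

section \<open>Integrals over the boundary of a strip\<close>

definition line_decay :: "real \<Rightarrow> real \<Rightarrow> real \<Rightarrow> (complex \<Rightarrow> 'a::real_normed_vector) \<Rightarrow> bool" where
  "line_decay \<nu> C e H \<longleftrightarrow> 0 < e \<and> continuous_on {z. \<bar>Im z\<bar> = \<nu>} H \<and>
     (\<forall>z. \<bar>Im z\<bar> = \<nu> \<longrightarrow> norm (H z) \<le> C * exp (- e * \<bar>Re z\<bar>))"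

text \<open>The substitution \<open>z = exp a\<close> turns the boundary of the sector of half-angle \<open>\<nu>\<close> into two lines and
  \<open>dz / z\<close> into \<open>da\<close>; the Dunford--Riesz integral of \<open>h\<close> becomes the boundary integral of \<open>h G\<close> with
  \<open>G a = z R(z, A)\<close>.\<close>

definition boundary_integral :: "real \<Rightarrow> (complex \<Rightarrow> 'a::complex_banach) \<Rightarrow> 'a" where
  "boundary_integral \<nu> H = (1 / (2 * of_real pi * \<i>)) *\<^sub>C
     (integral UNIV (\<lambda>u. H (Complex u (- \<nu>))) - integral UNIV (\<lambda>u. H (Complex u \<nu>)))"

lemma line_decayI:
  assumes "0 < e" "continuous_on {z. \<bar>Im z\<bar> = \<nu>} H"
    "\<And>z. \<bar>Im z\<bar> = \<nu> \<Longrightarrow> norm (H z) \<le> C * exp (- e * \<bar>Re z\<bar>)"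
  shows "line_decay \<nu> C e H"
  using assms unfolding line_decay_def by blast

lemma line_decayD:
  assumes "line_decay \<nu> C e H"
  shows "0 < e" "continuous_on {z. \<bar>Im z\<bar> = \<nu>} H"
    "\<And>z. \<bar>Im z\<bar> = \<nu> \<Longrightarrow> norm (H z) \<le> C * exp (- e * \<bar>Re z\<bar>)"
  using assms unfolding line_decay_def by blast+

lemma line_decay_nonneg: "0 \<le> \<nu> \<Longrightarrow> line_decay \<nu> C e H \<Longrightarrow> 0 \<le> C"
  using norm_ge_zero[THEN order_trans, OF line_decayD(3), of \<nu> C e H "Complex 0 \<nu>"] by simp

lemma exp_decay_line:
  assumes "0 \<le> \<nu>" "line_decay \<nu> C e H" "\<bar>t\<bar> = \<nu>"
  shows "exp_decay C e (\<lambda>u. H (Complex u t))"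
  unfolding exp_decay_def
proof (intro conjI allI)
  show "continuous_on UNIV (\<lambda>u. H (Complex u t))"
    unfolding Complex_eq
    by (rule continuous_on_compose2[OF line_decayD(2)[OF assms(2)]]) (use assms in \<open>auto intro!: continuous_intros\<close>)
  show "norm (H (Complex u t)) \<le> C * exp (- e * \<bar>u\<bar>)" for u
    using line_decayD(3)[OF assms(2), of "Complex u t"] assms(3) by simp
qed (rule line_decayD(1)[OF assms(2)])

lemma integrable_line:
  fixes H :: "complex \<Rightarrow> 'a::complex_banach"
  assumes "0 \<le> \<nu>" "line_decay \<nu> C e H"
  shows "(\<lambda>u. H (Complex u \<nu>)) integrable_on UNIV" "(\<lambda>u. H (Complex u (- \<nu>))) integrable_on UNIV"
  using exp_decay_integrable(1)[OF exp_decay_line[OF assms]] assms(1) by auto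

lemma boundary_integral_cong:
  assumes "0 \<le> \<nu>" "\<And>z. \<bar>Im z\<bar> = \<nu> \<Longrightarrow> H z = H' z"
  shows "boundary_integral \<nu> H = boundary_integral \<nu> H'"
proof -
  have "H (Complex u (- \<nu>)) = H' (Complex u (- \<nu>))" "H (Complex u \<nu>) = H' (Complex u \<nu>)" for u
    using assms by auto
  then show ?thesis unfolding boundary_integral_def by simp
qed

lemma boundary_integral_add:
  fixes H :: "complex \<Rightarrow> 'a::complex_banach"
  assumes "0 \<le> \<nu>" "line_decay \<nu> C e H" "line_decay \<nu> C' e' H'"
  shows "boundary_integral \<nu> (\<lambda>z. H z + H' z) = boundary_integral \<nu> H + boundary_integral \<nu> H'"
  unfolding boundary_integral_def
  using integrable_line[OF assms(1,2)] integrable_line[OF assms(1,3)]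
  by (simp add: integral_add algebra_simps flip: scaleC_add_right)

lemma boundary_integral_diff:
  fixes H :: "complex \<Rightarrow> 'a::complex_banach"
  assumes "0 \<le> \<nu>" "line_decay \<nu> C e H" "line_decay \<nu> C' e' H'"
  shows "boundary_integral \<nu> (\<lambda>z. H z - H' z) = boundary_integral \<nu> H - boundary_integral \<nu> H'"
  unfolding boundary_integral_def
  using integrable_line[OF assms(1,2)] integrable_line[OF assms(1,3)]
  by (simp add: integral_diff algebra_simps flip: scaleC.diff_right)

lemma boundary_integral_bounded_clinear:
  fixes H :: "complex \<Rightarrow> 'a::complex_banach"
  assumes "0 \<le> \<nu>" "line_decay \<nu> C e H" "bounded_clinear T"
  shows "boundary_integral \<nu> (\<lambda>z. T (H z)) = T (boundary_integral \<nu> H)"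
  unfolding boundary_integral_def using integrable_line[OF assms(1,2)]
  by (simp add: integral_bounded_clinear[OF _ assms(3)] bounded_clinear_simps(2,5)[OF assms(3)])

lemma boundary_integral_scaleC:
  fixes H :: "complex \<Rightarrow> 'a::complex_banach"
  assumes "0 \<le> \<nu>" "line_decay \<nu> C e H"
  shows "boundary_integral \<nu> (\<lambda>z. c *\<^sub>C H z) = c *\<^sub>C boundary_integral \<nu> H"
  unfolding boundary_integral_def using integrable_line[OF assms]
  by (simp add: integral_scaleC scaleC_scaleC mult.commute flip: scaleC.diff_right)

lemma boundary_integral_scaleC_left:
  fixes x :: "'a::complex_banach" and h :: "complex \<Rightarrow> complex"
  assumes "0 \<le> \<nu>" "line_decay \<nu> C e h"
  shows "boundary_integral \<nu> (\<lambda>z. h z *\<^sub>C x) = boundary_integral \<nu> h *\<^sub>C x"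
  unfolding boundary_integral_def using integrable_line[OF assms]
  by (simp add: integral_scaleC_left scaleC_scaleC flip: scaleC.diff_left) (simp add: scaleC_complex_def)

lemma norm_boundary_integral_le:
  fixes H :: "complex \<Rightarrow> 'a::complex_banach"
  assumes "0 \<le> \<nu>" "line_decay \<nu> C e H"
  shows "norm (boundary_integral \<nu> H) \<le> C * (2 / e)"
proof -
  have "norm (integral UNIV (\<lambda>u. H (Complex u (- \<nu>)))) \<le> C * (2 / e)"
    "norm (integral UNIV (\<lambda>u. H (Complex u \<nu>))) \<le> C * (2 / e)"
    using exp_decay_integrable(2)[OF exp_decay_line[OF assms]] assms(1) by auto
  then have "norm (integral UNIV (\<lambda>u. H (Complex u (- \<nu>))) - integral UNIV (\<lambda>u. H (Complex u \<nu>))) \<le> 2 * (C * (2 / e))"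
    using norm_triangle_ineq4[of "integral UNIV (\<lambda>u. H (Complex u (- \<nu>)))" "integral UNIV (\<lambda>u. H (Complex u \<nu>))"]
    by linarith
  then have "norm (boundary_integral \<nu> H) \<le> 1 / (2 * pi) * (2 * (C * (2 / e)))"
    unfolding boundary_integral_def norm_scaleC
    by (intro mult_mono) (auto simp: norm_divide norm_mult)
  also have "\<dots> = (C * (2 / e)) * (1 / pi)" by (simp add: field_simps)
  also have "\<dots> \<le> (C * (2 / e)) * 1"
    using line_decay_nonneg[OF assms] line_decayD(1)[OF assms(2)] pi_gt3
    by (intro mult_left_mono) auto
  finally show ?thesis by simp
qed

text \<open>The two lines have opposite orientation, and \<open>integral_line_shift\<close> moves
  one onto the other through the closed strip, in which \<open>H\<close> has no singularity.\<close>

lemma boundary_integral_eq_0: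
  fixes H H' :: "complex \<Rightarrow> 'a::complex_banach"
  assumes "0 \<le> \<nu>"
    and "\<And>z. \<bar>Im z\<bar> \<le> \<nu> \<Longrightarrow> (H has_derivative (\<lambda>h. h *\<^sub>C H' z)) (at z)"
    and "continuous_on {z. \<bar>Im z\<bar> \<le> \<nu>} H'"
    and "e > 0" and "\<And>z. \<bar>Im z\<bar> \<le> \<nu> \<Longrightarrow> norm (H z) \<le> C * exp (- e * \<bar>Re z\<bar>)"
  shows "boundary_integral \<nu> H = 0"
proof -
  have "{z. - \<nu> \<le> Im z \<and> Im z \<le> \<nu>} = {z. \<bar>Im z\<bar> \<le> \<nu>}" by auto
  then have "integral UNIV (\<lambda>u. H (Complex u (- \<nu>))) = integral UNIV (\<lambda>u. H (Complex u \<nu>))"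
    using assms by (intro integral_line_shift[where H' = H' and e = e and C = C]) auto
  then show ?thesis by (simp add: boundary_integral_def)
qed

text \<open>Fubini's theorem on each line separately. The two decay statements make the inner
  integrals available as integrands again.\<close>

lemma integral_UNIV_line_swap:
  fixes M :: "real \<Rightarrow> complex \<Rightarrow> 'a::complex_banach"
  assumes \<nu>: "0 \<le> \<nu>" and cont: "continuous_on (UNIV \<times> {z. \<bar>Im z\<bar> = \<nu>}) (\<lambda>(s, z). M s z)"
    and e: "e > 0" and le: "\<And>s z. \<bar>Im z\<bar> = \<nu> \<Longrightarrow> norm (M s z) \<le> C * exp (- e * \<bar>s\<bar>) * exp (- e * \<bar>Re z\<bar>)"
  shows "integral UNIV (\<lambda>s. boundary_integral \<nu> (M s)) = boundary_integral \<nu> (\<lambda>z. integral UNIV (\<lambda>s. M s z))"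
    and "line_decay \<nu> (C * (2 / e)) e (\<lambda>z. integral UNIV (\<lambda>s. M s z))"
    and "exp_decay (C * (2 / e)) e (\<lambda>s. boundary_integral \<nu> (M s))"
proof -
  have C: "C \<ge> 0" using norm_ge_zero[THEN order_trans, OF le[of "Complex 0 \<nu>" 0]] \<nu> by simp
  have le1: "C * exp (- e * \<bar>s\<bar>) * exp (- e * \<bar>t\<bar>) \<le> C * exp (- e * \<bar>s\<bar>)" for s t
    using C e by (simp add: mult_left_le)
  have le2: "C * exp (- e * \<bar>s\<bar>) * exp (- e * \<bar>t\<bar>) \<le> C * exp (- e * \<bar>t\<bar>)" for s t
    using le1[of t s] by (simp add: mult_ac)
  have contl: "continuous_on UNIV (\<lambda>(s, u). M s (Complex u t))" if "\<bar>t\<bar> = \<nu>" for t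
  proof -
    have "continuous_on UNIV (\<lambda>p. (\<lambda>(s, z). M s z) (fst p, Complex (snd p) t))"
      unfolding Complex_eq
      by (rule continuous_on_compose2[OF cont]) (use that in \<open>auto intro!: continuous_intros\<close>)
    then show ?thesis by (simp add: split_def)
  qed
  have lel: "norm (M s (Complex u t)) \<le> C * exp (- e * \<bar>s\<bar>) * exp (- e * \<bar>u\<bar>)" if "\<bar>t\<bar> = \<nu>" for s u t
    using le[of "Complex u t" s] that by simp
  have ldec: "line_decay \<nu> (C * exp (- e * \<bar>s\<bar>)) e (M s)" for s
  proof (rule line_decayI[OF e _ le])
    have "continuous_on {z. \<bar>Im z\<bar> = \<nu>} (\<lambda>z. (\<lambda>(s, z). M s z) (s, z))"
      by (rule continuous_on_compose2[OF cont]) (auto intro!: continuous_intros)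
    then show "continuous_on {z. \<bar>Im z\<bar> = \<nu>} (M s)" by simp
  qed
  have edec: "exp_decay (C * exp (- e * \<bar>Re z\<bar>)) e (\<lambda>s. M s z)" if "\<bar>Im z\<bar> = \<nu>" for z
    unfolding exp_decay_def
  proof (intro conjI allI)
    have "continuous_on UNIV (\<lambda>s. (\<lambda>(s, z). M s z) (s, z))"
      by (rule continuous_on_compose2[OF cont]) (use that in \<open>auto intro!: continuous_intros\<close>)
    then show "continuous_on UNIV (\<lambda>s. M s z)" by simp
    show "norm (M u z) \<le> C * exp (- e * \<bar>Re z\<bar>) * exp (- e * \<bar>u\<bar>)" for u
      using le[OF that, of u] by (simp add: mult_ac)
  qed (use e in auto)
  show "line_decay \<nu> (C * (2 / e)) e (\<lambda>z. integral UNIV (\<lambda>s. M s z))"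
  proof (rule line_decayI[OF e])
    show "continuous_on {z. \<bar>Im z\<bar> = \<nu>} (\<lambda>z. integral UNIV (\<lambda>s. M s z))"
    proof (rule continuous_on_integral_UNIV[OF _ e])
      have "continuous_on ({z. \<bar>Im z\<bar> = \<nu>} \<times> UNIV) (\<lambda>p. (\<lambda>(s, z). M s z) (snd p, fst p))"
        by (rule continuous_on_compose2[OF cont]) (auto intro!: continuous_intros)
      then show "continuous_on ({z. \<bar>Im z\<bar> = \<nu>} \<times> UNIV) (\<lambda>(z, s). M s z)" by (simp add: split_def)
      show "norm (M u s) \<le> C * exp (- e * \<bar>u\<bar>)" if "s \<in> {z. \<bar>Im z\<bar> = \<nu>}" for s u
        using le[of s u] le1[of u "Re s"] that by simp
    qed
    show "norm (integral UNIV (\<lambda>s. M s z)) \<le> C * (2 / e) * exp (- e * \<bar>Re z\<bar>)" if "\<bar>Im z\<bar> = \<nu>" for z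
      using exp_decay_integrable(2)[OF edec[OF that]] by (simp add: mult_ac)
  qed
  have half: "integral UNIV (\<lambda>s. integral UNIV (\<lambda>u. M s (Complex u t))) =
      integral UNIV (\<lambda>u. integral UNIV (\<lambda>s. M s (Complex u t)))"
    "continuous_on UNIV (\<lambda>s. integral UNIV (\<lambda>u. M s (Complex u t)))"
    "(\<lambda>s. integral UNIV (\<lambda>u. M s (Complex u t))) integrable_on UNIV" if t: "\<bar>t\<bar> = \<nu>" for t
  proof -
    show "integral UNIV (\<lambda>s. integral UNIV (\<lambda>u. M s (Complex u t))) =
      integral UNIV (\<lambda>u. integral UNIV (\<lambda>s. M s (Complex u t)))"
      by (rule integral_UNIV_swap[OF contl[OF t] e lel[OF t]])
    show ct: "continuous_on UNIV (\<lambda>s. integral UNIV (\<lambda>u. M s (Complex u t)))"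
      by (rule continuous_on_integral_UNIV[OF _ e, where C = C])
         (use contl[OF t] order_trans[OF lel[OF t] le2] in auto)
    have "exp_decay (C * (2 / e)) e (\<lambda>s. integral UNIV (\<lambda>u. M s (Complex u t)))"
      unfolding exp_decay_def
      using exp_decay_integrable(2)[OF exp_decay_line[OF \<nu> ldec t]] ct e by (simp add: mult_ac)
    then show "(\<lambda>s. integral UNIV (\<lambda>u. M s (Complex u t))) integrable_on UNIV"
      by (rule exp_decay_integrable(1))
  qed
  show "exp_decay (C * (2 / e)) e (\<lambda>s. boundary_integral \<nu> (M s))"
    unfolding exp_decay_def
  proof (intro conjI allI)
    show "continuous_on UNIV (\<lambda>s. boundary_integral \<nu> (M s))"
      unfolding boundary_integral_def using \<nu> by (intro continuous_intros half) auto
    show "norm (boundary_integral \<nu> (M s)) \<le> C * (2 / e) * exp (- e * \<bar>s\<bar>)" for s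
      using norm_boundary_integral_le[OF \<nu> ldec[of s]] by (simp add: mult_ac)
  qed (use e in auto)
  show "integral UNIV (\<lambda>s. boundary_integral \<nu> (M s)) = boundary_integral \<nu> (\<lambda>z. integral UNIV (\<lambda>s. M s z))"
    unfolding boundary_integral_def using half[of "- \<nu>"] half[of \<nu>] \<nu>
    by (simp add: integral_scaleC integral_diff integrable_diff)
qed

lemma boundary_integral_swap:
  fixes M :: "complex \<Rightarrow> complex \<Rightarrow> 'a::complex_banach"
  assumes \<mu>: "0 \<le> \<mu>" and \<nu>: "0 \<le> \<nu>"
    and cont: "continuous_on ({z. \<bar>Im z\<bar> = \<mu>} \<times> {z. \<bar>Im z\<bar> = \<nu>}) (\<lambda>(w, z). M w z)"
    and e: "e > 0" and le: "\<And>w z. \<bar>Im w\<bar> = \<mu> \<Longrightarrow> \<bar>Im z\<bar> = \<nu> \<Longrightarrow> norm (M w z) \<le> C * exp (- e * \<bar>Re w\<bar>) * exp (- e * \<bar>Re z\<bar>)"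
  shows "boundary_integral \<mu> (\<lambda>w. boundary_integral \<nu> (M w)) = boundary_integral \<nu> (\<lambda>z. boundary_integral \<mu> (\<lambda>w. M w z))"
proof -
  have *: "continuous_on (UNIV \<times> {z. \<bar>Im z\<bar> = \<nu>}) (\<lambda>(s, z). M (Complex s t) z)" if "\<bar>t\<bar> = \<mu>" for t
  proof -
    have "continuous_on (UNIV \<times> {z. \<bar>Im z\<bar> = \<nu>}) (\<lambda>p. (\<lambda>(w, z). M w z) (Complex (fst p) t, snd p))"
      unfolding Complex_eq
      by (rule continuous_on_compose2[OF cont]) (use that in \<open>auto intro!: continuous_intros\<close>)
    then show ?thesis by (simp add: split_def)
  qed
  have **: "norm (M (Complex s t) z) \<le> C * exp (- e * \<bar>s\<bar>) * exp (- e * \<bar>Re z\<bar>)" if "\<bar>t\<bar> = \<mu>" "\<bar>Im z\<bar> = \<nu>" for s t z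
    using le[of "Complex s t" z] that by simp
  have t: "\<bar>- \<mu>\<bar> = \<mu>" "\<bar>\<mu>\<bar> = \<mu>" using \<mu> by auto
  note sw = integral_UNIV_line_swap[OF \<nu> * e **]
  have "boundary_integral \<mu> (\<lambda>w. boundary_integral \<nu> (M w)) = (1 / (2 * of_real pi * \<i>)) *\<^sub>C
      (boundary_integral \<nu> (\<lambda>z. integral UNIV (\<lambda>s. M (Complex s (- \<mu>)) z)) - boundary_integral \<nu> (\<lambda>z. integral UNIV (\<lambda>s. M (Complex s \<mu>) z)))"
    unfolding boundary_integral_def[of \<mu>] by (simp only: sw(1)[OF t(1) t(1)] sw(1)[OF t(2) t(2)])
  also have "\<dots> = (1 / (2 * of_real pi * \<i>)) *\<^sub>C
      (boundary_integral \<nu> (\<lambda>z. integral UNIV (\<lambda>s. M (Complex s (- \<mu>)) z) - integral UNIV (\<lambda>s. M (Complex s \<mu>) z)))"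
    by (simp only: boundary_integral_diff[OF \<nu> sw(2)[OF t(1) t(1)] sw(2)[OF t(2) t(2)]])
  also have "\<dots> = boundary_integral \<nu> (\<lambda>z. boundary_integral \<mu> (\<lambda>w. M w z))"
  proof -
    let ?D = "\<lambda>z. integral UNIV (\<lambda>s. M (Complex s (- \<mu>)) z) - integral UNIV (\<lambda>s. M (Complex s \<mu>) z)"
    have "line_decay \<nu> (C * (2 / e) + C * (2 / e)) e ?D"
    proof (rule line_decayI[OF e])
      show "continuous_on {z. \<bar>Im z\<bar> = \<nu>} ?D"
        by (intro continuous_intros line_decayD(2)[OF sw(2)[OF t(1) t(1)]] line_decayD(2)[OF sw(2)[OF t(2) t(2)]])
      show "norm (?D z) \<le> (C * (2 / e) + C * (2 / e)) * exp (- e * \<bar>Re z\<bar>)" if z: "\<bar>Im z\<bar> = \<nu>" for z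
        unfolding distrib_right
        by (rule order_trans[OF norm_triangle_ineq4
              add_mono[OF line_decayD(3)[OF sw(2)[OF t(1) t(1)] z] line_decayD(3)[OF sw(2)[OF t(2) t(2)] z]]])
    qed
    from boundary_integral_scaleC[OF \<nu> this] show ?thesis unfolding boundary_integral_def[of \<mu>] by simp
  qed
  finally show ?thesis .
qed

section \<open>Resolvents in logarithmic coordinates\<close>

text \<open>Both \<open>G a = z R(z, A)\<close> and \<open>F a = z (z + B)\<^sup>-\<^sup>1\<close>, with \<open>z = exp a\<close>, satisfy the last condition, which is the
  resolvent equation.\<close>

definition resolvent_family :: "complex set \<Rightarrow> real \<Rightarrow> (complex \<Rightarrow> 'a::complex_banach \<Rightarrow> 'a) \<Rightarrow> bool" where
  "resolvent_family U K G \<longleftrightarrow> 0 \<le> K \<and>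
     (\<forall>a\<in>U. bounded_clinear (G a) \<and> (\<forall>v. norm (G a v) \<le> K * norm v)) \<and>
     (\<forall>a\<in>U. \<forall>b\<in>U. \<forall>v. G b v - G a v = (1 - exp (a - b)) *\<^sub>C G b (v - G a v))"

lemma resolvent_familyD:
  assumes "resolvent_family U K G"
  shows "0 \<le> K" "\<And>a. a \<in> U \<Longrightarrow> bounded_clinear (G a)" "\<And>a v. a \<in> U \<Longrightarrow> norm (G a v) \<le> K * norm v"
    "\<And>a b v. a \<in> U \<Longrightarrow> b \<in> U \<Longrightarrow> G b v - G a v = (1 - exp (a - b)) *\<^sub>C G b (v - G a v)"
  using assms unfolding resolvent_family_def by blast+

lemma resolvent_family_mult:
  assumes G: "resolvent_family U K G" and U: "a \<in> U" "b \<in> U"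
  shows "(1 - exp (a - b)) *\<^sub>C G b (G a v) = G a v - exp (a - b) *\<^sub>C G b v"
proof -
  note [simp] = bounded_clinear_simps[OF resolvent_familyD(2)[OF G U(2)]]
  show ?thesis
    using resolvent_familyD(4)[OF G U, of v]
    by (simp add: scaleC_simps algebra_simps)
qed

text \<open>Both products are the same combination of \<open>G a v\<close> and \<open>G b v\<close>,
  divided by \<open>1 - exp (a - b)\<close>. Points that differ by a multiple of
  \<open>2 \<pi> \<i>\<close> are treated apart: there \<open>G a\<close> and \<open>G b\<close>
  coincide.\<close>

lemma resolvent_family_commute:
  assumes G: "resolvent_family U K G" and U: "a \<in> U" "b \<in> U"
  shows "G a (G b v) = G b (G a v)"
proof (cases "exp (a - b) = 1")
  case True
  have "G b w = G a w" for w
    using resolvent_familyD(4)[OF G U, of w] True by simp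
  then show ?thesis by simp
next
  case False
  define E where "E = exp (a - b)"
  have E: "exp (b - a) = 1 / E" "E \<noteq> 0" "E \<noteq> 1"
    using False by (simp_all add: E_def exp_diff)
  have 1: "(1 - E) *\<^sub>C G b (G a v) = G a v - E *\<^sub>C G b v"
    using resolvent_family_mult[OF G U] by (simp add: E_def)
  have "(- E) *\<^sub>C ((1 - 1 / E) *\<^sub>C G a (G b v)) = (- E) *\<^sub>C (G b v - (1 / E) *\<^sub>C G a v)"
    using resolvent_family_mult[OF G U(2,1)] by (simp add: E)
  then have "(1 - E) *\<^sub>C G a (G b v) = G a v - E *\<^sub>C G b v"
    using E by (simp add: scaleC_scaleC scaleC.diff_right scaleC.minus_left right_diff_distrib)
  with 1 have "(1 / (1 - E)) *\<^sub>C ((1 - E) *\<^sub>C G a (G b v)) = (1 / (1 - E)) *\<^sub>C ((1 - E) *\<^sub>C G b (G a v))"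
    by simp
  then show ?thesis using E by (simp add: scaleC_scaleC)
qed

text \<open>A partial fraction decomposition: the coefficients are Cauchy kernels in
  \<open>b - a\<close> and \<open>a - b\<close>, and they add up to \<open>1\<close>.\<close>

lemma resolvent_family_exp_kernel:
  assumes G: "resolvent_family U K G" and U: "a \<in> U" "b \<in> U" and ne: "exp (a - b) \<noteq> 1"
  shows "G b (G a v) = exp_kernel (b - a) *\<^sub>C G a v + exp_kernel (a - b) *\<^sub>C G b v"
proof -
  define E where "E = exp (a - b)"
  have E: "E \<noteq> 0" "E \<noteq> 1" using ne by (simp_all add: E_def)
  have k: "exp_kernel (b - a) = 1 / (1 - E)" "exp_kernel (a - b) = - E / (1 - E)"
  proof -
    show "exp_kernel (b - a) = 1 / (1 - E)" by (simp add: exp_kernel_def E_def)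
    have "exp (- (a - b)) = 1 / E" by (simp add: E_def exp_diff)
    then show "exp_kernel (a - b) = - E / (1 - E)" unfolding exp_kernel_def \<open>exp (- (a - b)) = 1 / E\<close>
      using E by (simp add: field_simps)
  qed
  have "(1 - E) *\<^sub>C G b (G a v) = G a v - E *\<^sub>C G b v"
    using resolvent_family_mult[OF G U] by (simp add: E_def)
  then have "(1 / (1 - E)) *\<^sub>C ((1 - E) *\<^sub>C G b (G a v)) = (1 / (1 - E)) *\<^sub>C (G a v - E *\<^sub>C G b v)"
    by simp
  then show ?thesis using E by (simp add: k scaleC_scaleC scaleC.diff_right scaleC.minus_left)
qed

text \<open>The resolvent equation writes the change in the parameter as
  \<open>1 - exp (c s0 - c s)\<close> times \<open>G (c s)\<close> of a fixed vector. Together with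
  the common bound \<open>K\<close> this gives joint continuity, also for a moving argument
  \<open>x s\<close>.\<close>

lemma resolvent_family_continuous:
  assumes G: "resolvent_family U K G"
    and c: "continuous_on S c" "\<And>s. s \<in> S \<Longrightarrow> c s \<in> U" and x: "continuous_on S x"
  shows "continuous_on S (\<lambda>s. G (c s) (x s))"
  unfolding continuous_on_def
proof
  fix s0 assume s0: "s0 \<in> S"
  define w where "w = x s0 - G (c s0) (x s0)"
  have bound: "norm (G (c s) (x s) - G (c s0) (x s0)) \<le>
      K * norm (x s - x s0) + norm (1 - exp (c s0 - c s)) * (K * norm w)" if "s \<in> S" for s
  proof -
    note lin = bounded_clinear_simps[OF resolvent_familyD(2)[OF G c(2)[OF that]]]
    have "G (c s) (x s) - G (c s0) (x s0) = G (c s) (x s - x s0) + (1 - exp (c s0 - c s)) *\<^sub>C G (c s) w"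
      using resolvent_familyD(4)[OF G c(2)[OF s0] c(2)[OF that], of "x s0"] unfolding w_def lin(2)[of "x s" "x s0"]
      by (simp only: algebra_simps)
    also have "norm \<dots> \<le> norm (G (c s) (x s - x s0)) + norm (1 - exp (c s0 - c s)) * norm (G (c s) w)"
      using norm_triangle_ineq by (simp flip: norm_scaleC)
    also have "\<dots> \<le> K * norm (x s - x s0) + norm (1 - exp (c s0 - c s)) * (K * norm w)"
      by (intro add_mono mult_left_mono resolvent_familyD(3)[OF G c(2)[OF that]]) auto
    finally show ?thesis .
  qed
  have "((\<lambda>s. K * norm (x s - x s0) + norm (1 - exp (c s0 - c s)) * (K * norm w)) \<longlongrightarrow>
      K * norm (x s0 - x s0) + norm (1 - exp (c s0 - c s0)) * (K * norm w)) (at s0 within S)"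
    using c(1) x s0 unfolding continuous_on_def by (intro tendsto_intros) auto
  then have "((\<lambda>s. K * norm (x s - x s0) + norm (1 - exp (c s0 - c s)) * (K * norm w)) \<longlongrightarrow> 0) (at s0 within S)"
    by simp
  then have "((\<lambda>s. G (c s) (x s) - G (c s0) (x s0)) \<longlongrightarrow> 0) (at s0 within S)"
    by (rule Lim_null_comparison[rotated]) (use bound in \<open>auto simp: eventually_at_topological\<close>)
  then show "((\<lambda>s. G (c s) (x s)) \<longlongrightarrow> G (c s0) (x s0)) (at s0 within S)"
    by (simp add: LIM_zero_iff)
qed

text \<open>To first order the factor \<open>1 - exp (a - z)\<close> in the resolvent equation is
  \<open>z - a\<close>. The open set \<open>V\<close> is introduced since \<open>U\<close> itself
  may fail to be open.\<close>

lemma resolvent_family_has_derivative: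
  assumes G: "resolvent_family U K G" and U: "open V" "V \<subseteq> U" "a \<in> V"
  shows "((\<lambda>z. G z v) has_derivative (\<lambda>h. h *\<^sub>C G a (v - G a v))) (at a)"
proof -
  define w where "w = v - G a v"
  have aU: "a \<in> U" using U by blast
  have "continuous_on V (\<lambda>z. G z w)"
    by (rule resolvent_family_continuous[OF G]) (use U in \<open>auto intro!: continuous_intros\<close>)
  then have contw: "((\<lambda>z. G z w) \<longlongrightarrow> G a w) (at a)"
    using U unfolding continuous_on_eq_continuous_at[OF U(1)] isCont_def by blast
  have "((\<lambda>z. 1 - exp (a - z)) has_field_derivative 1) (at a)"
    by (auto intro!: derivative_eq_intros)
  then have "((\<lambda>z. (1 - exp (a - z)) / (z - a)) \<longlongrightarrow> 1) (at a)"
    by (simp add: has_field_derivative_iff)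
  then have "((\<lambda>z. ((1 - exp (a - z)) / (z - a)) *\<^sub>C G z w - G a w) \<longlongrightarrow> 1 *\<^sub>C G a w - G a w) (at a)"
    by (intro tendsto_intros contw)
  then have "((\<lambda>z. norm (((1 - exp (a - z)) / (z - a)) *\<^sub>C G z w - G a w)) \<longlongrightarrow> 0) (at a)"
    using tendsto_norm_zero by fastforce
  moreover have "\<forall>\<^sub>F z in at a. norm (((1 - exp (a - z)) / (z - a)) *\<^sub>C G z w - G a w) =
      norm ((G z v - G a v) - (z - a) *\<^sub>C G a w) / norm (z - a)"
    unfolding eventually_at_topological
  proof (intro exI conjI ballI impI)
    fix z assume z: "z \<in> V" "z \<noteq> a"
    have "G z v - G a v = (z - a) *\<^sub>C (((1 - exp (a - z)) / (z - a)) *\<^sub>C G z w)"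
      using resolvent_familyD(4)[OF G aU, of z v] z U by (auto simp: w_def scaleC_scaleC)
    then have "(G z v - G a v) - (z - a) *\<^sub>C G a w = (z - a) *\<^sub>C (((1 - exp (a - z)) / (z - a)) *\<^sub>C G z w - G a w)"
      by (simp only: scaleC.diff_right)
    then show "norm (((1 - exp (a - z)) / (z - a)) *\<^sub>C G z w - G a w) =
      norm ((G z v - G a v) - (z - a) *\<^sub>C G a w) / norm (z - a)"
      using z by (simp add: norm_scaleC)
  qed (use U in auto)
  ultimately have "((\<lambda>z. norm ((G z v - G a v) - (z - a) *\<^sub>C G a w) / norm (z - a)) \<longlongrightarrow> 0) (at a)"
    by (rule Lim_transform_eventually)
  then show ?thesis
    unfolding has_derivative_iff_norm w_def by (simp add: scaleC.bounded_linear_left)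
qed

section \<open>Holomorphic functions of exponential decay on a strip\<close>

definition strip_decay :: "real \<Rightarrow> real \<Rightarrow> real \<Rightarrow> (complex \<Rightarrow> complex) \<Rightarrow> bool" where
  "strip_decay r C e h \<longleftrightarrow> h holomorphic_on {z. \<bar>Im z\<bar> < r} \<and> 0 < e \<and>
     (\<forall>z. \<bar>Im z\<bar> < r \<longrightarrow> cmod (h z) \<le> C * exp (- e * \<bar>Re z\<bar>))"

lemma strip_decayD:
  assumes "strip_decay r C e h"
  shows "h holomorphic_on {z. \<bar>Im z\<bar> < r}" "0 < e"
    "\<And>z. \<bar>Im z\<bar> < r \<Longrightarrow> cmod (h z) \<le> C * exp (- e * \<bar>Re z\<bar>)"
    "0 < r \<Longrightarrow> 0 \<le> C"
proof -
  show *: "\<And>z. \<bar>Im z\<bar> < r \<Longrightarrow> cmod (h z) \<le> C * exp (- e * \<bar>Re z\<bar>)"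
    using assms unfolding strip_decay_def by blast
  show "0 \<le> C" if "0 < r"
    using order_trans[OF norm_ge_zero *[of 0]] that by simp
qed (use assms in \<open>auto simp: strip_decay_def\<close>)

lemma open_strip: "open {z. \<bar>Im z\<bar> < r}"
proof -
  have "{z. \<bar>Im z\<bar> < r} = {c. Im c < r} \<inter> {c. - r < Im c}" by auto
  then show ?thesis by (auto intro: open_halfspace_Im_lt open_halfspace_Im_gt)
qed

lemma strip_decay_continuous: "strip_decay r C e h \<Longrightarrow> S \<subseteq> {z. \<bar>Im z\<bar> < r} \<Longrightarrow> continuous_on S h"
  using holomorphic_on_imp_continuous_on[OF strip_decayD(1)] continuous_on_subset by blast

lemma strip_decay_line: "strip_decay r C e h \<Longrightarrow> \<nu> < r \<Longrightarrow> line_decay \<nu> C e h"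
  by (rule line_decayI[OF strip_decayD(2) strip_decay_continuous strip_decayD(3)]) auto

lemma strip_decay_translate:
  assumes "strip_decay r C e h"
  shows "strip_decay r (C * exp (e * \<bar>t\<bar>)) e (\<lambda>z. h (z + of_real t))"
  unfolding strip_decay_def
proof (intro conjI allI impI)
  have "h \<circ> (\<lambda>z. z + of_real t) holomorphic_on {z. \<bar>Im z\<bar> < r}"
    by (rule holomorphic_on_compose_gen[OF _ strip_decayD(1)[OF assms]]) (auto intro!: holomorphic_intros)
  then show "(\<lambda>z. h (z + of_real t)) holomorphic_on {z. \<bar>Im z\<bar> < r}" by (simp add: o_def)
  fix z assume z: "\<bar>Im z\<bar> < r"
  then have C: "0 \<le> C" using strip_decayD(4)[OF assms] by linarith
  have "cmod (h (z + of_real t)) \<le> C * exp (- e * \<bar>Re z + t\<bar>)"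
    using strip_decayD(3)[OF assms, of "z + of_real t"] z by simp
  also have "\<dots> \<le> C * exp (e * \<bar>t\<bar> + - e * \<bar>Re z\<bar>)"
  proof (intro mult_left_mono C)
    have "e * (\<bar>Re z\<bar> - \<bar>t\<bar>) \<le> e * \<bar>Re z + t\<bar>"
      using strip_decayD(2)[OF assms] by (intro mult_left_mono) auto
    then show "exp (- e * \<bar>Re z + t\<bar>) \<le> exp (e * \<bar>t\<bar> + - e * \<bar>Re z\<bar>)" by (simp add: algebra_simps)
  qed
  finally show "cmod (h (z + of_real t)) \<le> C * exp (e * \<bar>t\<bar>) * exp (- e * \<bar>Re z\<bar>)"
    by (simp only: exp_add mult.assoc)
qed (use strip_decayD[OF assms] in auto)

lemma strip_decay_mult_bounded:
  assumes h: "strip_decay r C e h" and k: "k holomorphic_on {z. \<bar>Im z\<bar> < r}"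
    and b: "\<And>z. \<bar>Im z\<bar> < r \<Longrightarrow> cmod (k z) \<le> B"
  shows "strip_decay r (C * B) e (\<lambda>z. h z * k z)"
  unfolding strip_decay_def
proof (intro conjI allI impI)
  fix z assume z: "\<bar>Im z\<bar> < r"
  have "0 < r" using z by linarith
  then have "cmod (h z) * cmod (k z) \<le> (C * exp (- e * \<bar>Re z\<bar>)) * B"
    using strip_decayD[OF h] z b[OF z] by (intro mult_mono) auto
  then show "cmod (h z * k z) \<le> C * B * exp (- e * \<bar>Re z\<bar>)" by (simp add: norm_mult mult_ac)
qed (use strip_decayD[OF h] k in \<open>auto intro!: holomorphic_intros\<close>)

lemma strip_decay_bounded:
  assumes "strip_decay r C e h" "\<bar>Im z\<bar> < r" shows "cmod (h z) \<le> C"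
proof -
  have "0 < r" using assms by linarith
  have "cmod (h z) \<le> C * exp (- e * \<bar>Re z\<bar>)" using strip_decayD[OF assms(1)] assms(2) by blast
  also have "\<dots> \<le> C * 1" using strip_decayD[OF assms(1)] \<open>0 < r\<close> by (intro mult_left_mono) auto
  finally show ?thesis by simp
qed

lemma strip_decay_mult:
  assumes "strip_decay r C e h" "strip_decay r C' e' k"
  shows "strip_decay r (C * C') e (\<lambda>z. h z * k z)"
  using assms strip_decay_bounded by (intro strip_decay_mult_bounded strip_decayD(1)) blast+

text \<open>Cauchy's theorem for a product in which the scalar factor supplies the decay, so that
  \<open>Y\<close> only has to be bounded and continuously differentiable. It is applied to
  constants and to \<open>Y z = F z x\<close>.\<close>

lemma boundary_integral_scaleC_holomorphic_eq_0:
  fixes Y Y' :: "complex \<Rightarrow> 'a::complex_banach"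
  assumes h: "strip_decay r C e h" and \<nu>: "0 \<le> \<nu>" "\<nu> < r"
    and Y: "\<And>z. \<bar>Im z\<bar> < r \<Longrightarrow> (Y has_derivative (\<lambda>t. t *\<^sub>C Y' z)) (at z)"
    and Y': "continuous_on {z. \<bar>Im z\<bar> < r} Y'"
    and b: "\<And>z. \<bar>Im z\<bar> < r \<Longrightarrow> norm (Y z) \<le> B"
  shows "boundary_integral \<nu> (\<lambda>z. h z *\<^sub>C Y z) = 0"
proof (rule boundary_integral_eq_0[OF \<nu>(1), where H' = "\<lambda>z. h z *\<^sub>C Y' z + deriv h z *\<^sub>C Y z"])
  have sub: "{z. \<bar>Im z\<bar> \<le> \<nu>} \<subseteq> {z. \<bar>Im z\<bar> < r}" using \<nu> by auto
  show "((\<lambda>z. h z *\<^sub>C Y z) has_derivative (\<lambda>t. t *\<^sub>C (h z *\<^sub>C Y' z + deriv h z *\<^sub>C Y z))) (at z)"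
    if "\<bar>Im z\<bar> \<le> \<nu>" for z
  proof -
    have z: "\<bar>Im z\<bar> < r" using that \<nu> by simp
    have "(h has_field_derivative deriv h z) (at z)"
      using holomorphic_derivI[OF strip_decayD(1)[OF h] open_strip] z by blast
    then have "(h has_derivative (\<lambda>t. deriv h z * t)) (at z)"
      by (simp add: has_field_derivative_def)
    from scaleC.FDERIV[OF this Y[OF z]] show ?thesis
      by (simp add: scaleC_add_right scaleC_scaleC mult.commute)
  qed
  have cY: "continuous_on {z. \<bar>Im z\<bar> < r} Y"
    using Y has_derivative_continuous by (fastforce intro!: continuous_at_imp_continuous_on)
  have ch: "continuous_on {z. \<bar>Im z\<bar> < r} h" "continuous_on {z. \<bar>Im z\<bar> < r} (deriv h)"
    using strip_decayD(1)[OF h] holomorphic_deriv[OF strip_decayD(1)[OF h] open_strip]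
    by (auto intro: holomorphic_on_imp_continuous_on)
  have "continuous_on {z. \<bar>Im z\<bar> < r} (\<lambda>z. h z *\<^sub>C Y' z + deriv h z *\<^sub>C Y z)"
    by (intro continuous_intros cY ch Y')
  then show "continuous_on {z. \<bar>Im z\<bar> \<le> \<nu>} (\<lambda>z. h z *\<^sub>C Y' z + deriv h z *\<^sub>C Y z)"
    using sub by (rule continuous_on_subset)
  show "norm (h z *\<^sub>C Y z) \<le> (C * B) * exp (- e * \<bar>Re z\<bar>)" if "\<bar>Im z\<bar> \<le> \<nu>" for z
  proof -
    have z: "\<bar>Im z\<bar> < r" using that \<nu> by simp
    have "cmod (h z) * norm (Y z) \<le> (C * exp (- e * \<bar>Re z\<bar>)) * B"
      using strip_decayD[OF h] z b[OF z] \<nu> by (intro mult_mono) auto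
    then show ?thesis by (simp add: norm_scaleC mult_ac)
  qed
qed (use strip_decayD(2)[OF h] in auto)

lemma boundary_integral_strip_scaleC_eq_0:
  fixes x :: "'a::complex_banach"
  assumes "strip_decay r C e h" "0 \<le> \<nu>" "\<nu> < r"
  shows "boundary_integral \<nu> (\<lambda>z. h z *\<^sub>C x) = 0"
  by (rule boundary_integral_scaleC_holomorphic_eq_0[OF assms, where Y' = "\<lambda>_. 0" and B = "norm x"]) auto

lemma boundary_integral_resolvent_eq_0:
  assumes "strip_decay r C e h" "0 \<le> \<nu>" "\<nu> < r"
    and F: "resolvent_family U K F" "{z. \<bar>Im z\<bar> < r} \<subseteq> U"
  shows "boundary_integral \<nu> (\<lambda>z. h z *\<^sub>C F z x) = 0"
proof (rule boundary_integral_scaleC_holomorphic_eq_0[OF assms(1-3), where Y' = "\<lambda>z. F z (x - F z x)" and B = "K * norm x"])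
  show "((\<lambda>z. F z x) has_derivative (\<lambda>t. t *\<^sub>C F z (x - F z x))) (at z)" if "\<bar>Im z\<bar> < r" for z
    using that by (intro resolvent_family_has_derivative[OF F(1) open_strip F(2)]) auto
  show "continuous_on {z. \<bar>Im z\<bar> < r} (\<lambda>z. F z (x - F z x))"
    using F(2) by (intro resolvent_family_continuous[OF F(1)] continuous_intros) auto
  show "norm (F z x) \<le> K * norm x" if "\<bar>Im z\<bar> < r" for z
    using that F(2) by (intro resolvent_familyD(3)[OF F(1)]) auto
qed

lemma line_decay_resolvent:
  assumes h: "line_decay \<nu> C e h" and \<nu>: "0 \<le> \<nu>"
    and G: "resolvent_family U K G" "{z. \<bar>Im z\<bar> = \<nu>} \<subseteq> U"
    and X: "continuous_on {z. \<bar>Im z\<bar> = \<nu>} X" "\<And>z. \<bar>Im z\<bar> = \<nu> \<Longrightarrow> norm (X z) \<le> B"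
  shows "line_decay \<nu> (C * (K * B)) e (\<lambda>z. h z *\<^sub>C G z (X z))"
proof (rule line_decayI[OF line_decayD(1)[OF h]])
  show "continuous_on {z. \<bar>Im z\<bar> = \<nu>} (\<lambda>z. h z *\<^sub>C G z (X z))"
    using G(2) by (intro continuous_intros line_decayD(2)[OF h] resolvent_family_continuous[OF G(1)] X(1)) auto
  fix z assume z: "\<bar>Im z\<bar> = \<nu>"
  have "norm (G z (X z)) \<le> K * norm (X z)" using z G(2) by (intro resolvent_familyD(3)[OF G(1)]) auto
  also have "\<dots> \<le> K * B" using X(2)[OF z] resolvent_familyD(1)[OF G(1)] by (intro mult_left_mono)
  finally have "cmod (h z) * norm (G z (X z)) \<le> (C * exp (- e * \<bar>Re z\<bar>)) * (K * B)"
    using line_decayD(3)[OF h z] line_decay_nonneg[OF \<nu> h] by (intro mult_mono) auto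
  then show "norm (h z *\<^sub>C G z (X z)) \<le> C * (K * B) * exp (- e * \<bar>Re z\<bar>)"
    by (simp add: norm_scaleC mult_ac)
qed

lemma line_decay_scaleC:
  assumes "line_decay \<nu> C e h"
  shows "line_decay \<nu> (C * norm x) e (\<lambda>z. h z *\<^sub>C x)"
proof (rule line_decayI[OF line_decayD(1)[OF assms]])
  show "norm (h z *\<^sub>C x) \<le> C * norm x * exp (- e * \<bar>Re z\<bar>)" if "\<bar>Im z\<bar> = \<nu>" for z
    using mult_right_mono[OF line_decayD(3)[OF assms that], of "norm x"] by (simp add: norm_scaleC mult_ac)
qed (intro continuous_intros line_decayD(2)[OF assms])

text \<open>The resolvent equation splits \<open>G b (G a x)\<close> into two terms. As \<open>b\<close> lies outside the strip bounded by
  the lines of \<open>a\<close>, integrating the term in \<open>G b x\<close> over \<open>a\<close> gives \<open>0\<close>, and integrating the other one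
  over \<open>b\<close> gives \<open>h a\<close> by Cauchy's formula.\<close>

lemma boundary_integral_multiplicative:
  assumes h: "strip_decay r C e h" and k: "strip_decay r C' e k"
    and \<nu>: "0 < \<nu>" "\<nu> < \<mu>" "\<mu> < r" "r \<le> pi"
    and G: "resolvent_family U K G" "{z. \<bar>Im z\<bar> = \<nu>} \<subseteq> U" "{z. \<bar>Im z\<bar> = \<mu>} \<subseteq> U"
  shows "boundary_integral \<mu> (\<lambda>b. h b *\<^sub>C G b (boundary_integral \<nu> (\<lambda>a. k a *\<^sub>C G a x))) = boundary_integral \<nu> (\<lambda>a. (h a * k a) *\<^sub>C G a x)"
proof -
  \<comment> \<open>The lines of \<open>a\<close> and \<open>b\<close> are
    \<open>\<mu> - \<nu>\<close> apart; half of this remains when \<open>a\<close> ranges over the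
    wider strip of half-width \<open>(\<nu> + \<mu>) / 2\<close> used below. The term
    \<open>pi - \<mu>\<close> keeps \<open>b - a\<close> away from the poles at
    \<open>2 \<pi> \<i>\<close> and \<open>- 2 \<pi> \<i>\<close>.\<close>
  define \<delta> where "\<delta> = min ((\<mu> - \<nu>) / 2) (pi - \<mu>)"
  define Q where "Q = 1 / sin (\<delta> / 2)"
  have \<delta>: "0 < \<delta>" "\<delta> \<le> pi" "\<delta> \<le> (\<mu> - \<nu>) / 2" "\<delta> \<le> pi - \<mu>" using \<nu> by (auto simp: \<delta>_def min_def)
  have Q: "Q > 0" using sin_half_pos[OF \<delta>(1,2)] by (simp add: Q_def)
  have gap: "1 - exp (- c) \<noteq> 0" "cmod (exp_kernel c) \<le> Q" if "\<delta> \<le> \<bar>Im c\<bar>" "\<bar>Im c\<bar> \<le> 2 * pi - \<delta>" for c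
    using cmod_exp_kernel_le[OF \<delta>(1,2) that] by (auto simp: Q_def)
  have ab: "\<delta> \<le> \<bar>Im (b - a)\<bar>" "\<bar>Im (b - a)\<bar> \<le> 2 * pi - \<delta>" if "\<bar>Im a\<bar> = \<nu>" "\<bar>Im b\<bar> = \<mu>" for a b
    using that \<delta> \<nu> by auto
  have ne: "exp (a - b) \<noteq> 1" if "\<bar>Im a\<bar> = \<nu>" "\<bar>Im b\<bar> = \<mu>" for a b
    using gap(1)[OF ab[OF that]] by simp
  have k\<nu>: "line_decay \<nu> C' e k" and h\<mu>: "line_decay \<mu> C e h"
    using strip_decay_line[OF k] strip_decay_line[OF h] \<nu> by auto
  have C: "C \<ge> 0" "C' \<ge> 0" using strip_decayD(4)[OF h] strip_decayD(4)[OF k] \<nu> by auto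
  have K: "K \<ge> 0" using resolvent_familyD(1)[OF G(1)] .
  have kk: "line_decay \<nu> (C' * Q) e (\<lambda>a. k a * exp_kernel (b - a))" if b: "\<bar>Im b\<bar> = \<mu>" for b
  proof (rule line_decayI[OF line_decayD(1)[OF k\<nu>]])
    show "continuous_on {z. \<bar>Im z\<bar> = \<nu>} (\<lambda>a. k a * exp_kernel (b - a))"
      unfolding exp_kernel_def using gap(1)[OF ab[OF _ b]]
      by (intro continuous_intros line_decayD(2)[OF k\<nu>]) auto
    show "cmod (k z * exp_kernel (b - z)) \<le> C' * Q * exp (- e * \<bar>Re z\<bar>)" if "\<bar>Im z\<bar> = \<nu>" for z
      using mult_mono[OF line_decayD(3)[OF k\<nu> that] gap(2)[OF ab[OF that b]]] C
      by (simp add: norm_mult mult_ac)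
  qed
  have hk: "line_decay \<mu> (C * Q) e (\<lambda>b. h b * exp_kernel (b - a))" if a: "\<bar>Im a\<bar> = \<nu>" for a
  proof (rule line_decayI[OF line_decayD(1)[OF h\<mu>]])
    show "continuous_on {z. \<bar>Im z\<bar> = \<mu>} (\<lambda>b. h b * exp_kernel (b - a))"
      unfolding exp_kernel_def using gap(1)[OF ab[OF a]]
      by (intro continuous_intros line_decayD(2)[OF h\<mu>]) auto
    show "cmod (h z * exp_kernel (z - a)) \<le> C * Q * exp (- e * \<bar>Re z\<bar>)" if "\<bar>Im z\<bar> = \<mu>" for z
      using mult_mono[OF line_decayD(3)[OF h\<mu> that] gap(2)[OF ab[OF a that]]] C
      by (simp add: norm_mult mult_ac)
  qed
  \<comment> \<open>The pole \<open>a = b\<close> lies outside this strip, which is wider than \<nu>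
    so that the lines of \<open>a\<close> lie in its interior.\<close>
  have zero: "strip_decay ((\<nu> + \<mu>) / 2) (C' * Q) e (\<lambda>a. k a * exp_kernel (a - b))" if b: "\<bar>Im b\<bar> = \<mu>" for b
  proof (rule strip_decay_mult_bounded)
    have sub: "{z. \<bar>Im z\<bar> < (\<nu> + \<mu>) / 2} \<subseteq> {z. \<bar>Im z\<bar> < r}" using \<nu> by auto
    show "strip_decay ((\<nu> + \<mu>) / 2) C' e k"
      using k sub holomorphic_on_subset[OF _ sub] unfolding strip_decay_def by auto
    have g: "\<delta> \<le> \<bar>Im (z - b)\<bar>" "\<bar>Im (z - b)\<bar> \<le> 2 * pi - \<delta>" if "\<bar>Im z\<bar> < (\<nu> + \<mu>) / 2" for z
      using that b \<delta> \<nu> by auto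
    show "(\<lambda>a. exp_kernel (a - b)) holomorphic_on {z. \<bar>Im z\<bar> < (\<nu> + \<mu>) / 2}"
      unfolding exp_kernel_def using gap(1)[OF g] by (intro holomorphic_intros) auto
    show "cmod (exp_kernel (z - b)) \<le> Q" if "\<bar>Im z\<bar> < (\<nu> + \<mu>) / 2" for z
      using gap(2)[OF g[OF that]] .
  qed
  have inner: "G b (boundary_integral \<nu> (\<lambda>a. k a *\<^sub>C G a x)) = boundary_integral \<nu> (\<lambda>a. (k a * exp_kernel (b - a)) *\<^sub>C G a x)"
    if b: "\<bar>Im b\<bar> = \<mu>" for b
  proof -
    have bU: "b \<in> U" using b G(3) by blast
    have lin: "bounded_clinear (G b)" by (rule resolvent_familyD(2)[OF G(1) bU])
    have nn: "0 \<le> \<nu>" using \<nu> by simp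
    have "G b (boundary_integral \<nu> (\<lambda>a. k a *\<^sub>C G a x)) = boundary_integral \<nu> (\<lambda>a. G b (k a *\<^sub>C G a x))"
      by (rule boundary_integral_bounded_clinear[OF nn line_decay_resolvent[OF k\<nu> nn G(1,2)] lin, symmetric, where B = "norm x"]) auto
    also have "\<dots> = boundary_integral \<nu> (\<lambda>a. (k a * exp_kernel (b - a)) *\<^sub>C G a x + (k a * exp_kernel (a - b)) *\<^sub>C G b x)"
    proof (rule boundary_integral_cong[OF nn])
      fix a assume a: "\<bar>Im a\<bar> = \<nu>"
      then have "a \<in> U" using G(2) by blast
      then show "G b (k a *\<^sub>C G a x) = (k a * exp_kernel (b - a)) *\<^sub>C G a x + (k a * exp_kernel (a - b)) *\<^sub>C G b x"
        using resolvent_family_exp_kernel[OF G(1) _ bU ne[OF a b], of x]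
        by (simp add: bounded_clinear_simps[OF lin] scaleC_add_right scaleC_scaleC)
    qed
    also have "\<dots> = boundary_integral \<nu> (\<lambda>a. (k a * exp_kernel (b - a)) *\<^sub>C G a x) + boundary_integral \<nu> (\<lambda>a. (k a * exp_kernel (a - b)) *\<^sub>C G b x)"
    proof (rule boundary_integral_add[OF nn])
      show "line_decay \<nu> (C' * Q * (K * norm x)) e (\<lambda>a. (k a * exp_kernel (b - a)) *\<^sub>C G a x)"
        by (rule line_decay_resolvent[OF kk[OF b] nn G(1,2)]) auto
      have "line_decay \<nu> (C' * Q) e (\<lambda>a. k a * exp_kernel (a - b))"
        using strip_decay_line[OF zero[OF b]] \<nu> by auto
      then show "line_decay \<nu> (C' * Q * norm (G b x)) e (\<lambda>a. (k a * exp_kernel (a - b)) *\<^sub>C G b x)"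
        by (rule line_decay_scaleC)
    qed
    also have "boundary_integral \<nu> (\<lambda>a. (k a * exp_kernel (a - b)) *\<^sub>C G b x) = 0"
      by (rule boundary_integral_strip_scaleC_eq_0[OF zero[OF b]]) (use \<nu> in auto)
    finally show ?thesis by simp
  qed
  have nn: "0 \<le> \<nu>" "0 \<le> \<mu>" using \<nu> by auto
  have "boundary_integral \<mu> (\<lambda>b. h b *\<^sub>C G b (boundary_integral \<nu> (\<lambda>a. k a *\<^sub>C G a x))) =
      boundary_integral \<mu> (\<lambda>b. boundary_integral \<nu> (\<lambda>a. (h b * exp_kernel (b - a) * k a) *\<^sub>C G a x))"
  proof (rule boundary_integral_cong[OF nn(2)])
    fix b assume b: "\<bar>Im b\<bar> = \<mu>"
    have "h b *\<^sub>C boundary_integral \<nu> (\<lambda>a. (k a * exp_kernel (b - a)) *\<^sub>C G a x) = boundary_integral \<nu> (\<lambda>a. h b *\<^sub>C (k a * exp_kernel (b - a)) *\<^sub>C G a x)"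
      by (rule boundary_integral_scaleC[OF nn(1) line_decay_resolvent[OF kk[OF b] nn(1) G(1,2)], symmetric, where B = "norm x"]) auto
    then show "h b *\<^sub>C G b (boundary_integral \<nu> (\<lambda>a. k a *\<^sub>C G a x)) = boundary_integral \<nu> (\<lambda>a. (h b * exp_kernel (b - a) * k a) *\<^sub>C G a x)"
      unfolding inner[OF b] by (simp add: scaleC_scaleC mult_ac)
  qed
  also have "\<dots> = boundary_integral \<nu> (\<lambda>a. boundary_integral \<mu> (\<lambda>b. (h b * exp_kernel (b - a) * k a) *\<^sub>C G a x))"
  proof (rule boundary_integral_swap[OF nn(2,1) _ strip_decayD(2)[OF h]])
    have "continuous_on ({z. \<bar>Im z\<bar> = \<mu>} \<times> {z. \<bar>Im z\<bar> = \<nu>}) (\<lambda>p. exp_kernel (fst p - snd p))"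
      unfolding exp_kernel_def using gap(1)[OF ab] by (intro continuous_intros) auto
    moreover have "continuous_on ({z. \<bar>Im z\<bar> = \<mu>} \<times> {z. \<bar>Im z\<bar> = \<nu>}) (\<lambda>p. h (fst p))"
      by (rule continuous_on_compose2[OF line_decayD(2)[OF h\<mu>]]) (auto intro!: continuous_intros)
    moreover have "continuous_on ({z. \<bar>Im z\<bar> = \<mu>} \<times> {z. \<bar>Im z\<bar> = \<nu>}) (\<lambda>p. k (snd p))"
      by (rule continuous_on_compose2[OF line_decayD(2)[OF k\<nu>]]) (auto intro!: continuous_intros)
    moreover have "continuous_on ({z. \<bar>Im z\<bar> = \<mu>} \<times> {z. \<bar>Im z\<bar> = \<nu>}) (\<lambda>p. G (snd p) x)"
      using G(2) by (intro resolvent_family_continuous[OF G(1)] continuous_intros) auto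
    ultimately show "continuous_on ({z. \<bar>Im z\<bar> = \<mu>} \<times> {z. \<bar>Im z\<bar> = \<nu>}) (\<lambda>(b, a). (h b * exp_kernel (b - a) * k a) *\<^sub>C G a x)"
      unfolding split_def by (intro continuous_intros)
    fix b a assume b: "\<bar>Im b\<bar> = \<mu>" and a: "\<bar>Im a\<bar> = \<nu>"
    have "norm (G a x) \<le> K * norm x" using a G(2) by (intro resolvent_familyD(3)[OF G(1)]) auto
    then have "cmod (h b) * cmod (exp_kernel (b - a)) * cmod (k a) * norm (G a x) \<le>
        (C * exp (- e * \<bar>Re b\<bar>)) * Q * (C' * exp (- e * \<bar>Re a\<bar>)) * (K * norm x)"
      using C Q K by (intro mult_mono line_decayD(3)[OF h\<mu> b] line_decayD(3)[OF k\<nu> a] gap(2)[OF ab[OF a b]]) auto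
    then show "norm ((h b * exp_kernel (b - a) * k a) *\<^sub>C G a x) \<le>
        (C * Q * C' * (K * norm x)) * exp (- e * \<bar>Re b\<bar>) * exp (- e * \<bar>Re a\<bar>)"
      by (simp add: norm_scaleC norm_mult mult_ac)
  qed
  also have "\<dots> = boundary_integral \<nu> (\<lambda>a. (h a * k a) *\<^sub>C G a x)"
  proof (rule boundary_integral_cong[OF nn(1)])
    fix a assume a: "\<bar>Im a\<bar> = \<nu>"
    have "boundary_integral \<mu> (\<lambda>b. (h b * exp_kernel (b - a) * k a) *\<^sub>C G a x) = boundary_integral \<mu> (\<lambda>b. (h b * exp_kernel (b - a)) *\<^sub>C (k a *\<^sub>C G a x))"
      by (simp add: scaleC_scaleC)
    also have "\<dots> = boundary_integral \<mu> (\<lambda>b. h b * exp_kernel (b - a)) *\<^sub>C (k a *\<^sub>C G a x)"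
      by (rule boundary_integral_scaleC_left[OF nn(2) hk[OF a]])
    also have "boundary_integral \<mu> (\<lambda>b. h b * exp_kernel (b - a)) = h a"
    proof -
      have "integral UNIV (\<lambda>u. h (Complex u (- \<mu>)) * exp_kernel (Complex u (- \<mu>) - a)) -
          integral UNIV (\<lambda>u. h (Complex u \<mu>) * exp_kernel (Complex u \<mu> - a)) = 2 * pi * \<i> * h a"
        by (rule Cauchy_formula_two_lines[OF strip_decayD(1)[OF h] _ _ _ strip_decayD(2)[OF h] strip_decayD(3)[OF h]])
           (use \<nu> a integrable_line[OF nn(2) hk[OF a]] in auto)
      then show ?thesis unfolding boundary_integral_def by (simp add: scaleC_complex_def)
    qed
    finally show "boundary_integral \<mu> (\<lambda>b. (h b * exp_kernel (b - a) * k a) *\<^sub>C G a x) = (h a * k a) *\<^sub>C G a x"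
      by (simp add: scaleC_scaleC)
  qed
  finally show ?thesis .
qed

lemma strip_decay_mono:
  assumes "strip_decay r C e h" "0 < e'" "e' \<le> e" "0 < r"
  shows "strip_decay r C e' h"
  unfolding strip_decay_def
proof (intro conjI allI impI)
  fix z assume z: "\<bar>Im z\<bar> < r"
  have "C * exp (- e * \<bar>Re z\<bar>) \<le> C * exp (- e' * \<bar>Re z\<bar>)"
    using assms strip_decayD(4)[OF assms(1)] by (intro mult_left_mono) (auto intro: mult_right_mono)
  then show "cmod (h z) \<le> C * exp (- e' * \<bar>Re z\<bar>)"
    using strip_decayD(3)[OF assms(1) z] by linarith
qed (use assms strip_decayD(1)[OF assms(1)] in auto)

text \<open>In the sector this is the invariance of \<open>dz / z\<close> under dilations.\<close>

lemma boundary_integral_translation: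
  "boundary_integral \<nu> (\<lambda>z. H (z + of_real t)) = boundary_integral \<nu> H"
proof -
  have "integral UNIV (\<lambda>u. H (Complex u s + of_real t)) = integral UNIV (\<lambda>u. H (Complex u s))" for s
  proof -
    have "Complex u s + of_real t = Complex (u + t) s" for u by (simp add: complex_eq_iff)
    then show ?thesis using integral_UNIV_translation[of "\<lambda>u. H (Complex u s)" t] by simp
  qed
  then show ?thesis by (simp add: boundary_integral_def)
qed

text \<open>The triangle inequality turns half of the decay into decay in the shift
  \<open>s\<close>, and half of the decay in \<open>x\<close> remains to be integrated. This is the
  source of the rate \<open>e / 2\<close> below.\<close>

lemma exp_abs_shift_le:
  fixes e x s :: real assumes "0 \<le> e"
  shows "exp (- e * \<bar>x\<bar>) * exp (- e * \<bar>x + s\<bar>) \<le> exp (- (e/2) * \<bar>s\<bar>) * exp (- (e/2) * \<bar>x\<bar>)"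
proof -
  have "e / 2 * (\<bar>s\<bar> - \<bar>x\<bar>) \<le> e / 2 * \<bar>x + s\<bar>" using assms by (intro mult_left_mono) auto
  moreover have "e / 2 * \<bar>x + s\<bar> \<le> e * \<bar>x + s\<bar>" using assms by (intro mult_right_mono) auto
  ultimately have "- e * \<bar>x\<bar> + - e * \<bar>x + s\<bar> \<le> - (e/2) * \<bar>s\<bar> + - (e/2) * \<bar>x\<bar>"
    by (simp add: algebra_simps)
  then show ?thesis by (simp only: exp_add[symmetric] exp_le_cancel_iff)
qed

lemma holomorphic_cnj_strip:
  assumes "h holomorphic_on {z. \<bar>Im z\<bar> < r}"
  shows "(\<lambda>z. cnj (h (cnj z))) holomorphic_on {z. \<bar>Im z\<bar> < r}"
proof -
  have "cnj ` {z. \<bar>Im z\<bar> < r} = {z. \<bar>Im z\<bar> < r}"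
  proof (intro equalityI subsetI)
    show "z \<in> cnj ` {z. \<bar>Im z\<bar> < r}" if "z \<in> {z. \<bar>Im z\<bar> < r}" for z
      using that by (intro image_eqI[of _ _ "cnj z"]) auto
  qed auto
  then show ?thesis
    using assms open_strip holomorphic_on_compose_cnj_cnj[of h "{z. \<bar>Im z\<bar> < r}"]
    by (simp add: o_def)
qed

lemma strip_decay_cnj:
  assumes "strip_decay r C e h"
  shows "strip_decay r C e (\<lambda>z. cnj (h (cnj z)))"
  using assms holomorphic_cnj_strip[OF strip_decayD(1)[OF assms]]
  unfolding strip_decay_def by (auto dest: spec[of _ "cnj _"])

text \<open>The imaginary part of \<open>z\<close> is removed by shifting the line of integration,
  the real part by translation invariance. Hence the constant of the reproducing formula is the same
  at all points of the strip.\<close>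

lemma integral_strip_translate:
  assumes h: "strip_decay r C e h" and z: "\<bar>Im z\<bar> < r"
  shows "integral UNIV (\<lambda>s. h (z + of_real s)) = integral UNIV (\<lambda>s. h (of_real s))"
proof -
  have der: "(h has_derivative (\<lambda>t. t *\<^sub>C deriv h w)) (at w)" if "\<bar>Im w\<bar> < r" for w
  proof -
    have "(h has_derivative (*) (deriv h w)) (at w)"
      using holomorphic_derivI[OF strip_decayD(1)[OF h] open_strip, of w UNIV] that
      by (simp add: has_field_derivative_def)
    moreover have "(*) (deriv h w) = (\<lambda>t. t *\<^sub>C deriv h w)"
      by (auto simp: scaleC_complex_def mult.commute)
    ultimately show ?thesis by simp
  qed
  have cont: "continuous_on {z. \<bar>Im z\<bar> < r} (deriv h)"
    by (intro holomorphic_on_imp_continuous_on holomorphic_deriv strip_decayD(1)[OF h] open_strip)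
  have shift: "integral UNIV (\<lambda>u. h (Complex u t0)) = integral UNIV (\<lambda>u. h (Complex u t1))"
    if "t0 \<le> t1" "- r < t0" "t1 < r" for t0 t1
    by (rule integral_line_shift[OF that(1) der _ strip_decayD(2)[OF h] strip_decayD(3)[OF h]])
       (use that in \<open>auto intro: continuous_on_subset[OF cont]\<close>)
  have "integral UNIV (\<lambda>u. h (Complex u (Im z))) = integral UNIV (\<lambda>u. h (Complex u 0))"
  proof (cases "0 \<le> Im z")
    case True
    show ?thesis by (rule shift[symmetric]) (use True z in auto)
  next
    case False
    show ?thesis by (rule shift) (use False z in auto)
  qed
  moreover have "integral UNIV (\<lambda>s. h (z + of_real s)) = integral UNIV (\<lambda>u. h (Complex u (Im z)))"
  proof -
    have "z + of_real s = Complex (s + Re z) (Im z)" for s by (simp add: complex_eq_iff)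
    then show ?thesis using integral_UNIV_translation[of "\<lambda>u. h (Complex u (Im z))" "Re z"] by simp
  qed
  ultimately show ?thesis by (simp only: complex_of_real_def)
qed

lemma strip_zero_if_zero_on_Reals:
  assumes h: "h holomorphic_on {z. \<bar>Im z\<bar> < r}" and 0: "\<And>s::real. h (of_real s) = 0" and z: "\<bar>Im z\<bar> < r"
  shows "h z = 0"
proof (rule analytic_continuation[OF h open_strip])
  have "{z. \<bar>Im z\<bar> < r} = {c. Im c < r} \<inter> {c. - r < Im c}" by auto
  then show "connected {z. \<bar>Im z\<bar> < r}"
    by (auto intro!: convex_connected convex_Int convex_halfspace_Im_lt convex_halfspace_Im_gt)
  show "\<real> \<subseteq> {z. \<bar>Im z\<bar> < r}" using z by (auto elim!: Reals_cases)
  show "(0::complex) \<in> {z. \<bar>Im z\<bar> < r}" using z by auto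
  show "(0::complex) islimpt \<real>"
    unfolding islimpt_approachable
  proof (intro allI impI)
    fix d :: real assume "0 < d"
    then show "\<exists>x'\<in>\<real>. x' \<noteq> 0 \<and> dist x' (0::complex) < d"
      by (intro bexI[of _ "of_real (d/2)"]) auto
  qed
qed (use 0 z in \<open>auto elim!: Reals_cases\<close>)

text \<open>On the real line the integrand is \<open>(cmod (h s))\<^sup>2\<close>. If its integral
  vanished, \<open>h\<close> would vanish there by continuity and then on the whole strip by the
  identity theorem.\<close>

lemma integral_cnj_mult_self_nonzero:
  assumes h: "strip_decay r C e h" and nz: "\<bar>Im z\<bar> < r" "h z \<noteq> 0"
  shows "integral UNIV (\<lambda>s::real. cnj (h (cnj (of_real s))) * h (of_real s)) \<noteq> 0"
proof
  assume 0: "integral UNIV (\<lambda>s::real. cnj (h (cnj (of_real s))) * h (of_real s)) = 0"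
  have r: "0 < r" using nz by linarith
  have dec: "exp_decay (C * C) e (\<lambda>s::real. (cmod (h (of_real s)))\<^sup>2)"
    unfolding exp_decay_def
  proof (intro conjI allI strip_decayD(2)[OF h])
    show "continuous_on UNIV (\<lambda>s. (cmod (h (of_real s)))\<^sup>2)"
      using r by (intro continuous_intros continuous_on_compose2[OF strip_decay_continuous[OF h order_refl]]) auto
    show "norm ((cmod (h (of_real u)))\<^sup>2) \<le> C * C * exp (- e * \<bar>u\<bar>)" for u
      using mult_mono[OF strip_decay_bounded[OF h, of "of_real u"] strip_decayD(3)[OF h, of "of_real u"]]
        strip_decayD(4)[OF h r] r
      by (simp add: power2_eq_square mult_ac)
  qed
  have "integral UNIV (\<lambda>s::real. cnj (h (cnj (of_real s))) * h (of_real s)) =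
      integral UNIV (\<lambda>s::real. of_real ((cmod (h (of_real s)))\<^sup>2))"
    by (simp only: complex_cnj_complex_of_real mult.commute[of "cnj _"] complex_norm_square)
  also have "\<dots> = of_real (integral UNIV (\<lambda>s::real. (cmod (h (of_real s)))\<^sup>2))"
    using integral_linear[OF exp_decay_integrable(1)[OF dec] bounded_linear_of_real, where 'a1 = complex]
    by (simp add: o_def)
  finally have I: "integral UNIV (\<lambda>s::real. (cmod (h (of_real s)))\<^sup>2) = 0"
    using 0 by simp
  have "h (of_real s) = 0" for s
  proof -
    let ?I = "{- \<bar>s\<bar> - 1..\<bar>s\<bar> + 1}"
    have int: "(\<lambda>s::real. (cmod (h (of_real s)))\<^sup>2) integrable_on ?I"
      by (rule integrable_on_subinterval[OF exp_decay_integrable(1)[OF dec]]) simp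
    have "integral ?I (\<lambda>s::real. (cmod (h (of_real s)))\<^sup>2) \<le> 0"
      using integral_subset_le[OF _ int exp_decay_integrable(1)[OF dec]] I by simp
    moreover have "0 \<le> integral ?I (\<lambda>s::real. (cmod (h (of_real s)))\<^sup>2)"
      by (rule integral_nonneg[OF int]) simp
    ultimately have "((\<lambda>s::real. (cmod (h (of_real s)))\<^sup>2) has_integral 0) (cbox (- \<bar>s\<bar> - 1) (\<bar>s\<bar> + 1))"
      using integrable_integral[OF int] by simp
    then have "(cmod (h (of_real s)))\<^sup>2 = 0"
      by (rule has_integral_0_cbox_imp_0[rotated 2])
         (auto intro!: exp_decayD(2)[OF dec] simp: box_ne_empty)
    then show ?thesis by simp
  qed
  then have "h z = 0"
    using strip_zero_if_zero_on_Reals[OF strip_decayD(1)[OF h]] nz by blast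
  then show False using nz by simp
qed

section \<open>The functional calculus and the reproducing formula\<close>

text \<open>\<open>Complex 0 pi\<close> corresponds to \<open>z = - 1\<close>, so \<open>G (Complex 0 pi)\<close> plays the role of \<open>(1 + A)\<^sup>-\<^sup>1\<close>, and \<open>F 0\<close>
  that of \<open>(1 + B)\<^sup>-\<^sup>1\<close>.\<close>

locale sectorial_families =
  fixes G F :: "complex \<Rightarrow> 'a::complex_banach \<Rightarrow> 'a" and UG UF :: "complex set" and K L :: real
    and \<nu> \<mu> r :: real and \<Phi> :: "complex \<Rightarrow> complex" and C e :: real
  assumes angles: "0 < \<nu>" "\<nu> < \<mu>" "\<mu> < r" "r < pi"
    and G: "resolvent_family UG K G" "{z. \<bar>Im z\<bar> = \<nu>} \<subseteq> UG" "{z. \<bar>Im z\<bar> = \<mu>} \<subseteq> UG" "Complex 0 pi \<in> UG"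
    and F: "resolvent_family UF L F" "{z. \<bar>Im z\<bar> < r} \<subseteq> UF"
    and GF: "\<And>a b v. a \<in> UG \<Longrightarrow> b \<in> UF \<Longrightarrow> G a (F b v) = F b (G a v)"
    and \<Phi>: "strip_decay r C e \<Phi>" and nonzero: "\<exists>z. \<bar>Im z\<bar> < r \<and> \<Phi> z \<noteq> 0"
begin

lemma nn [simp]: "0 \<le> \<nu>" "0 \<le> \<mu>" using angles by auto

lemma e_pos: "0 < e" and C_nonneg: "0 \<le> C"
  using strip_decayD[OF \<Phi>] angles by auto

text \<open>With \<open>\<Phi> a = \<phi>(exp a)\<close> this corresponds to
  \<open>z \<mapsto> \<phi>(exp t z)\<close>, so that \<open>calc (\<Phi>t t)\<close> is
  \<open>\<phi>(exp t A)\<close>.\<close>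

definition \<Phi>t :: "real \<Rightarrow> complex \<Rightarrow> complex" where
  "\<Phi>t t z = \<Phi> (z + of_real t)"

definition calc :: "(complex \<Rightarrow> complex) \<Rightarrow> 'a \<Rightarrow> 'a" where
  "calc h x = boundary_integral \<nu> (\<lambda>z. h z *\<^sub>C G z x)"

lemma \<Phi>t: "strip_decay r (C * exp (e * \<bar>t\<bar>)) e (\<Phi>t t)"
  unfolding \<Phi>t_def by (rule strip_decay_translate[OF \<Phi>])

lemma \<Phi>t_le: "\<bar>Im z\<bar> < r \<Longrightarrow> cmod (\<Phi>t t z) \<le> C * exp (- e * \<bar>Re z + t\<bar>)"
  unfolding \<Phi>t_def using strip_decayD(3)[OF \<Phi>, of "z + of_real t"] by simp

lemma line_decay_G:
  assumes "line_decay \<nu> B d h"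
  shows "line_decay \<nu> (B * (K * norm x)) d (\<lambda>z. h z *\<^sub>C G z x)"
  by (rule line_decay_resolvent[OF assms nn(1) G(1,2)]) auto

lemma calc_commute:
  assumes h: "line_decay \<nu> B d h" and T: "bounded_clinear T"
    and c: "\<And>z v. \<bar>Im z\<bar> = \<nu> \<Longrightarrow> T (G z v) = G z (T v)"
  shows "T (calc h x) = calc h (T x)"
proof -
  have "T (calc h x) = boundary_integral \<nu> (\<lambda>z. T (h z *\<^sub>C G z x))"
    unfolding calc_def by (rule boundary_integral_bounded_clinear[OF nn(1) line_decay_G[OF h] T, symmetric])
  also have "\<dots> = calc h (T x)"
    unfolding calc_def by (rule boundary_integral_cong) (auto simp: bounded_clinear_simps[OF T] c)
  finally show ?thesis .
qed

lemma calc_add: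
  assumes h: "line_decay \<nu> B d h"
  shows "calc h (x + y) = calc h x + calc h y"
proof -
  have "calc h (x + y) = boundary_integral \<nu> (\<lambda>z. h z *\<^sub>C G z x + h z *\<^sub>C G z y)"
    unfolding calc_def
  proof (rule boundary_integral_cong[OF nn(1)])
    fix z assume "\<bar>Im z\<bar> = \<nu>"
    then have "z \<in> UG" using G(2) by blast
    then show "h z *\<^sub>C G z (x + y) = h z *\<^sub>C G z x + h z *\<^sub>C G z y"
      by (simp add: bounded_clinear_simps[OF resolvent_familyD(2)[OF G(1)]] scaleC_add_right)
  qed
  then show ?thesis unfolding calc_def by (simp add: boundary_integral_add[OF nn(1) line_decay_G[OF h] line_decay_G[OF h]])
qed

lemma calc_bounded:
  assumes h: "line_decay \<nu> B d h"
  shows "bounded_clinear (calc h)"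
  unfolding bounded_clinear_def
proof (intro conjI allI)
  show sc: "calc h (c *\<^sub>C x) = c *\<^sub>C calc h x" for c x
  proof -
    have "calc h (c *\<^sub>C x) = boundary_integral \<nu> (\<lambda>z. c *\<^sub>C (h z *\<^sub>C G z x))"
      unfolding calc_def
    proof (rule boundary_integral_cong[OF nn(1)])
      fix z assume "\<bar>Im z\<bar> = \<nu>"
      then have "z \<in> UG" using G(2) by blast
      then show "h z *\<^sub>C G z (c *\<^sub>C x) = c *\<^sub>C (h z *\<^sub>C G z x)"
        by (simp add: bounded_clinear_simps[OF resolvent_familyD(2)[OF G(1)]] scaleC_scaleC mult.commute)
    qed
    then show ?thesis unfolding calc_def by (simp add: boundary_integral_scaleC[OF nn(1) line_decay_G[OF h]])
  qed
  show "bounded_linear (calc h)"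
  proof (rule bounded_linear_intro)
    show "calc h (x + y) = calc h x + calc h y" for x y by (rule calc_add[OF h])
    show "calc h (t *\<^sub>R x) = t *\<^sub>R calc h x" for t x
      using sc[of "of_real t" x] by (simp add: scaleC_of_real)
    show "norm (calc h x) \<le> norm x * (B * K * (2 / d))" for x
      using norm_boundary_integral_le[OF nn(1) line_decay_G[OF h, of x]] unfolding calc_def by (simp add: mult_ac)
  qed
qed

lemma \<Phi>t_line: "line_decay \<nu> (C * exp (e * \<bar>t\<bar>)) e (\<Phi>t t)"
  by (rule strip_decay_line[OF \<Phi>t]) (use angles in auto)

text \<open>Translation moves the dilation from \<Phi> to \<open>G\<close>, whose bound
  \<open>K\<close> is invariant under it. The bound is therefore uniform in \<open>t\<close>, unlike
  the decay constant of \<open>\<Phi>t t\<close>.\<close>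

lemma norm_calc_\<Phi>t_le: "norm (calc (\<Phi>t t) x) \<le> C * (K * norm x) * (2 / e)"
proof -
  have "calc (\<Phi>t t) x = boundary_integral \<nu> (\<lambda>z. \<Phi>t t (z + of_real (- t)) *\<^sub>C G (z + of_real (- t)) x)"
    unfolding calc_def by (rule boundary_integral_translation[symmetric])
  also have "\<dots> = boundary_integral \<nu> (\<lambda>z. \<Phi> z *\<^sub>C G (z + of_real (- t)) x)"
    by (simp add: \<Phi>t_def)
  also have "norm \<dots> \<le> C * (K * norm x) * (2 / e)"
  proof (rule norm_boundary_integral_le[OF nn(1) line_decayI])
    show "continuous_on {z. \<bar>Im z\<bar> = \<nu>} (\<lambda>z. \<Phi> z *\<^sub>C G (z + of_real (- t)) x)"
      using G(2) angles
      by (intro continuous_intros strip_decay_continuous[OF \<Phi>] resolvent_family_continuous[OF G(1)]) auto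
    fix z assume z: "\<bar>Im z\<bar> = \<nu>"
    then have "z + of_real (- t) \<in> UG" using G(2) by auto
    then show "norm (\<Phi> z *\<^sub>C G (z + of_real (- t)) x) \<le> C * (K * norm x) * exp (- e * \<bar>Re z\<bar>)"
      using mult_mono[OF strip_decayD(3)[OF \<Phi>, of z] resolvent_familyD(3)[OF G(1)], of "z + of_real (- t)" x]
        z angles C_nonneg by (simp add: norm_scaleC mult_ac)
  qed (rule e_pos)
  finally show ?thesis .
qed

text \<open>Continuity is local, and for bounded \<open>t\<close> the functions
  \<open>\<Phi>t t\<close> have a common exponential majorant.\<close>

lemma continuous_calc_\<Phi>t: "continuous_on A (\<lambda>t. calc (\<Phi>t t) x)"
proof -
  have "continuous_on {-real n<..<real n} (\<lambda>t. calc (\<Phi>t t) x)" for n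
  proof -
    have "continuous_on {-real n<..<real n} (\<lambda>t. integral UNIV (\<lambda>u. \<Phi>t t (Complex u s) *\<^sub>C G (Complex u s) x))"
      if s: "\<bar>s\<bar> = \<nu>" for s
    proof (rule continuous_on_integral_UNIV[OF _ e_pos])
      have "continuous_on ({-real n<..<real n} \<times> UNIV) (\<lambda>p. \<Phi> (Complex (snd p) s + of_real (fst p)))"
        unfolding Complex_eq using s angles
        by (intro continuous_on_compose2[OF strip_decay_continuous[OF \<Phi> order_refl]] continuous_intros) auto
      moreover have "continuous_on ({-real n<..<real n} \<times> UNIV) (\<lambda>p. G (Complex (snd p) s) x)"
        using s G(2) unfolding Complex_eq
        by (intro resolvent_family_continuous[OF G(1)] continuous_intros) auto
      ultimately show "continuous_on ({-real n<..<real n} \<times> UNIV) (\<lambda>(t, u). \<Phi>t t (Complex u s) *\<^sub>C G (Complex u s) x)"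
        unfolding split_def \<Phi>t_def by (intro continuous_intros)
      fix t u :: real assume t: "t \<in> {-real n<..<real n}"
      have "cmod (\<Phi>t t (Complex u s)) \<le> C * exp (e * \<bar>t\<bar>) * exp (- e * \<bar>u\<bar>)"
        using strip_decayD(3)[OF \<Phi>t, of "Complex u s" t] s angles by simp
      also have "\<dots> \<le> C * exp (e * real n) * exp (- e * \<bar>u\<bar>)"
        using t e_pos C_nonneg by (intro mult_right_mono mult_left_mono) auto
      finally have "cmod (\<Phi>t t (Complex u s)) \<le> C * exp (e * real n) * exp (- e * \<bar>u\<bar>)" .
      moreover have "Complex u s \<in> UG" using s G(2) by auto
      ultimately have "cmod (\<Phi>t t (Complex u s)) * norm (G (Complex u s) x) \<le>
          (C * exp (e * real n) * exp (- e * \<bar>u\<bar>)) * (K * norm x)"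
        using C_nonneg by (intro mult_mono resolvent_familyD(3)[OF G(1)]) auto
      then show "norm (\<Phi>t t (Complex u s) *\<^sub>C G (Complex u s) x) \<le> (C * exp (e * real n) * (K * norm x)) * exp (- e * \<bar>u\<bar>)"
        by (simp only: norm_scaleC mult_ac)
    qed
    then show ?thesis unfolding calc_def boundary_integral_def by (intro continuous_intros) auto
  qed
  then have "isCont (\<lambda>t. calc (\<Phi>t t) x) t" for t
    using continuous_on_eq_continuous_at[of "{-real n<..<real n}" for n] reals_Archimedean2[of "\<bar>t\<bar>"]
    by (metis abs_less_iff greaterThanLessThan_iff minus_less_iff open_greaterThanLessThan)
  then show ?thesis by (simp add: continuous_at_imp_continuous_on)
qed

text \<open>On the real line \<open>\<Psi>t s * \<Phi>t s\<close> is nonnegative; its integral over \<open>s\<close> is constant on the strip.\<close>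

definition \<Psi>t :: "real \<Rightarrow> complex \<Rightarrow> complex" where
  "\<Psi>t t z = cnj (\<Phi> (cnj (z + of_real t)))"

lemma \<Psi>t: "strip_decay r (C * exp (e * \<bar>t\<bar>)) e (\<Psi>t t)"
  unfolding \<Psi>t_def by (rule strip_decay_translate[OF strip_decay_cnj[OF \<Phi>]])

lemma \<Psi>t_le: "\<bar>Im z\<bar> < r \<Longrightarrow> cmod (\<Psi>t t z) \<le> C * exp (- e * \<bar>Re z + t\<bar>)"
  unfolding \<Psi>t_def using strip_decayD(3)[OF \<Phi>, of "cnj (z + of_real t)"] by simp

definition \<kappa> :: complex where
  "\<kappa> = integral UNIV (\<lambda>s::real. cnj (\<Phi> (cnj (of_real s))) * \<Phi> (of_real s))"

lemma \<kappa>_nonzero: "\<kappa> \<noteq> 0"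
  unfolding \<kappa>_def using nonzero integral_cnj_mult_self_nonzero[OF \<Phi>] by blast

lemma integral_\<Psi>t_\<Phi>t: "\<bar>Im z\<bar> < r \<Longrightarrow> integral UNIV (\<lambda>s. \<Psi>t s z * \<Phi>t s z) = \<kappa>"
  using integral_strip_translate[OF strip_decay_mult[OF strip_decay_cnj[OF \<Phi>] \<Phi>]]
  by (simp add: \<kappa>_def \<Psi>t_def \<Phi>t_def)

text \<open>Exchanging the integrals leaves the integral of \<open>\<Psi>t s z * \<Phi>t s z\<close>
  over \<open>s\<close> at each point \<open>z\<close> of the lines, which is \<kappa>. The exchange
  is justified by sharing the decay of the integrand between \<open>s\<close> and
  \<open>Re z\<close>.\<close>

lemma reproducing:
  "integral UNIV (\<lambda>s. calc (\<lambda>z. \<Phi>t t z * \<Psi>t s z * \<Phi>t s z) x) = \<kappa> *\<^sub>C calc (\<Phi>t t) x"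
  "(\<lambda>s. calc (\<lambda>z. \<Phi>t t z * \<Psi>t s z * \<Phi>t s z) x) integrable_on UNIV"
proof -
  define M where "M s z = (\<Phi>t t z * \<Psi>t s z * \<Phi>t s z) *\<^sub>C G z x" for s z
  have Hs: "strip_decay r (C * C) e (\<lambda>z. cnj (\<Phi> (cnj z)) * \<Phi> z)"
    by (rule strip_decay_mult[OF strip_decay_cnj[OF \<Phi>] \<Phi>])
  have cont: "continuous_on (UNIV \<times> {z. \<bar>Im z\<bar> = \<nu>}) (\<lambda>(s, z). M s z)"
  proof -
    have c1: "continuous_on (UNIV \<times> {z. \<bar>Im z\<bar> = \<nu>}) (\<lambda>p. (\<lambda>z. cnj (\<Phi> (cnj z)) * \<Phi> z) (snd p + of_real (fst p)))"
      by (rule continuous_on_compose2[OF strip_decay_continuous[OF Hs order_refl]])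
         (use angles in \<open>auto intro!: continuous_intros\<close>)
    have c2: "continuous_on (UNIV \<times> {z. \<bar>Im z\<bar> = \<nu>}) (\<lambda>p. \<Phi>t t (snd p))"
      by (rule continuous_on_compose2[OF line_decayD(2)[OF \<Phi>t_line]]) (auto intro!: continuous_intros)
    have c3: "continuous_on (UNIV \<times> {z. \<bar>Im z\<bar> = \<nu>}) (\<lambda>p. G (snd p) x)"
      using G(2) by (intro resolvent_family_continuous[OF G(1)] continuous_intros) auto
    from continuous_on_scaleC[OF continuous_on_mult[OF c2 c1] c3]
    show ?thesis by (simp add: M_def split_def \<Psi>t_def \<Phi>t_def mult.assoc)
  qed
  define B where "B = C * exp (e * \<bar>t\<bar>) * (C * C) * (K * norm x)"
  have le: "norm (M s z) \<le> B * exp (- (e/2) * \<bar>s\<bar>) * exp (- (e/2) * \<bar>Re z\<bar>)" if z: "\<bar>Im z\<bar> = \<nu>" for s z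
  proof -
    have zU: "z \<in> UG" using z G(2) by blast
    have 1: "cmod (\<Phi>t t z) \<le> C * exp (e * \<bar>t\<bar>) * exp (- e * \<bar>Re z\<bar>)"
      using strip_decayD(3)[OF \<Phi>t, of z t] z angles by simp
    have 2: "cmod (\<Psi>t s z * \<Phi>t s z) \<le> C * C * exp (- e * \<bar>Re z + s\<bar>)"
      using strip_decayD(3)[OF Hs, of "z + of_real s"] z angles by (simp add: \<Psi>t_def \<Phi>t_def)
    have "norm (M s z) = cmod (\<Phi>t t z) * cmod (\<Psi>t s z * \<Phi>t s z) * norm (G z x)"
      by (simp add: M_def norm_scaleC norm_mult)
    also have "\<dots> \<le> (C * exp (e * \<bar>t\<bar>) * exp (- e * \<bar>Re z\<bar>)) * (C * C * exp (- e * \<bar>Re z + s\<bar>)) * (K * norm x)"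
      using C_nonneg by (intro mult_mono 1 2 resolvent_familyD(3)[OF G(1) zU]) auto
    also have "\<dots> = B * (exp (- e * \<bar>Re z\<bar>) * exp (- e * \<bar>Re z + s\<bar>))"
      by (simp add: B_def mult_ac)
    also have "\<dots> \<le> B * (exp (- (e/2) * \<bar>s\<bar>) * exp (- (e/2) * \<bar>Re z\<bar>))"
      using C_nonneg e_pos resolvent_familyD(1)[OF G(1)]
      by (intro mult_left_mono exp_abs_shift_le) (auto simp: B_def)
    finally show ?thesis by (simp add: mult_ac)
  qed
  have e2: "0 < e / 2" using e_pos by simp
  note sw = integral_UNIV_line_swap[OF nn(1) cont e2 le]
  show "(\<lambda>s. calc (\<lambda>z. \<Phi>t t z * \<Psi>t s z * \<Phi>t s z) x) integrable_on UNIV"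
    using exp_decay_integrable(1)[OF sw(3)] by (simp add: calc_def M_def)
  have "integral UNIV (\<lambda>s. calc (\<lambda>z. \<Phi>t t z * \<Psi>t s z * \<Phi>t s z) x) = boundary_integral \<nu> (\<lambda>z. integral UNIV (\<lambda>s. M s z))"
    using sw(1) by (simp add: calc_def M_def)
  also have "\<dots> = boundary_integral \<nu> (\<lambda>z. \<kappa> *\<^sub>C (\<Phi>t t z *\<^sub>C G z x))"
  proof (rule boundary_integral_cong[OF nn(1)])
    fix z assume z: "\<bar>Im z\<bar> = \<nu>"
    have zr: "\<bar>Im z\<bar> < r" using z angles by simp
    have "exp_decay (C * C * exp (e * \<bar>Re z\<bar>)) e (\<lambda>s. \<Psi>t s z * \<Phi>t s z)"
      unfolding exp_decay_def
    proof (intro conjI allI e_pos)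
      have "continuous_on UNIV (\<lambda>s::real. (\<lambda>z. cnj (\<Phi> (cnj z)) * \<Phi> z) (z + of_real s))"
        by (rule continuous_on_compose2[OF strip_decay_continuous[OF Hs order_refl]])
           (use zr in \<open>auto intro!: continuous_intros\<close>)
      then show "continuous_on UNIV (\<lambda>s. \<Psi>t s z * \<Phi>t s z)" by (simp add: \<Psi>t_def \<Phi>t_def)
      fix s
      show "cmod (\<Psi>t s z * \<Phi>t s z) \<le> C * C * exp (e * \<bar>Re z\<bar>) * exp (- e * \<bar>s\<bar>)"
      proof -
        have "Complex s (Im z) + of_real (Re z) = z + of_real s" by (simp add: complex_eq_iff)
        then show ?thesis
          using strip_decayD(3)[OF strip_decay_translate[OF Hs, of "Re z"], of "Complex s (Im z)"] zr
          unfolding \<Psi>t_def \<Phi>t_def by simp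
      qed
    qed
    then have int: "(\<lambda>s. \<Psi>t s z * \<Phi>t s z) integrable_on UNIV" by (rule exp_decay_integrable(1))
    have "integral UNIV (\<lambda>s. M s z) = integral UNIV (\<lambda>s. (\<Psi>t s z * \<Phi>t s z) *\<^sub>C (\<Phi>t t z *\<^sub>C G z x))"
      by (simp add: M_def scaleC_scaleC mult_ac)
    also have "\<dots> = \<kappa> *\<^sub>C (\<Phi>t t z *\<^sub>C G z x)"
      by (simp add: integral_scaleC_left[OF int] integral_\<Psi>t_\<Phi>t[OF zr])
    finally show "integral UNIV (\<lambda>s. M s z) = \<kappa> *\<^sub>C (\<Phi>t t z *\<^sub>C G z x)" .
  qed
  also have "\<dots> = \<kappa> *\<^sub>C calc (\<Phi>t t) x"
    unfolding calc_def by (rule boundary_integral_scaleC[OF nn(1) line_decay_G[OF \<Phi>t_line]])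
  finally show "integral UNIV (\<lambda>s. calc (\<lambda>z. \<Phi>t t z * \<Psi>t s z * \<Phi>t s z) x) = \<kappa> *\<^sub>C calc (\<Phi>t t) x" .
qed

end

section \<open>The function \<open>z / (1 + z)\<close> and smooth truncations built from it\<close>

lemma exp_plus_pi: "exp (a + Complex 0 pi) = - exp a" "exp (a - Complex 0 pi) = - exp a"
proof -
  have "Complex 0 pi = of_real pi * \<i>" by (simp add: complex_eq_iff)
  then show "exp (a + Complex 0 pi) = - exp a" "exp (a - Complex 0 pi) = - exp a"
    by (simp_all add: exp_add exp_diff)
qed

definition logistic :: "complex \<Rightarrow> complex" where
  "logistic a = 1 / (1 + exp (- a))"

lemma logistic_exp_kernel: "logistic a = exp_kernel (a + Complex 0 pi)"
  using exp_plus_pi(2)[of "- a"] by (simp add: logistic_def exp_kernel_def)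

text \<open>The imaginary part of \<open>a + Complex 0 pi\<close> stays at distance
  \<open>pi - r\<close> from \<open>0\<close> and \<open>2 * pi\<close>, so the kernel bounds apply.
  The last bound interpolates between the two before it; \<open>approx_unit_bounds\<close> needs
  this weaker exponent.\<close>

lemma cmod_logistic_le:
  assumes r: "0 < r" "r < pi" and a: "\<bar>Im a\<bar> < r"
  defines "Q \<equiv> 1 / sin ((pi - r) / 2)"
  shows "1 + exp (- a) \<noteq> 0" "cmod (logistic a) \<le> Q" "cmod (logistic a) \<le> Q * exp (Re a)" "cmod (logistic a) \<le> Q * exp (Re a / 2)"
proof -
  have g: "0 < pi - r" "pi - r \<le> pi" "pi - r \<le> \<bar>Im (a + Complex 0 pi)\<bar>"
    "\<bar>Im (a + Complex 0 pi)\<bar> \<le> 2 * pi - (pi - r)"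
    using r a by auto
  have exps: "exp (- (a + Complex 0 pi)) = - exp (- a)"
    using exp_plus_pi(2)[of "- a"] by simp
  show "1 + exp (- a) \<noteq> 0" using cmod_exp_kernel_le(1)[OF g] unfolding exps by simp
  have Q: "Q > 0" using sin_half_pos[OF g(1,2)] by (simp add: Q_def)
  show le1: "cmod (logistic a) \<le> Q" using cmod_exp_kernel_le(3)[OF g] by (simp add: logistic_exp_kernel Q_def)
  have *: "cmod (logistic a) * (1 + exp (- Re a)) \<le> Q" using cmod_exp_kernel_le(2)[OF g] by (simp add: logistic_exp_kernel Q_def)
  have "cmod (logistic a) * exp (- Re a) \<le> Q"
    using * norm_ge_zero[of "logistic a"] by (simp only: distrib_left)
  then show le2: "cmod (logistic a) \<le> Q * exp (Re a)"
    by (simp add: exp_minus field_simps)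
  show "cmod (logistic a) \<le> Q * exp (Re a / 2)"
  proof (cases "0 \<le> Re a")
    case True
    then have "Q * 1 \<le> Q * exp (Re a / 2)" using Q by (intro mult_left_mono) auto
    then show ?thesis using le1 by simp
  next
    case False
    then have "Q * exp (Re a) \<le> Q * exp (Re a / 2)" using Q by (intro mult_left_mono) auto
    then show ?thesis using le2 by simp
  qed
qed

lemma logistic_holomorphic: "0 < r \<Longrightarrow> r < pi \<Longrightarrow> logistic holomorphic_on {z. \<bar>Im z\<bar> < r}"
  unfolding logistic_def using cmod_logistic_le(1) by (intro holomorphic_intros) auto

lemma one_minus_logistic:
  assumes "1 + exp (- a) \<noteq> 0"
  shows "1 - logistic a = logistic (- a)" "logistic (- a) = exp (- a) * logistic a"
proof -
  have "exp a * (1 + exp (- a)) \<noteq> 0" using assms by simp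
  then have "1 + exp a \<noteq> 0" by (simp add: distrib_left exp_minus add.commute)
  then show "logistic (- a) = exp (- a) * logistic a" "1 - logistic a = logistic (- a)"
    using assms by (simp_all add: logistic_def field_simps exp_minus)
qed

text \<open>In the variable \<open>z\<close> this is \<open>(n z / (1 + n z) * (1 + z / n)\<^sup>-\<^sup>1)\<^sup>2\<close> with \<open>n = exp m\<close>. The square gives the decay
  needed to divide by \<open>z\<close> in the construction of preimages under \<open>A + B\<close>.\<close>

definition approx_unit :: "real \<Rightarrow> complex \<Rightarrow> complex" where
  "approx_unit m z = (logistic (z + of_real m) * logistic (of_real m - z))\<^sup>2"

text \<open>The rate \<open>2\<close> is due to the square. In the second bound
  \<open>1 - logistic\<close> is estimated with a halved exponent: the price
  \<open>exp (\<bar>Re z\<bar> / 2)\<close> for the gain \<open>exp (- m / 2)\<close> is outweighed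
  by a factor that decays like \<open>exp (- \<bar>Re z\<bar>)\<close>, with decay to spare.\<close>

lemma approx_unit_bounds:
  assumes r: "0 < r" "r < pi" and m: "0 \<le> m"
  defines "Q \<equiv> 1 / sin ((pi - r) / 2)"
  shows "strip_decay r (Q ^ 4 * exp (2 * m)) 2 (approx_unit m)"
    "\<And>z. \<bar>Im z\<bar> < r \<Longrightarrow> cmod (1 - approx_unit m z) \<le> (1 + Q * Q) * ((1 + Q) * Q) * exp (- m / 2) * exp (\<bar>Re z\<bar> / 2)"
proof -
  have Q: "Q > 0" using sin_half_pos[of "pi - r"] r by (simp add: Q_def)
  have p: "cmod (logistic (z + of_real m)) \<le> Q" "cmod (logistic (z + of_real m)) \<le> Q * exp (Re z + m)"
    and q: "cmod (logistic (of_real m - z)) \<le> Q" "cmod (logistic (of_real m - z)) \<le> Q * exp (m - Re z)"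
    and p1: "cmod (1 - logistic (z + of_real m)) \<le> Q * exp (- m / 2) * exp (\<bar>Re z\<bar> / 2)"
    and q1: "cmod (1 - logistic (of_real m - z)) \<le> Q * exp (- m / 2) * exp (\<bar>Re z\<bar> / 2)"
    if z: "\<bar>Im z\<bar> < r" for z
  proof -
    have i: "\<bar>Im (z + of_real m)\<bar> < r" "\<bar>Im (of_real m - z)\<bar> < r" "\<bar>Im (- (z + of_real m))\<bar> < r" "\<bar>Im (- (of_real m - z))\<bar> < r"
      using z by auto
    note s = cmod_logistic_le[OF r i(1), folded Q_def] cmod_logistic_le[OF r i(2), folded Q_def]
      cmod_logistic_le(4)[OF r i(3), folded Q_def] cmod_logistic_le(4)[OF r i(4), folded Q_def]
    show "cmod (logistic (z + of_real m)) \<le> Q" "cmod (logistic (z + of_real m)) \<le> Q * exp (Re z + m)"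
      "cmod (logistic (of_real m - z)) \<le> Q" "cmod (logistic (of_real m - z)) \<le> Q * exp (m - Re z)"
      using s by auto
    have "exp (Re (- (z + of_real m)) / 2) \<le> exp (- m / 2) * exp (\<bar>Re z\<bar> / 2)"
      "exp (Re (- (of_real m - z)) / 2) \<le> exp (- m / 2) * exp (\<bar>Re z\<bar> / 2)"
      by (simp_all flip: exp_add)
    then have "Q * exp (Re (- (z + of_real m)) / 2) \<le> Q * (exp (- m / 2) * exp (\<bar>Re z\<bar> / 2))"
      "Q * exp (Re (- (of_real m - z)) / 2) \<le> Q * (exp (- m / 2) * exp (\<bar>Re z\<bar> / 2))"
      using Q by (auto intro!: mult_left_mono)
    then show "cmod (1 - logistic (z + of_real m)) \<le> Q * exp (- m / 2) * exp (\<bar>Re z\<bar> / 2)"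
      "cmod (1 - logistic (of_real m - z)) \<le> Q * exp (- m / 2) * exp (\<bar>Re z\<bar> / 2)"
      using s(9,10) unfolding one_minus_logistic(1)[OF s(1)] one_minus_logistic(1)[OF s(5)] mult.assoc
      by linarith+
  qed
  show "strip_decay r (Q ^ 4 * exp (2 * m)) 2 (approx_unit m)"
    unfolding strip_decay_def
  proof (intro conjI allI impI)
    have "logistic \<circ> (\<lambda>z. z + of_real m) holomorphic_on {z. \<bar>Im z\<bar> < r}"
      "logistic \<circ> (\<lambda>z. of_real m - z) holomorphic_on {z. \<bar>Im z\<bar> < r}"
      by (rule holomorphic_on_compose_gen[OF _ logistic_holomorphic[OF r]]; auto intro!: holomorphic_intros)+
    then show "approx_unit m holomorphic_on {z. \<bar>Im z\<bar> < r}"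
      unfolding approx_unit_def[abs_def] o_def by (intro holomorphic_intros)
    fix z assume z: "\<bar>Im z\<bar> < r"
    have "cmod (logistic (z + of_real m)) * cmod (logistic (of_real m - z)) \<le> Q * Q * exp m * exp (- \<bar>Re z\<bar>)"
    proof (cases "0 \<le> Re z")
      case True
      have "cmod (logistic (z + of_real m)) * cmod (logistic (of_real m - z)) \<le> Q * (Q * exp (m - Re z))"
        using Q by (intro mult_mono p q z) auto
      then show ?thesis using True by (simp add: exp_diff exp_minus field_simps)
    next
      case False
      have "cmod (logistic (z + of_real m)) * cmod (logistic (of_real m - z)) \<le> (Q * exp (Re z + m)) * Q"
        using Q by (intro mult_mono p q z) auto
      then show ?thesis using False by (simp add: exp_add mult_ac)
    qed
    then have "(cmod (logistic (z + of_real m)) * cmod (logistic (of_real m - z)))\<^sup>2 \<le> (Q * Q * exp m * exp (- \<bar>Re z\<bar>))\<^sup>2"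
      by (intro power_mono) auto
    also have "\<dots> = Q ^ 4 * exp (2 * m) * exp (- 2 * \<bar>Re z\<bar>)"
    proof -
      have "exp (2 * m) = exp m * exp m" "exp (- 2 * \<bar>Re z\<bar>) = exp (- \<bar>Re z\<bar>) * exp (- \<bar>Re z\<bar>)"
        by (simp_all flip: exp_add)
      then show ?thesis by (simp only: power2_eq_square power4_eq_xxxx mult_ac)
    qed
    finally show "cmod (approx_unit m z) \<le> Q ^ 4 * exp (2 * m) * exp (- 2 * \<bar>Re z\<bar>)"
      by (simp add: approx_unit_def norm_power norm_mult)
  qed simp
  fix z assume z: "\<bar>Im z\<bar> < r"
  let ?p = "logistic (z + of_real m)" and ?q = "logistic (of_real m - z)"
  let ?E = "Q * exp (- m / 2) * exp (\<bar>Re z\<bar> / 2)"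
  \<comment> \<open>\<open>1 - (p q)\<^sup>2 = (1 + p q) (1 - p q)\<close>, and
    \<open>1 - p q\<close> is telescoped into the two small differences.\<close>
  have "1 - approx_unit m z = (1 + ?p * ?q) * ((1 - ?p) + ?p * (1 - ?q))"
    by (simp add: approx_unit_def algebra_simps power2_eq_square)
  also have "cmod \<dots> \<le> (1 + Q * Q) * (?E + Q * ?E)"
    unfolding norm_mult
  proof (intro mult_mono)
    have "cmod ?p * cmod ?q \<le> Q * Q" using Q by (intro mult_mono p q z) auto
    then show "cmod (1 + ?p * ?q) \<le> 1 + Q * Q"
      using norm_triangle_ineq[of 1 "?p * ?q"] by (simp add: norm_mult)
    have "cmod ?p * cmod (1 - ?q) \<le> Q * ?E" using Q by (intro mult_mono p q1 z) auto
    then show "cmod ((1 - ?p) + ?p * (1 - ?q)) \<le> ?E + Q * ?E"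
      using norm_triangle_ineq[of "1 - ?p" "?p * (1 - ?q)"] p1[OF z] unfolding norm_mult by linarith
  qed (use Q in auto)
  also have "\<dots> = (1 + Q * Q) * ((1 + Q) * Q) * exp (- m / 2) * exp (\<bar>Re z\<bar> / 2)"
    by (simp add: algebra_simps)
  finally show "cmod (1 - approx_unit m z) \<le> (1 + Q * Q) * ((1 + Q) * Q) * exp (- m / 2) * exp (\<bar>Re z\<bar> / 2)" .
qed

context sectorial_families
begin

lemma F_clinear: "\<bar>Im a\<bar> < r \<Longrightarrow> bounded_clinear (F a)"
  using F by (intro resolvent_familyD(2)[OF F(1)]) auto

lemma calc_G_commute: "line_decay \<nu> B d h \<Longrightarrow> a \<in> UG \<Longrightarrow> G a (calc h x) = calc h (G a x)"
  using G(2) by (intro calc_commute resolvent_familyD(2)[OF G(1)] resolvent_family_commute[OF G(1)]) auto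

lemma calc_F_commute: "line_decay \<nu> B d h \<Longrightarrow> \<bar>Im a\<bar> < r \<Longrightarrow> F a (calc h x) = calc h (F a x)"
  using G(2) F(2) by (intro calc_commute F_clinear GF[symmetric]) auto

text \<open>Translation by \<open>- t\<close> centres the first factor at \<open>0\<close> and the
  second at \<open>t - s\<close>, and \<open>exp_abs_shift_le\<close> extracts the decay in
  \<open>t - s\<close>. The estimate sees \<open>X\<close> only through its bound, which is why
  uniform boundedness of \<open>z (z + B)\<^sup>-\<^sup>1\<close> is enough. The constant
  \<open>4 / e\<close> is \<open>2 / (e / 2)\<close>.\<close>

lemma norm_boundary_integral_\<Phi>_le:
  assumes X: "continuous_on {z. \<bar>Im z\<bar> = \<mu>} X" and B: "\<And>z. \<bar>Im z\<bar> = \<mu> \<Longrightarrow> norm (X z) \<le> B"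
  shows "norm (boundary_integral \<mu> (\<lambda>z. (\<Phi>t t z * \<Psi>t s z) *\<^sub>C X z)) \<le> (4 / e * C * C * B) * exp (- (e/2) * \<bar>t - s\<bar>)"
proof -
  have "boundary_integral \<mu> (\<lambda>z. (\<Phi>t t z * \<Psi>t s z) *\<^sub>C X z) =
      boundary_integral \<mu> (\<lambda>z. (\<Phi>t t (z + of_real (- t)) * \<Psi>t s (z + of_real (- t))) *\<^sub>C X (z + of_real (- t)))"
    by (rule boundary_integral_translation[symmetric])
  also have "norm \<dots> \<le> (C * C * B * exp (- (e/2) * \<bar>t - s\<bar>)) * (2 / (e/2))"
  proof (rule norm_boundary_integral_le[OF nn(2) line_decayI])
    have \<mu>r: "\<mu> < r" using angles by simp
    have "continuous_on {z. \<bar>Im z\<bar> = \<mu>} (\<lambda>z. \<Phi>t t (z + of_real (- t)))"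
      "continuous_on {z. \<bar>Im z\<bar> = \<mu>} (\<lambda>z. \<Psi>t s (z + of_real (- t)))"
      using \<mu>r by (auto intro!: continuous_on_compose2[OF strip_decay_continuous[OF \<Phi>t order_refl]]
          continuous_on_compose2[OF strip_decay_continuous[OF \<Psi>t order_refl]] continuous_intros)
    moreover have "continuous_on {z. \<bar>Im z\<bar> = \<mu>} (\<lambda>z. X (z + of_real (- t)))"
      by (rule continuous_on_compose2[OF X]) (auto intro!: continuous_intros)
    ultimately show "continuous_on {z. \<bar>Im z\<bar> = \<mu>}
        (\<lambda>z. (\<Phi>t t (z + of_real (- t)) * \<Psi>t s (z + of_real (- t))) *\<^sub>C X (z + of_real (- t)))"
      by (intro continuous_on_scaleC continuous_on_mult)
    fix z assume z: "\<bar>Im z\<bar> = \<mu>"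
    have zr: "\<bar>Im (z + of_real (- t))\<bar> < r" using z \<mu>r by simp
    have B0: "0 \<le> B" using B[OF z] norm_ge_zero order_trans by blast
    have "cmod (\<Phi>t t (z + of_real (- t))) * cmod (\<Psi>t s (z + of_real (- t))) * norm (X (z + of_real (- t))) \<le>
        (C * exp (- e * \<bar>Re z\<bar>)) * (C * exp (- e * \<bar>Re z + (s - t)\<bar>)) * B"
      using \<Phi>t_le[OF zr, of t] \<Psi>t_le[OF zr, of s] B[of "z + of_real (- t)"] z C_nonneg
      by (intro mult_mono) (auto simp: algebra_simps)
    also have "\<dots> = C * C * B * (exp (- e * \<bar>Re z\<bar>) * exp (- e * \<bar>Re z + (s - t)\<bar>))"
      by (simp add: mult_ac)
    also have "\<dots> \<le> C * C * B * (exp (- (e/2) * \<bar>s - t\<bar>) * exp (- (e/2) * \<bar>Re z\<bar>))"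
      using C_nonneg B0 e_pos by (intro mult_left_mono exp_abs_shift_le) auto
    finally show "norm ((\<Phi>t t (z + of_real (- t)) * \<Psi>t s (z + of_real (- t))) *\<^sub>C X (z + of_real (- t))) \<le>
        C * C * B * exp (- (e/2) * \<bar>t - s\<bar>) * exp (- (e/2) * \<bar>Re z\<bar>)"
      by (simp only: norm_scaleC norm_mult mult.assoc abs_minus_commute[of s t])
  qed (use e_pos in simp)
  finally show ?thesis by (simp add: mult_ac)
qed

text \<open>For \<open>p = A x\<close> and \<open>q = B x\<close> the hypothesis holds because \<open>G a (A x) = z (G a x - x)\<close> and
  \<open>F a (B x) = z (x - F a x)\<close>. It is inherited by \<open>calc (\<Phi>t s) p\<close> and \<open>calc (\<Phi>t s) q\<close>; inserted into the
  reproducing formula, its last term vanishes since \<open>F\<close> is holomorphic in the strip.\<close>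

lemma calc_convolution_bound:
  assumes rel: "\<And>a. \<bar>Im a\<bar> = \<mu> \<Longrightarrow> G a p = G a (F a (p + q)) - F a q"
  shows "norm (calc (\<Phi>t t) p) \<le> (1 / cmod \<kappa> * (4 / e * C * C * (K * L))) *
      integral UNIV (\<lambda>s. exp (- (e/2) * \<bar>t - s\<bar>) * norm (calc (\<Phi>t s) (p + q)))"
proof -
  define B where "B = 4 / e * C * C * (K * L)"
  have \<mu>r: "\<mu> < r" and \<nu>r: "\<nu> < r" using angles by auto
  have B0: "0 \<le> B" using e_pos C_nonneg resolvent_familyD(1)[OF G(1)] resolvent_familyD(1)[OF F(1)]
    by (simp add: B_def)
  have le: "norm (calc (\<lambda>z. \<Phi>t t z * \<Psi>t s z * \<Phi>t s z) p) \<le> B * (exp (- (e/2) * \<bar>t - s\<bar>) * norm (calc (\<Phi>t s) (p + q)))" for s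
  proof -
    define y' where "y' = calc (\<Phi>t s) (p + q)"
    define q' where "q' = calc (\<Phi>t s) q"
    define h where "h z = \<Phi>t t z * \<Psi>t s z" for z
    have h: "strip_decay r (C * exp (e * \<bar>t\<bar>) * (C * exp (e * \<bar>s\<bar>))) e h"
      unfolding h_def by (rule strip_decay_mult[OF \<Phi>t \<Psi>t])
    have rel': "G a (calc (\<Phi>t s) p) = G a (F a y') - F a q'" if a: "\<bar>Im a\<bar> = \<mu>" for a
    proof -
      have aU: "a \<in> UG" "\<bar>Im a\<bar> < r" using a G(3) \<mu>r by auto
      have "G a (calc (\<Phi>t s) p) = calc (\<Phi>t s) (G a (F a (p + q)) - F a q)"
        by (simp add: calc_G_commute[OF \<Phi>t_line aU(1)] rel[OF a])
      also have "\<dots> = calc (\<Phi>t s) (G a (F a (p + q))) - calc (\<Phi>t s) (F a q)"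
        using bounded_clinear_simps(2)[OF calc_bounded[OF \<Phi>t_line]] .
      finally show ?thesis
        by (simp add: y'_def q'_def calc_G_commute[OF \<Phi>t_line aU(1)] calc_F_commute[OF \<Phi>t_line aU(2)])
    qed
    have cF: "continuous_on {z. \<bar>Im z\<bar> = \<mu>} (\<lambda>z. F z x)" for x
      using F(2) \<mu>r by (intro resolvent_family_continuous[OF F(1)] continuous_intros) auto
    have bF: "norm (F z x) \<le> L * norm x" if "\<bar>Im z\<bar> = \<mu>" for z x
      using F(2) \<mu>r that by (intro resolvent_familyD(3)[OF F(1)]) auto
    have cGF: "continuous_on {z. \<bar>Im z\<bar> = \<mu>} (\<lambda>z. G z (F z x))" for x
      using G(3) by (intro resolvent_family_continuous[OF G(1)] cF continuous_intros) auto
    have bGF: "norm (G z (F z x)) \<le> K * L * norm x" if z: "\<bar>Im z\<bar> = \<mu>" for z x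
    proof -
      have "norm (G z (F z x)) \<le> K * norm (F z x)" using z G(3) by (intro resolvent_familyD(3)[OF G(1)]) auto
      also have "\<dots> \<le> K * (L * norm x)" using bF[OF z] resolvent_familyD(1)[OF G(1)] by (intro mult_left_mono)
      finally show ?thesis by simp
    qed
    have h\<mu>: "line_decay \<mu> (C * exp (e * \<bar>t\<bar>) * (C * exp (e * \<bar>s\<bar>))) e h"
      by (rule strip_decay_line[OF h \<mu>r])
    have "calc (\<lambda>z. \<Phi>t t z * \<Psi>t s z * \<Phi>t s z) p = boundary_integral \<mu> (\<lambda>b. h b *\<^sub>C G b (calc (\<Phi>t s) p))"
      unfolding calc_def h_def[symmetric]
      by (rule boundary_integral_multiplicative[OF h \<Phi>t angles(1-3) _ G(1-3), symmetric]) (use angles in simp)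
    also have "\<dots> = boundary_integral \<mu> (\<lambda>b. h b *\<^sub>C G b (F b y') - h b *\<^sub>C F b q')"
      by (rule boundary_integral_cong[OF nn(2)]) (simp add: rel' scaleC.diff_right)
    also have "\<dots> = boundary_integral \<mu> (\<lambda>b. h b *\<^sub>C G b (F b y')) - boundary_integral \<mu> (\<lambda>b. h b *\<^sub>C F b q')"
    proof (rule boundary_integral_diff[OF nn(2)])
      show "line_decay \<mu> (C * exp (e * \<bar>t\<bar>) * (C * exp (e * \<bar>s\<bar>)) * (K * (L * norm y'))) e (\<lambda>b. h b *\<^sub>C G b (F b y'))"
        by (rule line_decay_resolvent[OF h\<mu> nn(2) G(1,3) cF bF])
      show "line_decay \<mu> (C * exp (e * \<bar>t\<bar>) * (C * exp (e * \<bar>s\<bar>)) * (L * norm q')) e (\<lambda>b. h b *\<^sub>C F b q')"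
        by (rule line_decay_resolvent[OF h\<mu> nn(2) F(1)]) (use F(2) \<mu>r in auto)
    qed
    also have "boundary_integral \<mu> (\<lambda>b. h b *\<^sub>C F b q') = 0"
      by (rule boundary_integral_resolvent_eq_0[OF h nn(2) \<mu>r F])
    finally have "calc (\<lambda>z. \<Phi>t t z * \<Psi>t s z * \<Phi>t s z) p = boundary_integral \<mu> (\<lambda>b. h b *\<^sub>C G b (F b y'))" by simp
    then show ?thesis
      using norm_boundary_integral_\<Phi>_le[OF cGF[of y'] bGF[of _ y'], of t s] unfolding h_def y'_def B_def
      by (simp add: mult_ac)
  qed
  \<comment> \<open>By \<open>norm_calc_\<Phi>t_le\<close> the norms are bounded in
    \<open>s\<close>, so the kernel alone provides the decay.\<close>
  have int: "(\<lambda>s. B * (exp (- (e/2) * \<bar>t - s\<bar>) * norm (calc (\<Phi>t s) (p + q)))) integrable_on UNIV"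
  proof -
    have "exp_decay (B * exp (e / 2 * \<bar>t\<bar>) * (C * (K * norm (p + q)) * (2 / e))) (e / 2)
        (\<lambda>s. B * (exp (- (e/2) * \<bar>t - s\<bar>) * norm (calc (\<Phi>t s) (p + q))))"
      unfolding exp_decay_def
    proof (intro conjI allI)
      show "continuous_on UNIV (\<lambda>s. B * (exp (- (e/2) * \<bar>t - s\<bar>) * norm (calc (\<Phi>t s) (p + q))))"
        by (intro continuous_intros continuous_calc_\<Phi>t)
      fix s
      have "e / 2 * (\<bar>s\<bar> - \<bar>t\<bar>) \<le> e / 2 * \<bar>t - s\<bar>" using e_pos by (intro mult_left_mono) auto
      then have "exp (- (e/2) * \<bar>t - s\<bar>) \<le> exp (e / 2 * \<bar>t\<bar>) * exp (- (e/2) * \<bar>s\<bar>)"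
        by (simp add: algebra_simps flip: exp_add)
      then have "B * (exp (- (e/2) * \<bar>t - s\<bar>) * norm (calc (\<Phi>t s) (p + q))) \<le>
          B * ((exp (e / 2 * \<bar>t\<bar>) * exp (- (e/2) * \<bar>s\<bar>)) * (C * (K * norm (p + q)) * (2 / e)))"
        using B0 by (intro mult_left_mono mult_mono norm_calc_\<Phi>t_le) auto
      then show "norm (B * (exp (- (e/2) * \<bar>t - s\<bar>) * norm (calc (\<Phi>t s) (p + q)))) \<le>
          B * exp (e / 2 * \<bar>t\<bar>) * (C * (K * norm (p + q)) * (2 / e)) * exp (- (e/2) * \<bar>s\<bar>)"
        using B0 by (simp add: mult_ac)
    qed (use e_pos in simp)
    then show ?thesis by (rule exp_decay_integrable(1))
  qed
  have "cmod \<kappa> * norm (calc (\<Phi>t t) p) = norm (integral UNIV (\<lambda>s. calc (\<lambda>z. \<Phi>t t z * \<Psi>t s z * \<Phi>t s z) p))"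
    by (simp add: reproducing norm_scaleC)
  also have "\<dots> \<le> integral UNIV (\<lambda>s. B * (exp (- (e/2) * \<bar>t - s\<bar>) * norm (calc (\<Phi>t s) (p + q))))"
    by (rule integral_norm_bound_integral[OF reproducing(2) int le])
  also have "\<dots> = B * integral UNIV (\<lambda>s. exp (- (e/2) * \<bar>t - s\<bar>) * norm (calc (\<Phi>t s) (p + q)))"
    by simp
  finally have "norm (calc (\<Phi>t t) p) \<le> B * integral UNIV (\<lambda>s. exp (- (e/2) * \<bar>t - s\<bar>) * norm (calc (\<Phi>t s) (p + q))) / cmod \<kappa>"
    using \<kappa>_nonzero by (simp only: pos_le_divide_eq zero_less_norm_iff mult.commute not_False_eq_True)
  then show ?thesis unfolding B_def[symmetric] by simp
qed

text \<open>Subtracting \<open>logistic a\<close>, that is \<open>z / (1 + z)\<close>, changes no integral against a holomorphic function and makes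
  the integrand decay at both ends of the lines.\<close>

lemma resolvent_minus_logistic:
  assumes a: "\<bar>Im a\<bar> = \<nu>" and v: "v = G (Complex 0 pi) w"
  shows "G a (v - G (Complex 0 pi) v) - logistic a *\<^sub>C (v - G (Complex 0 pi) v) =
      (logistic a * logistic (- a)) *\<^sub>C (G a w - v)"
proof -
  let ?S = "G (Complex 0 pi)"
  have U: "a \<in> UG" "Complex 0 pi \<in> UG" using a G by auto
  have ex: "exp (Complex 0 pi - a) = - exp (- a)" "exp (a - Complex 0 pi) = - exp a"
    using exp_plus_pi(1)[of "- a"] exp_plus_pi(2)[of a] by (simp_all add: add.commute)
  have ne: "1 + exp (- a) \<noteq> 0" using cmod_logistic_le(1)[of r a] angles a by auto
  have s: "logistic a * (1 + exp (- a)) = 1" using ne by (simp add: logistic_def)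
  have ne': "1 + exp a \<noteq> 0"
  proof -
    have "exp a * (1 + exp (- a)) \<noteq> 0" using ne by simp
    then show ?thesis by (simp add: distrib_left exp_minus add.commute)
  qed
  have s': "logistic (- a) * (1 + exp a) = 1" using ne' by (simp add: logistic_def)
  \<comment> \<open>The resolvent equation between \<open>a\<close> and the point of
    \<open>- 1\<close>; its factor \<open>1 + exp (- a)\<close> is the inverse of
    \<open>logistic a\<close>.\<close>
  have "G a v - ?S v = (1 + exp (- a)) *\<^sub>C G a (v - ?S v)"
    using resolvent_familyD(4)[OF G(1) U(2,1), of v] by (simp add: ex)
  then have "logistic a *\<^sub>C (G a v - ?S v) = (logistic a * (1 + exp (- a))) *\<^sub>C G a (v - ?S v)"
    by (simp add: scaleC_scaleC)
  then have 1: "G a (v - ?S v) = logistic a *\<^sub>C (G a v - ?S v)" by (simp add: s)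
  have "?S w - G a w = (1 + exp a) *\<^sub>C ?S (w - G a w)"
    using resolvent_familyD(4)[OF G(1) U(1,2), of w] by (simp add: ex)
  then have "logistic (- a) *\<^sub>C (?S w - G a w) = (logistic (- a) * (1 + exp a)) *\<^sub>C ?S (w - G a w)"
    by (simp add: scaleC_scaleC)
  then have 2: "?S (w - G a w) = logistic (- a) *\<^sub>C (?S w - G a w)" by (simp add: s')
  have "?S (w - G a w) = v - G a v"
    using bounded_clinear_simps(2)[OF resolvent_familyD(2)[OF G(1) U(2)], of w "G a w"]
      resolvent_family_commute[OF G(1) U(2,1), of w] by (simp add: v)
  with 2 have 3: "G a v - v = logistic (- a) *\<^sub>C (G a w - v)"
    by (simp add: v scaleC.diff_right algebra_simps)
  have "G a (v - ?S v) - logistic a *\<^sub>C (v - ?S v) = logistic a *\<^sub>C (G a v - v)"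
    unfolding 1 by (simp add: scaleC.diff_right)
  also have "\<dots> = (logistic a * logistic (- a)) *\<^sub>C (G a w - v)"
    unfolding 3 by (simp add: scaleC_scaleC)
  finally show ?thesis .
qed

end

context sectorial_families
begin

text \<open>Applying \<open>calc (\<Phi>t t)\<close> turns the difference into the integral of
  \<open>\<Phi>t t * (1 - g)\<close> against \<open>G a y\<close>. The form of \<open>y\<close>
  allows \<open>resolvent_minus_logistic\<close>: the part along the fixed vector \<open>y\<close>
  integrates to \<open>0\<close>, and the rest carries \<open>logistic a * logistic (- a)\<close>,
  which absorbs the growth \<open>exp (\<bar>Re a\<bar> / 2)\<close> of the bound on
  \<open>1 - g\<close>. Decay of rate \<open>1 / 2\<close> is left over, hence the minimum in
  \<open>d\<close>.\<close>

lemma calc_approx_unit_estimate: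
  assumes v: "v = G (Complex 0 pi) w" and y: "y = v - G (Complex 0 pi) v"
  defines "d \<equiv> min e (1/2)"
  obtains M where "\<And>m t. 0 \<le> m \<Longrightarrow> norm (calc (\<Phi>t t) (y - boundary_integral \<mu> (\<lambda>a. approx_unit m a *\<^sub>C G a y))) \<le>
      M * exp (- m / 2) * exp (- (d/2) * \<bar>t\<bar>)"
proof -
  define Q where "Q = 1 / sin ((pi - r) / 2)"
  define B1 where "B1 = (1 + Q * Q) * ((1 + Q) * Q)"
  define B2 where "B2 = K * norm w + norm v"
  have r: "0 < r" "r < pi" "\<nu> < r" "\<mu> < r" using angles by auto
  have Q: "Q > 0" using sin_half_pos[of "pi - r"] r by (simp add: Q_def)
  have d: "0 < d" "d \<le> e" "d \<le> 1/2" using e_pos by (auto simp: d_def)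
  have B: "0 \<le> B1" "0 \<le> B2" using Q resolvent_familyD(1)[OF G(1)] by (auto simp: B1_def B2_def)
  have "norm (calc (\<Phi>t t) (y - boundary_integral \<mu> (\<lambda>a. approx_unit m a *\<^sub>C G a y))) \<le>
      (C * B1 * (Q * Q) * B2 * (2 / (d/2))) * exp (- m / 2) * exp (- (d/2) * \<bar>t\<bar>)" if m: "0 \<le> m" for m t
  proof -
    define g where "g = approx_unit m"
    have g: "strip_decay r (Q ^ 4 * exp (2 * m)) 2 g"
      and g1: "\<And>z. \<bar>Im z\<bar> < r \<Longrightarrow> cmod (1 - g z) \<le> B1 * exp (- m / 2) * exp (\<bar>Re z\<bar> / 2)"
      using approx_unit_bounds[OF r(1,2) m, folded Q_def B1_def] by (auto simp: g_def)
    have gd: "strip_decay r (Q ^ 4 * exp (2 * m)) d g" by (rule strip_decay_mono[OF g]) (use d r in auto)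
    have \<Phi>d: "strip_decay r (C * exp (e * \<bar>t\<bar>)) d (\<Phi>t t)" by (rule strip_decay_mono[OF \<Phi>t]) (use d r in auto)
    have g\<mu>: "line_decay \<mu> (Q ^ 4 * exp (2 * m)) d g" by (rule strip_decay_line[OF gd r(4)])
    have "calc (\<Phi>t t) (boundary_integral \<mu> (\<lambda>a. g a *\<^sub>C G a y)) = boundary_integral \<mu> (\<lambda>a. calc (\<Phi>t t) (g a *\<^sub>C G a y))"
      by (rule boundary_integral_bounded_clinear[OF nn(2) line_decay_resolvent[OF g\<mu> nn(2) G(1,3)] calc_bounded[OF \<Phi>t_line], symmetric, where B = "norm y"]) auto
    also have "\<dots> = boundary_integral \<mu> (\<lambda>a. g a *\<^sub>C G a (boundary_integral \<nu> (\<lambda>z. \<Phi>t t z *\<^sub>C G z y)))"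
    proof (rule boundary_integral_cong[OF nn(2)])
      fix a assume "\<bar>Im a\<bar> = \<mu>"
      then have "a \<in> UG" using G(3) by blast
      then show "calc (\<Phi>t t) (g a *\<^sub>C G a y) = g a *\<^sub>C G a (boundary_integral \<nu> (\<lambda>z. \<Phi>t t z *\<^sub>C G z y))"
        using calc_G_commute[OF \<Phi>t_line, of a t y]
        by (simp add: bounded_clinear_simps(5)[OF calc_bounded[OF \<Phi>t_line]] flip: calc_def)
    qed
    also have "\<dots> = boundary_integral \<nu> (\<lambda>a. (g a * \<Phi>t t a) *\<^sub>C G a y)"
      by (rule boundary_integral_multiplicative[OF gd \<Phi>d angles(1-3) _ G(1-3)]) (use r in simp)
    finally have *: "calc (\<Phi>t t) (boundary_integral \<mu> (\<lambda>a. g a *\<^sub>C G a y)) = boundary_integral \<nu> (\<lambda>a. (g a * \<Phi>t t a) *\<^sub>C G a y)" .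
    have g\<Phi>: "strip_decay r (Q ^ 4 * exp (2 * m) * (C * exp (e * \<bar>t\<bar>))) d (\<lambda>a. g a * \<Phi>t t a)"
      by (rule strip_decay_mult[OF gd \<Phi>d])
    have "calc (\<Phi>t t) (y - boundary_integral \<mu> (\<lambda>a. g a *\<^sub>C G a y)) =
        calc (\<Phi>t t) y - boundary_integral \<nu> (\<lambda>a. (g a * \<Phi>t t a) *\<^sub>C G a y)"
      using bounded_clinear_simps(2)[OF calc_bounded[OF \<Phi>t_line]] * by simp
    also have "\<dots> = boundary_integral \<nu> (\<lambda>a. \<Phi>t t a *\<^sub>C G a y - (g a * \<Phi>t t a) *\<^sub>C G a y)"
      unfolding calc_def
      by (rule boundary_integral_diff[OF nn(1) line_decay_G[OF \<Phi>t_line] line_decay_G[OF strip_decay_line[OF g\<Phi> r(3)]], symmetric])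
    also have "\<dots> = boundary_integral \<nu> (\<lambda>a. (\<Phi>t t a * (1 - g a) * logistic a) *\<^sub>C y + (\<Phi>t t a * (1 - g a) * (logistic a * logistic (- a))) *\<^sub>C (G a w - v))"
    proof (rule boundary_integral_cong[OF nn(1)])
      fix a assume a: "\<bar>Im a\<bar> = \<nu>"
      have "G a y = logistic a *\<^sub>C y + (logistic a * logistic (- a)) *\<^sub>C (G a w - v)"
        using resolvent_minus_logistic[OF a v] unfolding y by (simp add: algebra_simps)
      then show "\<Phi>t t a *\<^sub>C G a y - (g a * \<Phi>t t a) *\<^sub>C G a y =
          (\<Phi>t t a * (1 - g a) * logistic a) *\<^sub>C y + (\<Phi>t t a * (1 - g a) * (logistic a * logistic (- a))) *\<^sub>C (G a w - v)"
      proof -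
        have "\<Phi>t t a *\<^sub>C G a y - (g a * \<Phi>t t a) *\<^sub>C G a y = (\<Phi>t t a * (1 - g a)) *\<^sub>C G a y"
          by (simp add: algebra_simps flip: scaleC.diff_left)
        then show ?thesis
          unfolding \<open>G a y = _\<close> by (simp only: scaleC_add_right scaleC_scaleC)
      qed
    qed
    finally have split: "calc (\<Phi>t t) (y - boundary_integral \<mu> (\<lambda>a. g a *\<^sub>C G a y)) =
        boundary_integral \<nu> (\<lambda>a. (\<Phi>t t a * (1 - g a) * logistic a) *\<^sub>C y + (\<Phi>t t a * (1 - g a) * (logistic a * logistic (- a))) *\<^sub>C (G a w - v))" .
    have "boundary_integral \<nu> (\<lambda>a. (\<Phi>t t a * (1 - g a) * logistic a) *\<^sub>C y + (\<Phi>t t a * (1 - g a) * (logistic a * logistic (- a))) *\<^sub>C (G a w - v)) =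
        boundary_integral \<nu> (\<lambda>a. (\<Phi>t t a * (1 - g a) * logistic a) *\<^sub>C y) +
        boundary_integral \<nu> (\<lambda>a. (\<Phi>t t a * (1 - g a) * (logistic a * logistic (- a))) *\<^sub>C (G a w - v))"
      and ld: "line_decay \<nu> (C * B1 * (Q * Q) * B2 * exp (- m / 2) * exp (- (d/2) * \<bar>t\<bar>)) (d/2)
         (\<lambda>a. (\<Phi>t t a * (1 - g a) * (logistic a * logistic (- a))) *\<^sub>C (G a w - v))"
      and z0: "boundary_integral \<nu> (\<lambda>a. (\<Phi>t t a * (1 - g a) * logistic a) *\<^sub>C y) = 0"
    proof -
      \<comment> \<open>This bound grows with \<open>m\<close>, which is harmless because the
        integral that it serves is exactly \<open>0\<close>.\<close>
      have gb: "cmod (1 - g z) \<le> 1 + Q ^ 4 * exp (2 * m)" if "\<bar>Im z\<bar> < r" for z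
        using strip_decay_bounded[OF g that] norm_triangle_ineq4[of 1 "g z"] by simp
      have "strip_decay r (C * exp (e * \<bar>t\<bar>) * ((1 + Q ^ 4 * exp (2 * m)) * Q)) e (\<lambda>z. \<Phi>t t z * ((1 - g z) * logistic z))"
      proof (rule strip_decay_mult_bounded[OF \<Phi>t])
        show "(\<lambda>z. (1 - g z) * logistic z) holomorphic_on {z. \<bar>Im z\<bar> < r}"
          by (intro holomorphic_intros strip_decayD(1)[OF g] logistic_holomorphic r)
        show "cmod ((1 - g z) * logistic z) \<le> (1 + Q ^ 4 * exp (2 * m)) * Q" if "\<bar>Im z\<bar> < r" for z
          unfolding norm_mult using gb[OF that] cmod_logistic_le(2)[OF r(1,2) that, folded Q_def] Q
          by (intro mult_mono) auto
      qed
      then have sd: "strip_decay r (C * exp (e * \<bar>t\<bar>) * ((1 + Q ^ 4 * exp (2 * m)) * Q)) e (\<lambda>z. \<Phi>t t z * (1 - g z) * logistic z)"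
        by (simp only: mult.assoc)
      show "boundary_integral \<nu> (\<lambda>a. (\<Phi>t t a * (1 - g a) * logistic a) *\<^sub>C y) = 0"
        by (rule boundary_integral_strip_scaleC_eq_0[OF sd nn(1) r(3)])
      show ld: "line_decay \<nu> (C * B1 * (Q * Q) * B2 * exp (- m / 2) * exp (- (d/2) * \<bar>t\<bar>)) (d/2)
         (\<lambda>a. (\<Phi>t t a * (1 - g a) * (logistic a * logistic (- a))) *\<^sub>C (G a w - v))"
      proof (rule line_decayI)
        have c1: "continuous_on {z. \<bar>Im z\<bar> = \<nu>} (\<Phi>t t)" "continuous_on {z. \<bar>Im z\<bar> = \<nu>} g"
          "continuous_on {z. \<bar>Im z\<bar> = \<nu>} logistic"
          using r strip_decay_continuous[OF \<Phi>t] strip_decay_continuous[OF g]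
            holomorphic_on_imp_continuous_on[OF logistic_holomorphic[OF r(1,2)]]
          by (auto intro: continuous_on_subset)
        have c2: "continuous_on {z. \<bar>Im z\<bar> = \<nu>} (\<lambda>z. logistic (- z))"
          by (rule continuous_on_compose2[OF c1(3)]) (auto intro!: continuous_intros)
        have c3: "continuous_on {z. \<bar>Im z\<bar> = \<nu>} (\<lambda>a. G a w - v)"
          using G(2) by (intro continuous_intros resolvent_family_continuous[OF G(1)]) auto
        show "continuous_on {z. \<bar>Im z\<bar> = \<nu>} (\<lambda>a. (\<Phi>t t a * (1 - g a) * (logistic a * logistic (- a))) *\<^sub>C (G a w - v))"
          by (intro continuous_on_scaleC continuous_on_mult continuous_on_diff continuous_on_const c1 c2 c3)
        fix z assume z: "\<bar>Im z\<bar> = \<nu>"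
        have zr: "\<bar>Im z\<bar> < r" "\<bar>Im (- z)\<bar> < r" using z r by auto
        have "norm (G z w) \<le> K * norm w" using z G(2) by (intro resolvent_familyD(3)[OF G(1)]) auto
        then have b4: "norm (G z w - v) \<le> B2" using norm_triangle_ineq4[of "G z w" v] by (simp add: B2_def)
        have b3: "cmod (logistic z) * cmod (logistic (- z)) \<le> Q * Q * exp (- \<bar>Re z\<bar>)"
        proof (cases "0 \<le> Re z")
          case True
          have "cmod (logistic z) * cmod (logistic (- z)) \<le> Q * (Q * exp (Re (- z)))"
            using Q cmod_logistic_le[OF r(1,2) zr(1)] cmod_logistic_le[OF r(1,2) zr(2)] by (intro mult_mono) (auto simp: Q_def)
          then show ?thesis using True by simp
        next
          case False
          have "cmod (logistic z) * cmod (logistic (- z)) \<le> (Q * exp (Re z)) * Q"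
            using Q cmod_logistic_le[OF r(1,2) zr(1)] cmod_logistic_le[OF r(1,2) zr(2)] by (intro mult_mono) (auto simp: Q_def)
          then show ?thesis using False by (simp add: mult_ac)
        qed
        have "norm ((\<Phi>t t z * (1 - g z) * (logistic z * logistic (- z))) *\<^sub>C (G z w - v)) =
            cmod (\<Phi>t t z) * cmod (1 - g z) * (cmod (logistic z) * cmod (logistic (- z))) * norm (G z w - v)"
          by (simp add: norm_scaleC norm_mult)
        also have "\<dots> \<le> (C * exp (- e * \<bar>Re z + t\<bar>)) * (B1 * exp (- m / 2) * exp (\<bar>Re z\<bar> / 2)) *
            (Q * Q * exp (- \<bar>Re z\<bar>)) * B2"
          using C_nonneg Q B by (intro mult_mono \<Phi>t_le[OF zr(1)] g1[OF zr(1)] b3 b4) auto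
        also have "\<dots> = (C * B1 * (Q * Q) * B2 * exp (- m / 2)) * (exp (- e * \<bar>Re z + t\<bar>) * (exp (\<bar>Re z\<bar> / 2) * exp (- \<bar>Re z\<bar>)))"
          by (simp only: mult_ac)
        also have "\<dots> \<le> (C * B1 * (Q * Q) * B2 * exp (- m / 2)) * (exp (- (d/2) * \<bar>t\<bar>) * exp (- (d/2) * \<bar>Re z\<bar>))"
        proof (intro mult_left_mono)
          have "exp (\<bar>Re z\<bar> / 2) * exp (- \<bar>Re z\<bar>) = exp (- (1/2) * \<bar>Re z\<bar>)" by (simp flip: exp_add)
          also have "\<dots> \<le> exp (- d * \<bar>Re z\<bar>)" using mult_right_mono[OF d(3), of "\<bar>Re z\<bar>"] by simp
          finally have 1: "exp (\<bar>Re z\<bar> / 2) * exp (- \<bar>Re z\<bar>) \<le> exp (- d * \<bar>Re z\<bar>)" .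
          have 2: "exp (- e * \<bar>Re z + t\<bar>) \<le> exp (- d * \<bar>Re z + t\<bar>)"
            using mult_right_mono[OF d(2), of "\<bar>Re z + t\<bar>"] by simp
          have "exp (- e * \<bar>Re z + t\<bar>) * (exp (\<bar>Re z\<bar> / 2) * exp (- \<bar>Re z\<bar>)) \<le>
              exp (- d * \<bar>Re z + t\<bar>) * exp (- d * \<bar>Re z\<bar>)"
            by (rule mult_mono[OF 2 1]) auto
          also have "\<dots> \<le> exp (- (d/2) * \<bar>t\<bar>) * exp (- (d/2) * \<bar>Re z\<bar>)"
            using exp_abs_shift_le[of d "Re z" t] d by (simp add: mult.commute)
          finally show "exp (- e * \<bar>Re z + t\<bar>) * (exp (\<bar>Re z\<bar> / 2) * exp (- \<bar>Re z\<bar>)) \<le>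
              exp (- (d/2) * \<bar>t\<bar>) * exp (- (d/2) * \<bar>Re z\<bar>)" .
        qed (use C_nonneg Q B in auto)
        finally show "norm ((\<Phi>t t z * (1 - g z) * (logistic z * logistic (- z))) *\<^sub>C (G z w - v)) \<le>
            C * B1 * (Q * Q) * B2 * exp (- m / 2) * exp (- (d/2) * \<bar>t\<bar>) * exp (- (d/2) * \<bar>Re z\<bar>)"
          by (simp only: mult.assoc)
      qed (use d in simp)
      show "boundary_integral \<nu> (\<lambda>a. (\<Phi>t t a * (1 - g a) * logistic a) *\<^sub>C y + (\<Phi>t t a * (1 - g a) * (logistic a * logistic (- a))) *\<^sub>C (G a w - v)) =
          boundary_integral \<nu> (\<lambda>a. (\<Phi>t t a * (1 - g a) * logistic a) *\<^sub>C y) +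
          boundary_integral \<nu> (\<lambda>a. (\<Phi>t t a * (1 - g a) * (logistic a * logistic (- a))) *\<^sub>C (G a w - v))"
        by (rule boundary_integral_add[OF nn(1) line_decay_scaleC[OF strip_decay_line[OF sd r(3)]] ld])
    qed
    then have "calc (\<Phi>t t) (y - boundary_integral \<mu> (\<lambda>a. g a *\<^sub>C G a y)) =
        boundary_integral \<nu> (\<lambda>a. (\<Phi>t t a * (1 - g a) * (logistic a * logistic (- a))) *\<^sub>C (G a w - v))"
      using z0 split by simp
    then show ?thesis using norm_boundary_integral_le[OF nn(1) ld] by (simp add: g_def mult_ac)
  qed
  then show ?thesis by (rule that)
qed

text \<open>The witness is \<open>x = (1 / 2 \<pi> i) \<integral> h(z) R(z, A) (z + B)\<^sup>-\<^sup>1 y dz\<close>; then \<open>q - x\<close> is \<open>A x\<close> and \<open>q' - x\<close> is \<open>B x\<close>.\<close>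

lemma sum_range_representation:
  assumes h: "strip_decay r B 2 h"
  shows "\<exists>x q q'. x = G (Complex 0 pi) q \<and> x = F 0 q' \<and>
      (q - x) + (q' - x) = boundary_integral \<mu> (\<lambda>a. h a *\<^sub>C G a y)"
proof -
  let ?S = "G (Complex 0 pi)" and ?T = "F 0"
  have \<mu>r: "\<mu> < r" using angles by simp
  have U: "Complex 0 pi \<in> UG" "(0::complex) \<in> UF" using G(4) F(2) angles by auto
  have S: "bounded_clinear ?S" and T: "bounded_clinear ?T"
    using resolvent_familyD(2)[OF G(1)] resolvent_familyD(2)[OF F(1)] U by auto
  have aG: "a \<in> UG" and aF: "a \<in> UF" if "\<bar>Im a\<bar> = \<mu>" for a
    using that G(3) F(2) \<mu>r by auto
  have h1: "line_decay \<mu> B 1 h"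
    using strip_decay_line[OF strip_decay_mono[OF h] \<mu>r] angles by auto
  have B: "0 \<le> B" using strip_decayD(4)[OF h] angles by simp
  \<comment> \<open>\<open>R(z, A) (z + B)\<^sup>-\<^sup>1 dz\<close> is
    \<open>exp (- a) G a F a da\<close>. The factor \<open>exp (- a)\<close> costs one unit of
    decay, so the rate \<open>2\<close> of \<open>h\<close> becomes \<open>1\<close>.\<close>
  have he: "line_decay \<mu> B 1 (\<lambda>a. h a * exp (- a))"
  proof (rule line_decayI)
    show "continuous_on {z. \<bar>Im z\<bar> = \<mu>} (\<lambda>a. h a * exp (- a))"
      by (intro continuous_intros line_decayD(2)[OF h1])
    fix z assume "\<bar>Im z\<bar> = \<mu>"
    then have "cmod (h z) \<le> B * exp (- 2 * \<bar>Re z\<bar>)" using strip_decayD(3)[OF h, of z] \<mu>r by simp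
    then have "cmod (h z) * exp (- Re z) \<le> (B * exp (- 2 * \<bar>Re z\<bar>)) * exp (\<bar>Re z\<bar>)"
      using B by (intro mult_mono) auto
    also have "\<dots> = B * exp (- 1 * \<bar>Re z\<bar>)" by (simp add: mult.assoc flip: exp_add)
    finally show "cmod (h z * exp (- z)) \<le> B * exp (- 1 * \<bar>Re z\<bar>)"
      by (simp add: norm_mult)
  qed simp
  have bG: "norm (G a v) \<le> K * norm v" if "\<bar>Im a\<bar> = \<mu>" for a v
    by (rule resolvent_familyD(3)[OF G(1) aG[OF that]])
  have cG: "continuous_on {z. \<bar>Im z\<bar> = \<mu>} (\<lambda>a. G a y)"
    using G(3) by (intro continuous_intros resolvent_family_continuous[OF G(1)]) auto
  have F\<mu>: "{z. \<bar>Im z\<bar> = \<mu>} \<subseteq> UF" using F(2) \<mu>r by auto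
  note dF = line_decay_resolvent[OF _ nn(2) F(1) F\<mu>]
  \<comment> \<open>\<open>I1\<close> is the witness \<open>x\<close>; \<open>I2\<close> and
    \<open>I3 - I2\<close> will be \<open>A x\<close> and \<open>B x\<close>.\<close>
  define I1 where "I1 = boundary_integral \<mu> (\<lambda>a. (h a * exp (- a)) *\<^sub>C F a (G a y))"
  define I2 where "I2 = boundary_integral \<mu> (\<lambda>a. h a *\<^sub>C F a (G a y))"
  define I3 where "I3 = boundary_integral \<mu> (\<lambda>a. h a *\<^sub>C G a y)"
  have d1: "line_decay \<mu> (B * (L * (K * norm y))) 1 (\<lambda>a. (h a * exp (- a)) *\<^sub>C F a (G a y))"
    by (rule dF[OF he cG bG])
  have d2: "line_decay \<mu> (B * (L * (K * norm y))) 1 (\<lambda>a. h a *\<^sub>C F a (G a y))"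
    by (rule dF[OF h1 cG bG])
  have d3: "line_decay \<mu> (B * (K * norm y)) 1 (\<lambda>a. h a *\<^sub>C G a y)"
    by (rule line_decay_resolvent[OF h1 nn(2) G(1,3)]) auto
  have d4: "line_decay \<mu> (B * (L * norm y)) 1 (\<lambda>a. h a *\<^sub>C F a y)"
    by (rule dF[OF h1]) auto
  have sum: "line_decay \<mu> (Ca + Cb) 1 (\<lambda>a. Xa a + Xb a)" and diff: "line_decay \<mu> (Ca + Cb) 1 (\<lambda>a. Xa a - Xb a)"
    if "line_decay \<mu> Ca 1 Xa" "line_decay \<mu> Cb 1 Xb" for Ca Cb and Xa Xb :: "complex \<Rightarrow> 'a"
    using that unfolding line_decay_def
    by (auto intro!: continuous_intros order_trans[OF norm_triangle_ineq] order_trans[OF norm_triangle_ineq4]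
        intro: add_mono simp: distrib_right)
  \<comment> \<open>The last integral is \<open>0\<close>. It is kept so that \<open>?S q\<close>
    and \<open>I1\<close> can be compared under the integral sign.\<close>
  define q where "q = I1 + (I2 - boundary_integral \<mu> (\<lambda>a. h a *\<^sub>C F a y))"
  define q' where "q' = I3 + (I1 - I2)"
  have z: "boundary_integral \<mu> (\<lambda>a. h a *\<^sub>C F a y) = 0"
    by (rule boundary_integral_resolvent_eq_0[OF h nn(2) \<mu>r F])
  have "I1 = ?S q"
  proof -
    have "q = boundary_integral \<mu> (\<lambda>a. (h a * exp (- a)) *\<^sub>C F a (G a y) + (h a *\<^sub>C F a (G a y) - h a *\<^sub>C F a y))"
      unfolding q_def I1_def I2_def
      by (simp only: boundary_integral_add[OF nn(2) d1 diff[OF d2 d4]] boundary_integral_diff[OF nn(2) d2 d4])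
    then have "?S q = boundary_integral \<mu> (\<lambda>a. ?S ((h a * exp (- a)) *\<^sub>C F a (G a y) + (h a *\<^sub>C F a (G a y) - h a *\<^sub>C F a y)))"
      using boundary_integral_bounded_clinear[OF nn(2) sum[OF d1 diff[OF d2 d4]] S] by simp
    also have "\<dots> = I1"
      unfolding I1_def
    proof (rule boundary_integral_cong[OF nn(2)])
      fix a assume a: "\<bar>Im a\<bar> = \<mu>"
      define g where "g = G a y"
      have Fa: "bounded_clinear (F a)" using resolvent_familyD(2)[OF F(1) aF[OF a]] .
      have rel: "?S y - g = (1 + exp a) *\<^sub>C (?S y - ?S g)"
        using resolvent_familyD(4)[OF G(1) aG[OF a] U(1), of y]
        by (simp add: exp_plus_pi g_def bounded_clinear_simps(2)[OF S])
      have "exp (- a) *\<^sub>C (?S y - g) = (exp (- a) + 1) *\<^sub>C (?S y - ?S g)"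
        unfolding rel by (simp add: scaleC_scaleC distrib_left flip: exp_add)
      then have rel': "exp (- a) *\<^sub>C ?S g + (?S g - ?S y) = exp (- a) *\<^sub>C g"
        by (simp add: scaleC_simps algebra_simps)
      have "?S ((h a * exp (- a)) *\<^sub>C F a g + (h a *\<^sub>C F a g - h a *\<^sub>C F a y)) =
          h a *\<^sub>C F a (exp (- a) *\<^sub>C ?S g + (?S g - ?S y))"
        using GF[OF U(1) aF[OF a]]
        by (simp add: bounded_clinear_simps[OF S] bounded_clinear_simps[OF Fa] scaleC_simps)
      then show "?S ((h a * exp (- a)) *\<^sub>C F a (G a y) + (h a *\<^sub>C F a (G a y) - h a *\<^sub>C F a y)) =
          (h a * exp (- a)) *\<^sub>C F a (G a y)"
        unfolding rel' by (simp add: g_def bounded_clinear_simps[OF Fa] scaleC_scaleC)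
    qed
    finally show ?thesis by simp
  qed
  moreover have "I1 = ?T q'"
  proof -
    have "q' = boundary_integral \<mu> (\<lambda>a. h a *\<^sub>C G a y + ((h a * exp (- a)) *\<^sub>C F a (G a y) - h a *\<^sub>C F a (G a y)))"
      unfolding q'_def I1_def I2_def I3_def
      by (simp only: boundary_integral_add[OF nn(2) d3 diff[OF d1 d2]] boundary_integral_diff[OF nn(2) d1 d2])
    then have "?T q' = boundary_integral \<mu> (\<lambda>a. ?T (h a *\<^sub>C G a y + ((h a * exp (- a)) *\<^sub>C F a (G a y) - h a *\<^sub>C F a (G a y))))"
      using boundary_integral_bounded_clinear[OF nn(2) sum[OF d3 diff[OF d1 d2]] T] by simp
    also have "\<dots> = I1"
      unfolding I1_def
    proof (rule boundary_integral_cong[OF nn(2)])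
      fix a assume a: "\<bar>Im a\<bar> = \<mu>"
      define g where "g = G a y"
      have rel: "?T g - F a g = (1 - exp a) *\<^sub>C (?T g - ?T (F a g))"
        using resolvent_familyD(4)[OF F(1) aF[OF a] U(2), of g]
        by (simp add: bounded_clinear_simps(2)[OF T])
      have "exp (- a) *\<^sub>C (?T g - F a g) = (exp (- a) - 1) *\<^sub>C (?T g - ?T (F a g))"
        unfolding rel by (simp add: scaleC_scaleC right_diff_distrib flip: exp_add)
      then have rel': "?T g + (exp (- a) *\<^sub>C ?T (F a g) - ?T (F a g)) = exp (- a) *\<^sub>C F a g"
        by (simp add: scaleC_simps algebra_simps)
      have "?T (h a *\<^sub>C g + ((h a * exp (- a)) *\<^sub>C F a g - h a *\<^sub>C F a g)) =
          h a *\<^sub>C (?T g + (exp (- a) *\<^sub>C ?T (F a g) - ?T (F a g)))"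
        by (simp add: bounded_clinear_simps[OF T] scaleC_simps)
      then show "?T (h a *\<^sub>C G a y + ((h a * exp (- a)) *\<^sub>C F a (G a y) - h a *\<^sub>C F a (G a y))) =
          (h a * exp (- a)) *\<^sub>C F a (G a y)"
        unfolding rel' by (simp add: g_def scaleC_scaleC)
    qed
    finally show ?thesis by simp
  qed
  moreover have "(q - I1) + (q' - I1) = I3"
    by (simp add: q_def q'_def z)
  ultimately show ?thesis unfolding I3_def by blast
qed

end

section \<open>The \<open>L\<^sup>p\<close> norm in logarithmic coordinates\<close>

lemma space_dt_over_t [simp]: "space dt_over_t = {0<..}"
  by (simp add: dt_over_t_def space_restrict_space)

lemma ln_measurable_dt_over_t [measurable]: "ln \<in> dt_over_t \<rightarrow>\<^sub>M borel"
proof -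
  have "(\<lambda>x::real. ln x) \<in> borel \<rightarrow>\<^sub>M borel" by measurable
  then have "ln \<in> restrict_space lborel {0<..} \<rightarrow>\<^sub>M (borel :: real measure)"
    by (intro measurable_restrict_space1) (simp add: measurable_lborel1)
  then show ?thesis unfolding dt_over_t_def by simp
qed

text \<open>The interval \<open>{exp l<..<exp u}\<close> has \<open>dt / t\<close> measure
  \<open>ln (exp u) - ln (exp l) = u - l\<close>, and such values determine Lebesgue
  measure.\<close>

lemma distr_ln_dt_over_t: "distr dt_over_t borel ln = lborel"
proof (rule lborel_eqI[symmetric])
  fix l u :: real assume lu: "\<And>b. b \<in> Basis \<Longrightarrow> l \<bullet> b \<le> u \<bullet> b"
  then have le: "l \<le> u" by simp
  have set: "ln -` {l<..<u} \<inter> {0<..} = {exp l<..<exp u}"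
  proof (intro equalityI subsetI)
    fix x :: real assume "x \<in> ln -` {l<..<u} \<inter> {0<..}"
    then have x: "0 < x" "l < ln x" "ln x < u" by auto
    then show "x \<in> {exp l<..<exp u}"
      using exp_less_cancel_iff[of l "ln x"] exp_less_cancel_iff[of "ln x" u] by simp
  next
    fix x :: real assume x: "x \<in> {exp l<..<exp u}"
    then have "0 < x" by (auto intro: less_trans[OF exp_gt_zero])
    then show "x \<in> ln -` {l<..<u} \<inter> {0<..}"
      using x exp_less_cancel_iff[of l "ln x"] exp_less_cancel_iff[of "ln x" u] by simp
  qed
  have "emeasure (distr dt_over_t borel ln) (box l u) = emeasure dt_over_t {exp l<..<exp u}"
    by (subst emeasure_distr) (simp_all add: set)
  also have "\<dots> = (\<integral>\<^sup>+t. ennreal (1 / t) * indicator {exp l<..<exp u} t \<partial>restrict_space lborel {0<..})"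
    unfolding dt_over_t_def
  proof (rule emeasure_density)
    show "(\<lambda>t. ennreal (1 / t)) \<in> borel_measurable (restrict_space lborel {0<..})"
      by (intro measurable_restrict_space1) simp
    have "{exp l<..<exp u} \<subseteq> {0<..}" by (auto intro: less_trans[OF exp_gt_zero])
    then show "{exp l<..<exp u} \<in> sets (restrict_space lborel {0<..})"
      by (simp add: sets_restrict_space_iff)
  qed
  also have "\<dots> = (\<integral>\<^sup>+t. ennreal (1 / t) * indicator {exp l<..<exp u} t * indicator {0<..} t \<partial>lborel)"
    by (subst nn_integral_restrict_space) simp_all
  also have "\<dots> = (\<integral>\<^sup>+t. ennreal (1 / t) * indicator {exp l..exp u} t \<partial>lborel)"
  proof (rule nn_integral_cong_AE)
    have "AE t in lborel. t \<noteq> exp l \<and> t \<noteq> exp u"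
      using AE_lborel_singleton[of "exp l"] AE_lborel_singleton[of "exp u"] by eventually_elim auto
    then show "AE t in lborel. ennreal (1 / t) * indicator {exp l<..<exp u} t * indicator {0<..} t =
        ennreal (1 / t) * indicator {exp l..exp u} t"
      by eventually_elim (auto simp: indicator_def intro: less_trans[OF exp_gt_zero] less_le_trans[OF exp_gt_zero])
  qed
  also have "\<dots> = ln (exp u) - ln (exp l)"
  proof (rule nn_integral_FTC_Icc)
    fix x assume "x \<in> {exp l..exp u}"
    then have "0 < x" by (auto intro: less_le_trans[OF exp_gt_zero])
    then show "(ln has_real_derivative 1 / x) (at x)" "0 \<le> 1 / x"
      by (auto intro!: derivative_eq_intros)
  qed (use le in auto)
  finally show "emeasure (distr dt_over_t borel ln) (box l u) = (\<Prod>b\<in>Basis. (u - l) \<bullet> b)"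
    by simp
qed simp

text \<open>Measurability is asked only of the real function \<open>u\<close> that represents the
  norm of \<open>f\<close>.\<close>

lemma Lp_norm_dt_over_t:
  fixes f :: "real \<Rightarrow> 'a::real_normed_vector" and u :: "real \<Rightarrow> real"
  assumes u [measurable]: "u \<in> borel_measurable borel" and f: "\<And>t. 0 < t \<Longrightarrow> norm (f t) = \<bar>u (ln t)\<bar>"
  shows "Lp_norm p dt_over_t f = Lp_norm p lborel u"
proof -
  have "(\<integral>\<^sup>+t. ennreal (norm (f t) powr q) \<partial>dt_over_t) = (\<integral>\<^sup>+s. ennreal (norm (u s) powr q) \<partial>lborel)" for q
  proof -
    have "(\<integral>\<^sup>+t. ennreal (norm (f t) powr q) \<partial>dt_over_t) = (\<integral>\<^sup>+t. ennreal (norm (u (ln t)) powr q) \<partial>dt_over_t)"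
      by (rule nn_integral_cong) (simp add: f)
    also have "\<dots> = (\<integral>\<^sup>+s. ennreal (norm (u s) powr q) \<partial>distr dt_over_t borel ln)"
      by (subst nn_integral_distr) simp_all
    finally show ?thesis by (simp only: distr_ln_dt_over_t)
  qed
  moreover have "esssup dt_over_t (\<lambda>t. ennreal (norm (f t))) = esssup lborel (\<lambda>s. ennreal (norm (u s)))"
  proof -
    have m: "(\<lambda>t. ennreal (norm (u (ln t)))) \<in> borel_measurable dt_over_t" by measurable
    have m': "(\<lambda>t. ennreal (norm (f t))) \<in> borel_measurable dt_over_t"
      by (subst measurable_cong[where g = "\<lambda>t. ennreal (norm (u (ln t)))"]) (use f m in auto)
    have "esssup dt_over_t (\<lambda>t. ennreal (norm (f t))) = esssup dt_over_t (\<lambda>t. ennreal (norm (u (ln t))))"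
      by (rule esssup_AE_cong[OF m' m]) (auto intro!: AE_I2 simp: f)
    also have "\<dots> = Inf {z. AE s in distr dt_over_t borel ln. ennreal (norm (u s)) \<le> z}"
      unfolding esssup_eq_AE[OF m] by (subst AE_distr_iff) simp_all
    also have "\<dots> = esssup lborel (\<lambda>s. ennreal (norm (u s)))"
      unfolding distr_ln_dt_over_t by (rule esssup_eq_AE[symmetric]) simp
    finally show ?thesis .
  qed
  ultimately show ?thesis unfolding Lp_norm_def by simp
qed

text \<open>Convexity of \<open>x powr q\<close>, as Bernoulli's inequality for
  \<open>x / c\<close>. For positive \<open>x\<close> it follows from the weighted inequality of
  arithmetic and geometric means with weights \<open>1 / q\<close> and \<open>1 - 1 / q\<close>,
  applied to \<open>(x / c) powr q\<close> and \<open>1\<close>.\<close>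

lemma powr_above_tangent:
  fixes x c q :: real
  assumes q: "1 \<le> q" and c: "0 < c" and x: "0 \<le> x"
  shows "c powr q + q * c powr (q - 1) * (x - c) \<le> x powr q"
proof (cases "x = 0")
  case True
  have "c powr q = c * c powr (q - 1)" using c by (simp add: powr_diff)
  then have "c powr q + q * c powr (q - 1) * (x - c) = (1 - q) * (c * c powr (q - 1))"
    using True by (simp add: algebra_simps)
  also have "\<dots> \<le> 0" using q c by (intro mult_nonpos_nonneg) auto
  finally show ?thesis using True by simp
next
  case False
  then have x: "0 < x" using x by simp
  define y where "y = (x / c) powr q"
  have y: "y > 0" using x c by (simp add: y_def)
  have "y powr (1 / q) * 1 powr (1 - 1 / q) \<le> (1 / q) * y + (1 - 1 / q) * 1"
    by (rule Youngs_inequality_0) (use q y in auto)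
  moreover have "y powr (1 / q) = x / c" using q x c by (simp add: y_def powr_powr)
  ultimately have "x / c \<le> y / q + (1 - 1 / q)" by simp
  then have "q * (x / c) \<le> q * (y / q + (1 - 1 / q))" using q by (intro mult_left_mono) auto
  also have "\<dots> = y + q - 1" using q by (simp add: field_simps)
  finally have "1 + q * (x / c - 1) \<le> y" by (simp only: right_diff_distrib)
  then have "c powr q * (1 + q * (x / c - 1)) \<le> c powr q * y" by (intro mult_left_mono) auto
  also have "c powr q * y = x powr q" using x c by (simp add: y_def powr_divide)
  also have "c powr q * (1 + q * (x / c - 1)) = c powr q + q * c powr (q - 1) * (x - c)"
    using c by (simp add: powr_diff field_simps)
  finally show ?thesis .
qed

lemma exp_decay_translated_kernel:
  fixes h :: "real \<Rightarrow> real"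
  assumes d: "0 < d" and h: "continuous_on UNIV h" "\<And>s. \<bar>h s\<bar> \<le> B"
  shows "exp_decay (exp (d * \<bar>t\<bar>) * B) d (\<lambda>s. exp (- d * \<bar>t - s\<bar>) * h s)"
  unfolding exp_decay_def
proof (intro conjI allI d)
  show "continuous_on UNIV (\<lambda>s. exp (- d * \<bar>t - s\<bar>) * h s)" by (intro continuous_intros h)
  fix s
  have "d * (\<bar>s\<bar> - \<bar>t\<bar>) \<le> d * \<bar>t - s\<bar>" using d by (intro mult_left_mono) auto
  then have "exp (- d * \<bar>t - s\<bar>) \<le> exp (d * \<bar>t\<bar>) * exp (- d * \<bar>s\<bar>)"
    by (simp add: algebra_simps flip: exp_add)
  then have "exp (- d * \<bar>t - s\<bar>) * \<bar>h s\<bar> \<le> (exp (d * \<bar>t\<bar>) * exp (- d * \<bar>s\<bar>)) * B"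
    by (intro mult_mono h) auto
  then show "norm (exp (- d * \<bar>t - s\<bar>) * h s) \<le> exp (d * \<bar>t\<bar>) * B * exp (- d * \<bar>s\<bar>)"
    by (simp add: abs_mult mult_ac)
qed

lemma integral_translated_kernel:
  assumes d: "0 < (d::real)"
  shows "integral UNIV (\<lambda>s. exp (- d * \<bar>t - s\<bar>)) = 2 / d"
proof -
  have "integral UNIV (\<lambda>s. exp (- d * \<bar>s + (- t)\<bar>)) = integral UNIV (\<lambda>s. exp (- d * \<bar>s\<bar>))"
    by (rule integral_UNIV_translation)
  also have "\<dots> = 2 / d" by (rule integral_unique[OF has_integral_exp_neg_abs[OF d]])
  finally show ?thesis by (simp add: abs_minus_commute)
qed

text \<open>The exceptional set is open and null, hence empty.\<close>

lemma AE_le_continuous: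
  fixes g :: "real \<Rightarrow> real"
  assumes "continuous_on UNIV g" "AE s in lborel. g s \<le> X"
  shows "g s \<le> X"
proof (rule ccontr)
  assume "\<not> g s \<le> X"
  have op: "open {s. X < g s}"
    using open_Collect_less[OF continuous_on_const assms(1)] .
  have "{s. X < g s} \<in> null_sets lborel"
    using assms(2) op by (subst AE_iff_null_sets) (auto simp: not_le elim!: eventually_mono)
  then have "negligible {s. X < g s}"
    unfolding negligible_iff_null_sets by (rule null_sets_completionI)
  moreover have "s \<in> {s. X < g s}" using \<open>\<not> g s \<le> X\<close> by simp
  ultimately show False using open_not_negligible[OF op] by blast
qed

text \<open>Young's inequality. For finite \<open>p\<close> it is reduced to Tonelli's theorem by Jensen's inequality, which follows by
  integrating the tangent of \<open>x powr q\<close> at the weighted mean of \<open>g\<close>.\<close>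

lemma Lp_norm_convolution_le:
  fixes g u :: "real \<Rightarrow> real"
  assumes p: "1 \<le> p" and d: "0 < d"
    and g: "continuous_on UNIV g" "\<And>s. 0 \<le> g s" "\<And>s. g s \<le> B"
    and u: "u \<in> borel_measurable borel" "\<And>t. 0 \<le> u t" "\<And>t. u t \<le> M * integral UNIV (\<lambda>s. exp (- d * \<bar>t - s\<bar>) * g s)"
    and M: "0 \<le> M" and X: "0 \<le> X" "Lp_norm p lborel g \<le> ennreal X"
  shows "Lp_norm p lborel u \<le> ennreal (M * (2 / d) * X)"
proof (cases "p = \<infinity>")
  case True
  have "esssup lborel (\<lambda>t. ennreal (norm (g t))) \<le> ennreal X"
    using X(2) True by (simp add: Lp_norm_def)
  then have "AE s in lborel. ennreal (norm (g s)) \<le> ennreal X"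
    using esssup_AE[where M = lborel and f = "\<lambda>t. ennreal (norm (g t))"] by (auto elim: eventually_mono)
  then have "AE s in lborel. g s \<le> X"
    by (rule eventually_mono) (use X(1) g(2) in auto)
  then have gX: "g s \<le> X" for s by (rule AE_le_continuous[OF g(1)])
  have "u t \<le> M * (2 / d) * X" for t
  proof -
    have "integral UNIV (\<lambda>s. exp (- d * \<bar>t - s\<bar>) * g s) \<le> integral UNIV (\<lambda>s. exp (- d * \<bar>t - s\<bar>) * X)"
    proof (rule integral_le)
      show "(\<lambda>s. exp (- d * \<bar>t - s\<bar>) * g s) integrable_on UNIV"
        by (rule exp_decay_integrable(1)[OF exp_decay_translated_kernel[OF d g(1), of B]]) (use g in auto)
      show "(\<lambda>s. exp (- d * \<bar>t - s\<bar>) * X) integrable_on UNIV"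
        by (rule exp_decay_integrable(1)[OF exp_decay_translated_kernel[OF d continuous_on_const, of _ "\<bar>X\<bar>"]]) auto
    qed (auto intro!: mult_left_mono gX)
    also have "\<dots> = (2 / d) * X"
      using integral_translated_kernel[OF d, of t] by simp
    finally show ?thesis using u(3)[of t] mult_left_mono[OF _ M, of _ "(2 / d) * X"] by (metis mult.assoc order_trans)
  qed
  then have "esssup lborel (\<lambda>t. ennreal (norm (u t))) \<le> ennreal (M * (2 / d) * X)"
    using u(1,2) by (intro esssup_I) (auto intro!: AE_I2 ennreal_leI)
  then show ?thesis using True by (simp add: Lp_norm_def)
next
  case False
  define q where "q = enn2real p"
  have q: "1 \<le> q"
    using p False enn2real_mono[of 1 p] by (simp add: q_def top.not_eq_extremum)
  define \<kappa> where "\<kappa> = 2 / d"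
  have \<kappa>: "0 < \<kappa>" using d by (simp add: \<kappa>_def)
  define Ig where "Ig = (\<integral>\<^sup>+s. ennreal (g s powr q) \<partial>lborel)"
  define Iu where "Iu = (\<integral>\<^sup>+s. ennreal (u s powr q) \<partial>lborel)"
  have Lg: "Lp_norm p lborel g = (if Ig = \<infinity> then \<infinity> else ennreal (enn2real Ig powr (1 / q)))"
    using False g(2) by (simp add: Lp_norm_def Let_def Ig_def q_def)
  have Lu: "Lp_norm p lborel u = (if Iu = \<infinity> then \<infinity> else ennreal (enn2real Iu powr (1 / q)))"
    using False u(2) by (simp add: Lp_norm_def Let_def Iu_def q_def)
  have Ig: "Ig \<noteq> \<infinity>" using X(2) Lg by (auto simp: top_unique)
  then have Xg: "enn2real Ig powr (1 / q) \<le> X" using X Lg by simp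
  have gm: "g \<in> borel_measurable borel" using g(1) by (rule borel_measurable_continuous_onI)
  have cgq: "continuous_on UNIV (\<lambda>s. g s powr q)"
    using g q by (intro continuous_on_powr' continuous_intros) auto
  have [measurable]: "(\<lambda>s. g s powr q) \<in> borel_measurable borel"
    using cgq by (rule borel_measurable_continuous_onI)
  have gq: "0 \<le> g s powr q" "g s powr q \<le> B powr q" for s
    using g(2,3)[of s] q by (auto intro: powr_mono2)
  have J1: "(\<lambda>s. exp (- d * \<bar>t - s\<bar>) * g s) integrable_on UNIV" for t
    by (rule exp_decay_integrable(1)[OF exp_decay_translated_kernel[OF d g(1), of B]]) (use g in auto)
  have J2: "(\<lambda>s. exp (- d * \<bar>t - s\<bar>) * g s powr q) integrable_on UNIV" for t
    by (rule exp_decay_integrable(1)[OF exp_decay_translated_kernel[OF d cgq, of "B powr q"]]) (use gq in auto)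
  have J0: "(\<lambda>s. exp (- d * \<bar>t - s\<bar>) * k) integrable_on UNIV" for t k
    by (rule exp_decay_integrable(1)[OF exp_decay_translated_kernel[OF d continuous_on_const, of _ "\<bar>k\<bar>"]]) auto
  have jensen: "(integral UNIV (\<lambda>s. exp (- d * \<bar>t - s\<bar>) * g s)) powr q \<le>
      \<kappa> powr (q - 1) * integral UNIV (\<lambda>s. exp (- d * \<bar>t - s\<bar>) * g s powr q)" for t
  proof -
    define m where "m = integral UNIV (\<lambda>s. exp (- d * \<bar>t - s\<bar>) * g s)"
    have m0: "0 \<le> m" unfolding m_def using g(2) by (intro integral_nonneg J1) auto
    have R0: "0 \<le> integral UNIV (\<lambda>s. exp (- d * \<bar>t - s\<bar>) * g s powr q)"
      using gq by (intro integral_nonneg J2) auto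
    show ?thesis
    proof (cases "m = 0")
      case True
      then show ?thesis unfolding m_def[symmetric] using R0 by simp
    next
      case False
      \<comment> \<open>\<open>c\<close> is the mean of \<open>g\<close> for the probability density
        \<open>exp (- d * \<bar>t - s\<bar>) / \<kappa>\<close>; the tangent is taken there.\<close>
      define c where "c = m / \<kappa>"
      have c: "0 < c" using False m0 \<kappa> by (simp add: c_def)
      have int: "((\<lambda>s. exp (- d * \<bar>t - s\<bar>) * (c powr q - q * c powr (q - 1) * c) + (q * c powr (q - 1)) * (exp (- d * \<bar>t - s\<bar>) * g s))
          has_integral \<kappa> * (c powr q - q * c powr (q - 1) * c) + (q * c powr (q - 1)) * m) UNIV"
        using integrable_integral[OF J0[of t "c powr q - q * c powr (q - 1) * c"]] integrable_integral[OF J1[of t]]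
          integral_translated_kernel[OF d, of t]
        unfolding m_def \<kappa>_def by (intro has_integral_add has_integral_mult_right) auto
      have "\<kappa> * (c powr q - q * c powr (q - 1) * c) + (q * c powr (q - 1)) * m \<le>
          integral UNIV (\<lambda>s. exp (- d * \<bar>t - s\<bar>) * g s powr q)"
      proof (rule has_integral_le[OF int integrable_integral[OF J2]])
        fix s
        have "exp (- d * \<bar>t - s\<bar>) * (c powr q + q * c powr (q - 1) * (g s - c)) \<le> exp (- d * \<bar>t - s\<bar>) * g s powr q"
          by (intro mult_left_mono powr_above_tangent[OF q c g(2)]) auto
        then show "exp (- d * \<bar>t - s\<bar>) * (c powr q - q * c powr (q - 1) * c) + (q * c powr (q - 1)) * (exp (- d * \<bar>t - s\<bar>) * g s)
            \<le> exp (- d * \<bar>t - s\<bar>) * g s powr q"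
          by (simp add: algebra_simps)
      qed
      \<comment> \<open>Because the tangent point is the mean, the linear terms cancel after
        integration.\<close>
      moreover have "\<kappa> * c = m" using \<kappa> by (simp add: c_def)
      then have "\<kappa> * (c powr q - q * c powr (q - 1) * c) + (q * c powr (q - 1)) * m = \<kappa> * c powr q"
        by (simp add: algebra_simps)
      ultimately have "\<kappa> powr (q - 1) * (\<kappa> * c powr q) \<le> \<kappa> powr (q - 1) * integral UNIV (\<lambda>s. exp (- d * \<bar>t - s\<bar>) * g s powr q)"
        by (intro mult_left_mono) auto
      moreover have "\<kappa> powr (q - 1) * (\<kappa> * c powr q) = m powr q"
        using \<kappa> c m0 by (simp add: c_def powr_divide powr_diff)
      ultimately show ?thesis by (simp add: m_def)
    qed
  qed
  have "Iu \<le> (\<integral>\<^sup>+t. ennreal (M powr q * \<kappa> powr (q - 1)) * (\<integral>\<^sup>+s. ennreal (exp (- d * \<bar>t - s\<bar>) * g s powr q) \<partial>lborel) \<partial>lborel)"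
    unfolding Iu_def
  proof (rule nn_integral_mono)
    fix t :: real
    have R0: "0 \<le> integral UNIV (\<lambda>s. exp (- d * \<bar>t - s\<bar>) * g s powr q)"
      using gq by (intro integral_nonneg J2) auto
    have m0: "0 \<le> integral UNIV (\<lambda>s. exp (- d * \<bar>t - s\<bar>) * g s)"
      using g(2) by (intro integral_nonneg J1) auto
    have "u t powr q \<le> (M * integral UNIV (\<lambda>s. exp (- d * \<bar>t - s\<bar>) * g s)) powr q"
      using u q by (intro powr_mono2) auto
    also have "\<dots> = M powr q * (integral UNIV (\<lambda>s. exp (- d * \<bar>t - s\<bar>) * g s)) powr q"
      using M m0 by (simp add: powr_mult)
    also have "\<dots> \<le> M powr q * (\<kappa> powr (q - 1) * integral UNIV (\<lambda>s. exp (- d * \<bar>t - s\<bar>) * g s powr q))"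
      by (intro mult_left_mono jensen) auto
    finally have "ennreal (u t powr q) \<le> ennreal ((M powr q * \<kappa> powr (q - 1)) * integral UNIV (\<lambda>s. exp (- d * \<bar>t - s\<bar>) * g s powr q))"
      by (intro ennreal_leI) (simp only: mult.assoc)
    also have "\<dots> = ennreal (M powr q * \<kappa> powr (q - 1)) * ennreal (integral UNIV (\<lambda>s. exp (- d * \<bar>t - s\<bar>) * g s powr q))"
      using R0 by (simp add: ennreal_mult)
    also have "ennreal (integral UNIV (\<lambda>s. exp (- d * \<bar>t - s\<bar>) * g s powr q)) =
        (\<integral>\<^sup>+s. ennreal (exp (- d * \<bar>t - s\<bar>) * g s powr q) \<partial>lborel)"
      by (rule nn_integral_has_integral_lborel[OF _ _ integrable_integral[OF J2], symmetric]) (use gm gq in auto)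
    finally show "ennreal (u t powr q) \<le> ennreal (M powr q * \<kappa> powr (q - 1)) * (\<integral>\<^sup>+s. ennreal (exp (- d * \<bar>t - s\<bar>) * g s powr q) \<partial>lborel)" .
  qed
  also have "\<dots> = ennreal (M powr q * \<kappa> powr (q - 1)) * (\<integral>\<^sup>+t. (\<integral>\<^sup>+s. ennreal (exp (- d * \<bar>t - s\<bar>) * g s powr q) \<partial>lborel) \<partial>lborel)"
    by (rule nn_integral_cmult) measurable
  also have "(\<integral>\<^sup>+t. (\<integral>\<^sup>+s. ennreal (exp (- d * \<bar>t - s\<bar>) * g s powr q) \<partial>lborel) \<partial>lborel) =
      (\<integral>\<^sup>+s. (\<integral>\<^sup>+t. ennreal (exp (- d * \<bar>t - s\<bar>) * g s powr q) \<partial>lborel) \<partial>lborel)"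
  proof (rule lborel_pair.Fubini')
    show "(\<lambda>(s, t). ennreal (exp (- d * \<bar>t - s\<bar>) * g s powr q)) \<in> borel_measurable (lborel \<Otimes>\<^sub>M lborel)"
      by measurable
  qed
  also have "\<dots> = (\<integral>\<^sup>+s. ennreal \<kappa> * ennreal (g s powr q) \<partial>lborel)"
  proof (rule nn_integral_cong)
    fix s :: real
    have "(\<integral>\<^sup>+t. ennreal (exp (- d * \<bar>t - s\<bar>)) \<partial>lborel) = ennreal \<kappa>"
    proof (rule nn_integral_has_integral_lborel)
      have "(\<lambda>t. exp (- d * \<bar>s - t\<bar>) * 1) integrable_on UNIV" by (rule J0)
      then show "((\<lambda>t. exp (- d * \<bar>t - s\<bar>)) has_integral \<kappa>) UNIV"
        using integral_translated_kernel[OF d, of s] by (simp add: \<kappa>_def abs_minus_commute has_integral_iff)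
    qed auto
    then show "(\<integral>\<^sup>+t. ennreal (exp (- d * \<bar>t - s\<bar>) * g s powr q) \<partial>lborel) = ennreal \<kappa> * ennreal (g s powr q)"
      using gq(1)[of s] by (simp add: ennreal_mult nn_integral_multc)
  qed
  also have "\<dots> = ennreal \<kappa> * Ig"
    unfolding Ig_def using gm by (intro nn_integral_cmult) measurable
  finally have le: "Iu \<le> ennreal ((M * \<kappa>) powr q) * Ig"
    using M \<kappa> by (simp add: powr_mult powr_diff flip: mult.assoc ennreal_mult)
  also have "\<dots> = ennreal ((M * \<kappa>) powr q * enn2real Ig)"
    using Ig by (simp add: ennreal_mult top.not_eq_extremum)
  finally have le': "Iu \<le> ennreal ((M * \<kappa>) powr q * enn2real Ig)" .
  then have Iu: "Iu \<noteq> \<infinity>" by (auto simp: top_unique)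
  have "enn2real Iu \<le> (M * \<kappa>) powr q * enn2real Ig"
    using enn2real_mono[OF le'] by simp
  then have "enn2real Iu powr (1 / q) \<le> ((M * \<kappa>) powr q * enn2real Ig) powr (1 / q)"
    using q by (intro powr_mono2) auto
  also have "\<dots> = M * \<kappa> * enn2real Ig powr (1 / q)"
    using M \<kappa> q by (simp add: powr_mult powr_powr)
  also have "\<dots> \<le> M * \<kappa> * X"
    using M \<kappa> by (intro mult_left_mono Xg) auto
  finally show ?thesis using Iu Lu by (simp add: \<kappa>_def ennreal_leI)
qed

text \<open>\<open>N\<close> is the norm of \<open>exp (- a * \<bar>t\<bar>)\<close>: its
  \<open>q\<close>-th power has integral \<open>2 / (a * q)\<close>, and for
  \<open>p = \<infinity>\<close> the norm is \<open>1\<close>. As \<open>N\<close> does not depend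
  on \<open>u\<close> and \<open>c\<close>, the bound tends to \<open>0\<close> with
  \<open>c\<close>.\<close>

lemma Lp_norm_exp_decay_le:
  fixes a :: real
  assumes p: "1 \<le> p" and a: "0 < a"
  shows "\<exists>N\<ge>0. \<forall>u c. u \<in> borel_measurable borel \<longrightarrow> 0 \<le> c \<longrightarrow> (\<forall>t. \<bar>u t\<bar> \<le> c * exp (- a * \<bar>t\<bar>)) \<longrightarrow>
      Lp_norm p lborel (u :: real \<Rightarrow> real) \<le> ennreal (c * N)"
proof (cases "p = \<infinity>")
  case True
  show ?thesis
  proof (intro exI[of _ 1] conjI allI impI)
    fix u :: "real \<Rightarrow> real" and c :: real
    assume u: "u \<in> borel_measurable borel" "\<forall>t. \<bar>u t\<bar> \<le> c * exp (- a * \<bar>t\<bar>)" and c: "0 \<le> c"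
    have "\<bar>u t\<bar> \<le> c * 1" for t
      using u(2)[rule_format, of t] mult_left_mono[of "exp (- a * \<bar>t\<bar>)" 1 c] a c by auto
    then have "esssup lborel (\<lambda>t. ennreal (norm (u t))) \<le> ennreal (c * 1)"
      using u(1) by (intro esssup_I) (auto intro!: AE_I2 ennreal_leI)
    then show "Lp_norm p lborel u \<le> ennreal (c * 1)" using True by (simp add: Lp_norm_def)
  qed simp
next
  case False
  define q where "q = enn2real p"
  have q: "1 \<le> q"
    using p False enn2real_mono[of 1 p] by (simp add: q_def top.not_eq_extremum)
  define N where "N = (2 / (a * q)) powr (1 / q)"
  show ?thesis
  proof (intro exI[of _ N] conjI allI impI)
    fix u :: "real \<Rightarrow> real" and c :: real
    assume u: "u \<in> borel_measurable borel" "\<forall>t. \<bar>u t\<bar> \<le> c * exp (- a * \<bar>t\<bar>)" and c: "0 \<le> c"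
    define I where "I = (\<integral>\<^sup>+t. ennreal (norm (u t) powr q) \<partial>lborel)"
    have "I \<le> (\<integral>\<^sup>+t. ennreal (c powr q * exp (- (a * q) * \<bar>t\<bar>)) \<partial>lborel)"
      unfolding I_def
    proof (rule nn_integral_mono, rule ennreal_leI)
      fix t
      have "norm (u t) powr q \<le> (c * exp (- a * \<bar>t\<bar>)) powr q"
        using u(2) q by (intro powr_mono2) auto
      also have "\<dots> = c powr q * exp (- (a * q) * \<bar>t\<bar>)"
        using c by (simp add: powr_mult exp_powr_real mult_ac)
      finally show "norm (u t) powr q \<le> c powr q * exp (- (a * q) * \<bar>t\<bar>)" .
    qed
    also have "\<dots> = ennreal (c powr q * (2 / (a * q)))"
    proof (rule nn_integral_has_integral_lborel)
      show "((\<lambda>t. c powr q * exp (- (a * q) * \<bar>t\<bar>)) has_integral c powr q * (2 / (a * q))) UNIV"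
        using a q by (intro has_integral_mult_right has_integral_exp_neg_abs) simp
    qed auto
    finally have le: "I \<le> ennreal (c powr q * (2 / (a * q)))" .
    then have I: "I \<noteq> \<infinity>" by (auto simp: top_unique)
    have "enn2real I \<le> c powr q * (2 / (a * q))" using enn2real_mono[OF le] a q by simp
    then have "enn2real I powr (1 / q) \<le> (c powr q * (2 / (a * q))) powr (1 / q)"
      using q by (intro powr_mono2) auto
    also have "\<dots> = c * N" using c a q by (subst powr_mult) (simp_all add: N_def powr_powr)
    finally have "enn2real I powr (1 / q) \<le> c * N" .
    moreover have "Lp_norm p lborel u = (if I = \<infinity> then \<infinity> else ennreal (enn2real I powr (1 / q)))"
      using False by (simp only: Lp_norm_def Let_def I_def q_def if_False)
    ultimately show "Lp_norm p lborel u \<le> ennreal (c * N)"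
      using I by (simp add: ennreal_leI)
  qed (simp add: N_def)
qed

section \<open>Consequences of the square function estimate\<close>

locale square_function_families = sectorial_families +
  fixes p :: ennreal and c0 C0 :: real
  assumes p: "1 \<le> p" and c0: "0 < c0" and C0: "0 < C0"
    and lower: "\<And>x. ennreal (c0 * norm x) \<le> Lp_norm p lborel (\<lambda>s. norm (calc (\<Phi>t s) x))"
    and upper: "\<And>x. Lp_norm p lborel (\<lambda>s. norm (calc (\<Phi>t s) x)) \<le> ennreal (C0 * norm x)"
begin

lemma continuous_norm_calc: "continuous_on UNIV (\<lambda>s. norm (calc (\<Phi>t s) x))"
  by (intro continuous_intros continuous_calc_\<Phi>t)

lemma measurable_norm_calc: "(\<lambda>s. norm (calc (\<Phi>t s) x)) \<in> borel_measurable borel"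
  by (rule borel_measurable_continuous_onI[OF continuous_norm_calc])

text \<open>\<open>lower\<close> is used at \<open>x\<close>, \<open>upper\<close> at
  \<open>x + y\<close>, and Young's inequality connects them. Here \<open>x\<close> and
  \<open>y\<close> stand for the images of one vector under \<open>A\<close> and
  \<open>B\<close>.\<close>

lemma norm_le_sum:
  obtains M where "0 \<le> M"
    "\<And>x y. (\<And>a. \<bar>Im a\<bar> = \<mu> \<Longrightarrow> G a x = G a (F a (x + y)) - F a y) \<Longrightarrow> norm x \<le> M * norm (x + y)"
proof -
  define M0 where "M0 = 1 / cmod \<kappa> * (4 / e * C * C * (K * L))"
  define d where "d = e / 2"
  have d: "0 < d" using e_pos by (simp add: d_def)
  have M0: "0 \<le> M0"
    using e_pos resolvent_familyD(1)[OF G(1)] resolvent_familyD(1)[OF F(1)] C_nonneg by (simp add: M0_def)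
  have "norm x \<le> (M0 * (2 / d) * C0 / c0) * norm (x + y)"
    if rel: "\<And>a. \<bar>Im a\<bar> = \<mu> \<Longrightarrow> G a x = G a (F a (x + y)) - F a y" for x y
  proof -
    have "Lp_norm p lborel (\<lambda>s. norm (calc (\<Phi>t s) x)) \<le> ennreal (M0 * (2 / d) * (C0 * norm (x + y)))"
    proof (rule Lp_norm_convolution_le[OF p d continuous_norm_calc _ norm_calc_\<Phi>t_le measurable_norm_calc _ _ M0 _ upper])
      show "norm (calc (\<Phi>t t) x) \<le> M0 * integral UNIV (\<lambda>s. exp (- d * \<bar>t - s\<bar>) * norm (calc (\<Phi>t s) (x + y)))" for t
        using calc_convolution_bound[OF rel, of t] by (simp only: M0_def d_def)
    qed (use C0 in auto)
    with lower[of x] have "ennreal (c0 * norm x) \<le> ennreal (M0 * (2 / d) * (C0 * norm (x + y)))"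
      by (rule order_trans)
    then have "c0 * norm x \<le> M0 * (2 / d) * (C0 * norm (x + y))"
      using M0 d C0 by (subst (asm) ennreal_le_iff) auto
    then have "norm x \<le> M0 * (2 / d) * (C0 * norm (x + y)) / c0"
      using c0 by (simp only: pos_le_divide_eq mult.commute)
    then show ?thesis by simp
  qed
  moreover have "0 \<le> M0 * (2 / d) * C0 / c0" using M0 d C0 c0 by simp
  ultimately show ?thesis using that by blast
qed

text \<open>The hypothesis expresses \<open>A x = 0\<close>. Every \<open>calc (\<Phi>t t) x\<close>
  is then the integral of a scalar holomorphic function times a constant vector, hence
  \<open>0\<close>, and \<open>lower\<close> gives the claim.\<close>

lemma eq_0_if_fixed:
  assumes "\<And>a. \<bar>Im a\<bar> = \<nu> \<Longrightarrow> G a x = x"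
  shows "x = 0"
proof -
  have "calc (\<Phi>t t) x = 0" for t
  proof -
    have "calc (\<Phi>t t) x = boundary_integral \<nu> (\<lambda>z. \<Phi>t t z *\<^sub>C x)"
      unfolding calc_def by (rule boundary_integral_cong) (auto simp: assms)
    also have "\<dots> = 0" by (rule boundary_integral_strip_scaleC_eq_0[OF \<Phi>t]) (use angles in auto)
    finally show ?thesis .
  qed
  then have "(\<lambda>s. norm (calc (\<Phi>t s) x)) = (\<lambda>s. 0)" by auto
  moreover obtain N where N: "\<forall>u c. u \<in> borel_measurable borel \<longrightarrow> 0 \<le> c \<longrightarrow>
      (\<forall>t. \<bar>u t\<bar> \<le> c * exp (- 1 * \<bar>t\<bar>)) \<longrightarrow> Lp_norm p lborel (u :: real \<Rightarrow> real) \<le> ennreal (c * N)"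
    using Lp_norm_exp_decay_le[OF p, of 1] by auto
  have "Lp_norm p lborel (\<lambda>s::real. 0 :: real) \<le> ennreal (0 * N)"
    using N[rule_format, of "\<lambda>s. 0" 0] by simp
  ultimately have "ennreal (c0 * norm x) \<le> 0" using lower[of x] by (auto intro: order_trans)
  then have "c0 * norm x \<le> 0" by (simp add: ennreal_eq_0_iff)
  then show ?thesis using c0 by (simp add: mult_le_0_iff)
qed

text \<open>The images of the difference under \<open>calc (\<Phi>t t)\<close> have, as a function
  of \<open>t\<close>, a norm of order \<open>exp (- m / 2)\<close>, which \<open>lower\<close>
  transfers to the difference itself.\<close>

lemma approx_unit_tendsto:
  assumes v: "v = G (Complex 0 pi) w" and y: "y = v - G (Complex 0 pi) v" and \<epsilon>: "0 < \<epsilon>"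
  shows "\<exists>m\<ge>0. norm (y - boundary_integral \<mu> (\<lambda>a. approx_unit m a *\<^sub>C G a y)) < \<epsilon>"
proof -
  define d where "d = min e (1/2)"
  obtain M where M: "\<And>m t. 0 \<le> m \<Longrightarrow> norm (calc (\<Phi>t t) (y - boundary_integral \<mu> (\<lambda>a. approx_unit m a *\<^sub>C G a y))) \<le>
      M * exp (- m / 2) * exp (- (d/2) * \<bar>t\<bar>)"
    using calc_approx_unit_estimate[OF v y] unfolding d_def by metis
  have d: "0 < d / 2" using e_pos by (simp add: d_def)
  obtain N where N: "0 \<le> N" "\<And>u c. u \<in> borel_measurable borel \<Longrightarrow> 0 \<le> c \<Longrightarrow> (\<And>t. \<bar>u t\<bar> \<le> c * exp (- (d/2) * \<bar>t\<bar>)) \<Longrightarrow>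
      Lp_norm p lborel (u :: real \<Rightarrow> real) \<le> ennreal (c * N)"
    using Lp_norm_exp_decay_le[OF p d] by metis
  have M0: "0 \<le> M"
    using order_trans[OF norm_ge_zero M[of 0 0]] by simp
  have le: "norm (y - boundary_integral \<mu> (\<lambda>a. approx_unit m a *\<^sub>C G a y)) \<le> M * exp (- m / 2) * N / c0" if m: "0 \<le> m" for m
  proof -
    let ?z = "y - boundary_integral \<mu> (\<lambda>a. approx_unit m a *\<^sub>C G a y)"
    have "Lp_norm p lborel (\<lambda>s. norm (calc (\<Phi>t s) ?z)) \<le> ennreal (M * exp (- m / 2) * N)"
      by (rule N(2)[OF measurable_norm_calc]) (use M[OF m] M0 in auto)
    with lower[of ?z] have "ennreal (c0 * norm ?z) \<le> ennreal (M * exp (- m / 2) * N)" by (rule order_trans)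
    then have "c0 * norm ?z \<le> M * exp (- m / 2) * N" using M0 N(1) by (subst (asm) ennreal_le_iff) auto
    then show ?thesis using c0 by (simp add: pos_le_divide_eq mult_ac)
  qed
  have "((\<lambda>m. M * exp (- m / 2) * N / c0) \<longlongrightarrow> 0) at_top" using c0 by real_asymp
  then have "\<forall>\<^sub>F m in at_top. M * exp (- m / 2) * N / c0 < \<epsilon> \<and> 0 \<le> m"
    using \<epsilon> by (intro eventually_conj eventually_ge_at_top order_tendstoD(2)) auto
  then obtain m where "M * exp (- m / 2) * N / c0 < \<epsilon>" "0 \<le> m"
    by (auto simp: eventually_at_top_linorder)
  then show ?thesis using le[of m] by (intro exI[of _ m]) auto
qed

end

section \<open>From operators to resolvent families\<close>

text \<open>The cone is closed and described by \<open>cos\<close>, so that membership in the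
  closure can be refuted without dealing with the jump of \<open>Arg\<close> on the negative
  axis.\<close>

lemma closure_sector_subset:
  assumes "0 \<le> \<sigma>" "\<sigma> \<le> pi"
  shows "closure (sector \<sigma>) \<subseteq> {z. cmod z * cos \<sigma> \<le> Re z}"
proof (rule closure_minimal)
  show "sector \<sigma> \<subseteq> {z. cmod z * cos \<sigma> \<le> Re z}"
  proof
    fix z assume z: "z \<in> sector \<sigma>"
    show "z \<in> {z. cmod z * cos \<sigma> \<le> Re z}"
    proof (cases "\<sigma> = 0")
      case True
      then show ?thesis using z by (auto simp: sector_def)
    next
      case False
      then have z: "z \<noteq> 0" "\<bar>Arg z\<bar> < \<sigma>" using z by (auto simp: sector_def)
      have "cos \<sigma> \<le> cos \<bar>Arg z\<bar>" using z assms by (subst cos_mono_le_eq) auto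
      then have "cmod z * cos \<sigma> \<le> cmod z * cos (Arg z)" by (intro mult_left_mono) auto
      also have "\<dots> = Re z" using z by (simp add: cos_Arg)
      finally show ?thesis by simp
    qed
  qed
  show "closed {z. cmod z * cos \<sigma> \<le> Re z}"
    by (intro closed_Collect_le continuous_intros)
qed

lemma exp_not_in_closure_sector:
  assumes "0 \<le> \<sigma>" "\<sigma> < \<bar>Im a\<bar>" "\<bar>Im a\<bar> \<le> pi"
  shows "exp a \<notin> closure (sector \<sigma>)"
proof -
  have "cos \<bar>Im a\<bar> < cos \<sigma>" using assms by (intro cos_monotone_0_pi) auto
  then have "exp (Re a) * cos (Im a) < exp (Re a) * cos \<sigma>" by simp
  then have "\<not> cmod (exp a) * cos \<sigma> \<le> Re (exp a)" by (simp add: Re_exp)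
  then show ?thesis using closure_sector_subset[of \<sigma>] assms by auto
qed

lemma minus_exp_not_in_closure_sector:
  assumes "0 \<le> \<sigma>" "\<sigma> \<le> pi" "\<bar>Im a\<bar> < pi - \<sigma>"
  shows "exp (a + Complex 0 pi) \<notin> closure (sector \<sigma>)"
proof -
  have "cos (pi - \<sigma>) < cos \<bar>Im a\<bar>" using assms by (intro cos_monotone_0_pi) auto
  then have "exp (Re a) * - cos (Im a) < exp (Re a) * cos \<sigma>"
    by (intro mult_strict_left_mono) (auto simp: cos_diff)
  then have "\<not> cmod (- exp a) * cos \<sigma> \<le> Re (- exp a)" by (simp add: Re_exp)
  then show ?thesis using closure_sector_subset[of \<sigma>] assms unfolding exp_plus_pi by auto
qed

lemma sector_mono: "\<omega> \<le> \<sigma> \<Longrightarrow> 0 \<le> \<omega> \<Longrightarrow> \<sigma> < pi \<Longrightarrow> sector \<omega> \<subseteq> sector \<sigma>"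
  by (auto simp: sector_def)

lemma resolvent_right:
  assumes "l \<in> resolvent_set D A"
  shows "resolvent D A l y \<in> D" "l *\<^sub>C resolvent D A l y - A (resolvent D A l y) = y"
proof -
  have bij: "bij_betw (\<lambda>x. l *\<^sub>C x - A x) D UNIV" using assms by (simp add: resolvent_set_def)
  then have y: "y \<in> (\<lambda>x. l *\<^sub>C x - A x) ` D" by (simp add: bij_betw_def)
  show "resolvent D A l y \<in> D"
    unfolding resolvent_def using the_inv_into_into[OF bij_betw_imp_inj_on[OF bij] y order_refl] .
  show "l *\<^sub>C resolvent D A l y - A (resolvent D A l y) = y"
    unfolding resolvent_def using f_the_inv_into_f[OF bij_betw_imp_inj_on[OF bij] y] .
qed

lemma resolvent_left:
  assumes "l \<in> resolvent_set D A" "x \<in> D"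
  shows "resolvent D A l (l *\<^sub>C x - A x) = x"
  unfolding resolvent_def
  by (rule the_inv_into_f_f) (use assms in \<open>auto simp: resolvent_set_def bij_betw_def\<close>)

lemma resolvent_identity:
  assumes "l \<in> resolvent_set D A" "m \<in> resolvent_set D A"
  shows "resolvent D A m y - resolvent D A l y = (l - m) *\<^sub>C resolvent D A l (resolvent D A m y)"
proof -
  let ?x = "resolvent D A m y"
  have lin: "bounded_clinear (resolvent D A l)" using assms(1) by (simp add: resolvent_set_def)
  have "l *\<^sub>C ?x - A ?x = y + (l - m) *\<^sub>C ?x"
    using resolvent_right(2)[OF assms(2), of y] by (simp add: scaleC.diff_left algebra_simps)
  then have "?x = resolvent D A l y + (l - m) *\<^sub>C resolvent D A l ?x"
    using resolvent_left[OF assms(1) resolvent_right(1)[OF assms(2)], of y]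
    by (simp add: bounded_clinear_simps[OF lin])
  then show ?thesis by (simp add: algebra_simps)
qed

lemma sectorial_resolvent_set:
  assumes "sectorial D A \<omega>" "\<omega> < \<sigma>" "\<sigma> < pi" "l \<notin> closure (sector \<sigma>)"
  shows "l \<in> resolvent_set D A"
  using assms closure_mono[OF sector_mono[of \<omega> \<sigma>]] unfolding sectorial_def spectrum_def by auto

text \<open>For the operator \<open>B\<close>, the value at \<open>a + Complex 0 pi\<close> is
  \<open>z (z + B)\<^sup>-\<^sup>1\<close> with \<open>z = exp a\<close>, since both signs
  change.\<close>

definition log_resolvent :: "'a::complex_banach set \<Rightarrow> ('a \<Rightarrow> 'a) \<Rightarrow> complex \<Rightarrow> 'a \<Rightarrow> 'a" where
  "log_resolvent D A a v = exp a *\<^sub>C resolvent D A (exp a) v"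

text \<open>The shift \<open>c\<close> is \<open>0\<close> for \<open>A\<close> and
  \<open>Complex 0 pi\<close> for \<open>B\<close>; it cancels in \<open>exp (a - b)\<close>, so
  both cases are the resolvent identity. The bound is uniform because all points avoid the closed
  sector of an angle \<sigma> larger than \<omega>.\<close>

lemma log_resolvent_family:
  assumes A: "sectorial D A \<omega>" "\<omega> < \<sigma>" "\<sigma> < pi" and U: "\<And>a. a \<in> U \<Longrightarrow> exp (a + c) \<notin> closure (sector \<sigma>)"
  shows "\<exists>K. resolvent_family U K (\<lambda>a. log_resolvent D A (a + c))"
proof -
  have res: "exp (a + c) \<in> resolvent_set D A" if "a \<in> U" for a
    using sectorial_resolvent_set[OF A U[OF that]] .
  have "bdd_above ((\<lambda>l. onorm (\<lambda>x. l *\<^sub>C resolvent D A l x)) ` (- closure (sector \<sigma>)))"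
    using A by (auto simp: sectorial_def)
  then obtain K where K: "\<And>l. l \<notin> closure (sector \<sigma>) \<Longrightarrow> onorm (\<lambda>x. l *\<^sub>C resolvent D A l x) \<le> K"
    by (auto simp: bdd_above_def)
  have lin: "bounded_clinear (log_resolvent D A (a + c))" if "a \<in> U" for a
  proof -
    have R: "bounded_clinear (resolvent D A (exp (a + c)))" using res[OF that] by (simp add: resolvent_set_def)
    have "bounded_linear (\<lambda>x. exp (a + c) *\<^sub>C resolvent D A (exp (a + c)) x)"
      by (rule bounded_linear_compose[OF scaleC.bounded_linear_right bounded_clinearD[OF R]])
    then show ?thesis
      unfolding bounded_clinear_def log_resolvent_def[abs_def]
      by (simp add: bounded_clinear_simps[OF R] scaleC_scaleC mult.commute)
  qed
  have "resolvent_family U (max K 0) (\<lambda>a. log_resolvent D A (a + c))"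
    unfolding resolvent_family_def
  proof (intro conjI ballI allI)
    fix a v assume a: "a \<in> U"
    show "bounded_clinear (log_resolvent D A (a + c))" by (rule lin[OF a])
    have "norm (log_resolvent D A (a + c) v) \<le> onorm (log_resolvent D A (a + c)) * norm v"
      by (rule onorm[OF bounded_clinearD[OF lin[OF a]]])
    also have "\<dots> \<le> max K 0 * norm v"
      using K[OF U[OF a]] by (intro mult_right_mono) (auto simp: log_resolvent_def[abs_def])
    finally show "norm (log_resolvent D A (a + c) v) \<le> max K 0 * norm v" .
    fix b assume b: "b \<in> U"
    define z w where "z = exp (b + c)" and "w = exp (a + c)"
    have zw: "exp (a - b) = w / z" "z \<noteq> 0" by (auto simp: z_def w_def simp flip: exp_diff)
    define Rz Rw where "Rz = resolvent D A z" and "Rw = resolvent D A w"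
    have Rz: "bounded_clinear Rz" using res[OF b] by (simp add: resolvent_set_def Rz_def z_def)
    have id: "Rw v - Rz v = (z - w) *\<^sub>C Rz (Rw v)"
      using resolvent_identity[OF res[OF b] res[OF a], of v] by (simp add: Rz_def Rw_def z_def w_def)
    have "(1 - w / z) *\<^sub>C (z *\<^sub>C Rz (v - w *\<^sub>C Rw v)) = (z - w) *\<^sub>C Rz v - w *\<^sub>C ((z - w) *\<^sub>C Rz (Rw v))"
      using zw(2) by (simp add: bounded_clinear_simps[OF Rz] scaleC_scaleC scaleC.diff_right
          left_diff_distrib mult.commute right_diff_distrib)
    also have "\<dots> = z *\<^sub>C Rz v - w *\<^sub>C Rw v"
      unfolding id[symmetric] by (simp add: scaleC.diff_left scaleC.diff_right)
    finally show "log_resolvent D A (b + c) v - log_resolvent D A (a + c) v =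
        (1 - exp (a - b)) *\<^sub>C log_resolvent D A (b + c) (v - log_resolvent D A (a + c) v)"
      unfolding zw(1) log_resolvent_def z_def[symmetric] w_def[symmetric] Rz_def[symmetric] Rw_def[symmetric] ..
  qed simp
  then show ?thesis by blast
qed

lemma log_resolvent_apply:
  assumes "exp a \<in> resolvent_set D A" "x \<in> D"
  shows "log_resolvent D A a (A x) = exp a *\<^sub>C (log_resolvent D A a x - x)"
proof -
  have R: "bounded_clinear (resolvent D A (exp a))" using assms(1) by (simp add: resolvent_set_def)
  have "exp a *\<^sub>C resolvent D A (exp a) x - resolvent D A (exp a) (A x) = x"
    using resolvent_left[OF assms] by (simp add: bounded_clinear_simps[OF R])
  then have "resolvent D A (exp a) (A x) = exp a *\<^sub>C resolvent D A (exp a) x - x"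
    by (simp add: algebra_simps)
  then show ?thesis by (simp add: log_resolvent_def)
qed

text \<open>Since \<open>exp c = - 1\<close>, the operator is
  \<open>- R(- 1, A) = (1 + A)\<^sup>-\<^sup>1\<close>.\<close>

lemma log_resolvent_minus_one:
  assumes A: "linear_operator D A" and c: "exp c = - 1" "- 1 \<in> resolvent_set D A"
  shows "log_resolvent D A c q \<in> D" "A (log_resolvent D A c q) = q - log_resolvent D A c q"
    "x \<in> D \<Longrightarrow> x = log_resolvent D A c (x + A x)"
proof -
  let ?r = "resolvent D A (- 1) q"
  have R: "bounded_clinear (resolvent D A (- 1))" using c(2) by (simp add: resolvent_set_def)
  have e: "log_resolvent D A c y = (- 1) *\<^sub>C resolvent D A (- 1) y" for y
    by (simp add: log_resolvent_def c)
  have r: "?r \<in> D" "(- 1) *\<^sub>C ?r - A ?r = q" using resolvent_right[OF c(2)] by auto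
  have neg: "(- 1) *\<^sub>C x \<in> D" "A ((- 1) *\<^sub>C x) = (- 1) *\<^sub>C A x" if "x \<in> D" for x
    using A that unfolding linear_operator_def by blast+
  show "log_resolvent D A c q \<in> D" "A (log_resolvent D A c q) = q - log_resolvent D A c q"
    using neg[OF r(1)] r(2) unfolding e by (auto simp: scaleC.minus_left algebra_simps)
  assume "x \<in> D"
  then have "resolvent D A (- 1) ((- 1) *\<^sub>C x - A x) = x" by (rule resolvent_left[OF c(2)])
  moreover have "(- 1) *\<^sub>C x - A x = (- 1) *\<^sub>C (x + A x)" by (simp add: scaleC.minus_left)
  ultimately have "(- 1) *\<^sub>C resolvent D A (- 1) (x + A x) = x"
    by (simp only: bounded_clinear_simps(5)[OF R])
  then show "x = log_resolvent D A c (x + A x)" by (simp only: e)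
qed

lemma resolvent_scaleR:
  assumes "l / of_real t \<in> resolvent_set D A" "0 < t"
  shows "resolvent D (\<lambda>y. t *\<^sub>R A y) l x = (1 / t) *\<^sub>R resolvent D A (l / of_real t) x"
proof -
  let ?m = "l / of_real t"
  have R: "bounded_clinear (resolvent D A ?m)" using assms(1) by (simp add: resolvent_set_def)
  have eq: "l *\<^sub>C y - t *\<^sub>R A y = t *\<^sub>R (?m *\<^sub>C y - A y)" for y
    using assms(2) by (simp add: scaleC.diff_right scaleC_scaleC flip: scaleC_of_real)
  have inj: "inj_on (\<lambda>y. l *\<^sub>C y - t *\<^sub>R A y) D"
    using assms unfolding eq resolvent_set_def bij_betw_def inj_on_def by auto
  have "resolvent D (\<lambda>y. t *\<^sub>R A y) l x = resolvent D A ?m ((1 / t) *\<^sub>R x)"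
    unfolding resolvent_def[of D "\<lambda>y. t *\<^sub>R A y"]
  proof (rule the_inv_into_f_eq[OF inj])
    show "l *\<^sub>C resolvent D A ?m ((1 / t) *\<^sub>R x) - t *\<^sub>R A (resolvent D A ?m ((1 / t) *\<^sub>R x)) = x"
      unfolding eq resolvent_right(2)[OF assms(1)] using assms(2) by simp
  qed (rule resolvent_right(1)[OF assms(1)])
  then show ?thesis by (simp add: bounded_clinear_simps(6)[OF R])
qed

lemma Arg_exp_strip: "\<bar>Im a\<bar> < pi \<Longrightarrow> Arg (exp a) = Im a"
  by (subst Arg_exp) auto

lemma exp_in_sector: "\<bar>Im a\<bar> < \<rho> \<Longrightarrow> \<rho> \<le> pi \<Longrightarrow> exp a \<in> sector \<rho>"
  by (auto simp: sector_def Arg_exp_strip)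

lemma strip_decay_H_inf_0:
  assumes "\<phi> \<in> H_inf_0 \<rho>" "\<rho> \<le> pi"
  shows "\<exists>C e. strip_decay \<rho> C e (\<lambda>a. \<phi> (exp a))"
proof -
  obtain C \<epsilon> where C: "0 < C" "0 < \<epsilon>" "\<And>z. z \<in> sector \<rho> \<Longrightarrow> cmod (\<phi> z) \<le> C * min (cmod z powr \<epsilon>) (cmod z powr (- \<epsilon>))"
    and hol: "\<phi> holomorphic_on sector \<rho>"
    using assms(1) by (auto simp: H_inf_0_def)
  have "strip_decay \<rho> C \<epsilon> (\<lambda>a. \<phi> (exp a))"
    unfolding strip_decay_def
  proof (intro conjI allI impI C)
    have "\<phi> \<circ> exp holomorphic_on {z. \<bar>Im z\<bar> < \<rho>}"
      by (rule holomorphic_on_compose_gen[OF _ hol]) (use exp_in_sector[OF _ assms(2)] in \<open>auto intro!: holomorphic_intros\<close>)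
    then show "(\<lambda>a. \<phi> (exp a)) holomorphic_on {z. \<bar>Im z\<bar> < \<rho>}" by (simp add: o_def)
    fix z assume "\<bar>Im z\<bar> < \<rho>"
    then have "cmod (\<phi> (exp z)) \<le> C * min (cmod (exp z) powr \<epsilon>) (cmod (exp z) powr (- \<epsilon>))"
      by (intro C(3) exp_in_sector assms(2))
    also have "min (cmod (exp z) powr \<epsilon>) (cmod (exp z) powr (- \<epsilon>)) \<le> exp (- \<epsilon> * \<bar>Re z\<bar>)"
      by (cases "0 \<le> Re z") (auto simp: exp_powr_real min_le_iff_disj mult.commute)
    finally show "cmod (\<phi> (exp z)) \<le> C * exp (- \<epsilon> * \<bar>Re z\<bar>)" using C(1) by simp
  qed
  then show ?thesis by blast
qed

text \<open>The substitution \<open>r = exp v\<close> turns each ray into a line, and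
  \<open>R(z, t A) = (1 / t) R(z / t, A)\<close> shifts the resolvent by \<open>ln t\<close>;
  translating the line moves this shift to \<phi>.\<close>

lemma dunford_eq_boundary_integral:
  assumes \<nu>: "0 < \<nu>" "\<nu> < \<rho>" "\<rho> \<le> pi" and \<Phi>: "strip_decay \<rho> C e (\<lambda>a. \<phi> (exp a))"
    and G: "resolvent_family U K (log_resolvent D A)" "{z. \<bar>Im z\<bar> = \<nu>} \<subseteq> U"
    and res: "\<And>a. \<bar>Im a\<bar> = \<nu> \<Longrightarrow> exp a \<in> resolvent_set D A" and t: "0 < t"
  shows "dunford \<nu> D (\<lambda>y. t *\<^sub>R A y) \<phi> x = boundary_integral \<nu> (\<lambda>z. \<phi> (exp (z + of_real (ln t))) *\<^sub>C log_resolvent D A z x)"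
proof -
  have ray: "ray_integral \<theta> D (\<lambda>y. t *\<^sub>R A y) \<phi> x =
      integral UNIV (\<lambda>u. \<phi> (exp (Complex u \<theta> + of_real (ln t))) *\<^sub>C log_resolvent D A (Complex u \<theta>) x)"
    if \<theta>: "\<bar>\<theta>\<bar> = \<nu>" for \<theta>
  proof -
    define g where "g r = (\<phi> (of_real r * cis \<theta>) * cis \<theta>) *\<^sub>C resolvent D (\<lambda>y. t *\<^sub>R A y) (of_real r * cis \<theta>) x" for r
    define H where "H v = \<phi> (exp (Complex v \<theta>)) *\<^sub>C log_resolvent D A (Complex (v - ln t) \<theta>) x" for v
    have expC: "exp (Complex v \<theta>) = of_real (exp v) * cis \<theta>" for v
      by (simp add: exp_eq_polar)
    have gH: "exp v *\<^sub>R g (exp v) = H v" for v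
    proof -
      have q: "of_real (exp v) * cis \<theta> / of_real t = exp (Complex (v - ln t) \<theta>)"
        using t by (simp add: expC exp_diff exp_of_real field_simps)
      have "resolvent D (\<lambda>y. t *\<^sub>R A y) (of_real (exp v) * cis \<theta>) x =
          (1 / t) *\<^sub>R resolvent D A (exp (Complex (v - ln t) \<theta>)) x"
        using resolvent_scaleR[of "of_real (exp v) * cis \<theta>" t D A x] t res[of "Complex (v - ln t) \<theta>"] \<theta>
        unfolding q by simp
      then have "exp v *\<^sub>R g (exp v) = (of_real (exp v) * (\<phi> (exp (Complex v \<theta>)) * cis \<theta>) * of_real (1 / t)) *\<^sub>C
          resolvent D A (exp (Complex (v - ln t) \<theta>)) x"
        unfolding g_def expC[symmetric] by (simp only: scaleC_scaleC mult.assoc flip: scaleC_of_real)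
      also have "of_real (exp v) * (\<phi> (exp (Complex v \<theta>)) * cis \<theta>) * of_real (1 / t) =
          \<phi> (exp (Complex v \<theta>)) * exp (Complex (v - ln t) \<theta>)"
        unfolding q[symmetric] by simp
      finally show ?thesis by (simp only: H_def log_resolvent_def scaleC_scaleC)
    qed
    have dec: "exp_decay (C * (K * norm x)) e H"
      unfolding exp_decay_def
    proof (intro conjI allI)
      have "continuous_on UNIV (\<lambda>v. (\<lambda>a. \<phi> (exp a)) (Complex v \<theta>))"
        unfolding Complex_eq
        by (rule continuous_on_compose2[OF strip_decay_continuous[OF \<Phi> order_refl]])
           (use \<theta> \<nu> in \<open>auto intro!: continuous_intros\<close>)
      moreover have "continuous_on UNIV (\<lambda>v. log_resolvent D A (Complex (v - ln t) \<theta>) x)"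
        unfolding Complex_eq
        by (rule resolvent_family_continuous[OF G(1)]) (use \<theta> G(2) in \<open>auto intro!: continuous_intros\<close>)
      ultimately show "continuous_on UNIV H" unfolding H_def[abs_def] by (intro continuous_on_scaleC)
      fix v
      have "Complex (v - ln t) \<theta> \<in> U" using \<theta> G(2) by auto
      then have "cmod (\<phi> (exp (Complex v \<theta>))) * norm (log_resolvent D A (Complex (v - ln t) \<theta>) x) \<le>
          (C * exp (- e * \<bar>v\<bar>)) * (K * norm x)"
        using strip_decayD(3)[OF \<Phi>, of "Complex v \<theta>"] strip_decayD(4)[OF \<Phi>] \<theta> \<nu>
        by (intro mult_mono resolvent_familyD(3)[OF G(1)]) auto
      then show "norm (H v) \<le> C * (K * norm x) * exp (- e * \<bar>v\<bar>)"
        by (simp add: H_def norm_scaleC mult_ac)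
    qed (rule strip_decayD(2)[OF \<Phi>])
    have contg: "continuous_on {0<..} g"
    proof -
      have "continuous_on {0<..} (\<lambda>r. (1 / r) *\<^sub>R H (ln r))"
        by (intro continuous_intros continuous_on_compose2[OF exp_decayD(2)[OF dec, of UNIV]]) auto
      then show ?thesis
      proof (rule continuous_on_eq)
        fix r :: real assume "r \<in> {0<..}"
        then show "(1 / r) *\<^sub>R H (ln r) = g r" using gH[of "ln r"] by (simp flip: gH)
      qed
    qed
    have "ray_integral \<theta> D (\<lambda>y. t *\<^sub>R A y) \<phi> x = integral {0<..} g"
      unfolding ray_integral_def g_def[abs_def] ..
    also have "\<dots> = integral UNIV H"
      using integral_exp_substitution[OF contg, of "C * (K * norm x)" e] dec by (simp add: gH)
    also have "\<dots> = integral UNIV (\<lambda>u. H (u + ln t))"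
      by (rule integral_UNIV_translation[symmetric])
    also have "\<dots> = integral UNIV (\<lambda>u. \<phi> (exp (Complex u \<theta> + of_real (ln t))) *\<^sub>C log_resolvent D A (Complex u \<theta>) x)"
    proof -
      have "Complex (u + ln t) \<theta> = Complex u \<theta> + of_real (ln t)" for u by (simp add: complex_eq_iff)
      then show ?thesis by (simp add: H_def)
    qed
    finally show ?thesis .
  qed
  show ?thesis unfolding dunford_def boundary_integral_def using ray[of "- \<nu>"] ray[of \<nu>] \<nu> by simp
qed

section \<open>Closedness, density and extension\<close>

text \<open>A Lipschitz map extends continuously to the closure, and additivity, homogeneity and the
  bound pass to limits of sequences in \<open>Y\<close>.\<close>

lemma bounded_clinear_extension:
  fixes f :: "'a::complex_banach \<Rightarrow> 'a"
  assumes Y: "\<And>x y. x \<in> Y \<Longrightarrow> y \<in> Y \<Longrightarrow> x + y \<in> Y" "\<And>c x. x \<in> Y \<Longrightarrow> c *\<^sub>C x \<in> Y"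
    and f: "\<And>x y. x \<in> Y \<Longrightarrow> y \<in> Y \<Longrightarrow> f (x + y) = f x + f y" "\<And>c x. x \<in> Y \<Longrightarrow> f (c *\<^sub>C x) = c *\<^sub>C f x"
    and M: "\<And>x. x \<in> Y \<Longrightarrow> norm (f x) \<le> M * norm x" and dense: "closure Y = UNIV"
  shows "\<exists>T. bounded_clinear T \<and> (\<forall>y\<in>Y. T y = f y)"
proof -
  \<comment> \<open>\<open>M\<close> may be nonpositive; the modulus of continuity
    \<open>e / L\<close> requires a positive constant.\<close>
  define L where "L = max M 1"
  have L: "0 < L" "M \<le> L" by (auto simp: L_def)
  have diff: "norm (f x - f y) \<le> L * norm (x - y)" if "x \<in> Y" "y \<in> Y" for x y
  proof -
    have y: "(- 1) *\<^sub>C y \<in> Y" using Y(2) that by blast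
    have "f (x + (- 1) *\<^sub>C y) = f x + (- 1) *\<^sub>C f y" using f that y by simp
    then have "f (x - y) = f x - f y" by (simp add: scaleC.minus_left)
    moreover have "x - y \<in> Y" using Y(1)[OF that(1) y] by (simp add: scaleC.minus_left)
    ultimately have "norm (f x - f y) \<le> M * norm (x - y)" using M by metis
    also have "\<dots> \<le> L * norm (x - y)" using L by (intro mult_right_mono) auto
    finally show ?thesis .
  qed
  have "uniformly_continuous_on Y f"
    unfolding uniformly_continuous_on_def
  proof (intro allI impI)
    fix e :: real assume "0 < e"
    show "\<exists>d>0. \<forall>x\<in>Y. \<forall>x'\<in>Y. dist x' x < d \<longrightarrow> dist (f x') (f x) < e"
    proof (intro exI[of _ "e / L"] conjI ballI impI)
      fix x x' assume x: "x \<in> Y" "x' \<in> Y" "dist x' x < e / L"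
      have "L * norm (x' - x) < e" using x(3) L(1) by (simp add: dist_norm pos_less_divide_eq mult.commute)
      then show "dist (f x') (f x) < e" using diff[OF x(2,1)] by (simp add: dist_norm)
    qed (use \<open>0 < e\<close> L in auto)
  qed
  then obtain g where g: "uniformly_continuous_on (closure Y) g" "\<And>x. x \<in> Y \<Longrightarrow> f x = g x"
    using uniformly_continuous_on_extension_on_closure by metis
  have cg: "isCont g x" for x
    using uniformly_continuous_imp_continuous[OF g(1)] unfolding dense by (simp add: continuous_on_eq_continuous_at)
  have seq: "\<exists>s. (\<forall>n. s n \<in> Y) \<and> s \<longlonglongrightarrow> x" for x
    using dense closure_sequential[of x Y] by auto
  have add: "g (x + y) = g x + g y" for x y
  proof -
    obtain s t where s: "\<And>n. s n \<in> Y" "s \<longlonglongrightarrow> x" and t: "\<And>n. t n \<in> Y" "t \<longlonglongrightarrow> y"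
      using seq by metis
    have "(\<lambda>n. g (s n + t n)) \<longlonglongrightarrow> g (x + y)"
      by (rule isCont_tendsto_compose[OF cg tendsto_add[OF s(2) t(2)]])
    moreover have "g (s n + t n) = g (s n) + g (t n)" for n
      using f(1)[OF s(1) t(1)] g(2) Y(1) s(1) t(1) by metis
    then have "(\<lambda>n. g (s n + t n)) \<longlonglongrightarrow> g x + g y"
      by (simp only:) (intro tendsto_add isCont_tendsto_compose[OF cg] s t)
    ultimately show ?thesis by (rule LIMSEQ_unique)
  qed
  have sc: "g (c *\<^sub>C x) = c *\<^sub>C g x" for c x
  proof -
    obtain s where s: "\<And>n. s n \<in> Y" "s \<longlonglongrightarrow> x" using seq by metis
    have "(\<lambda>n. g (c *\<^sub>C s n)) \<longlonglongrightarrow> g (c *\<^sub>C x)"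
      by (rule isCont_tendsto_compose[OF cg tendsto_scaleC[OF tendsto_const s(2)]])
    moreover have "g (c *\<^sub>C s n) = c *\<^sub>C g (s n)" for n
      using f(2)[OF s(1)] g(2) Y(2) s(1) by metis
    then have "(\<lambda>n. g (c *\<^sub>C s n)) \<longlonglongrightarrow> c *\<^sub>C g x"
      by (simp only:) (intro tendsto_scaleC tendsto_const isCont_tendsto_compose[OF cg] s)
    ultimately show ?thesis by (rule LIMSEQ_unique)
  qed
  have "norm (g x) \<le> norm x * L" for x
  proof -
    obtain s where s: "\<And>n. s n \<in> Y" "s \<longlonglongrightarrow> x" using seq by metis
    show ?thesis
    proof (rule LIMSEQ_le)
      show "(\<lambda>n. norm (g (s n))) \<longlonglongrightarrow> norm (g x)"
        by (intro tendsto_norm isCont_tendsto_compose[OF cg] s)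
      show "(\<lambda>n. norm (s n) * L) \<longlonglongrightarrow> norm x * L" by (intro tendsto_intros s)
      have "norm (g (s n)) \<le> norm (s n) * L" for n
        using M[OF s(1)[of n]] g(2)[OF s(1)[of n]] mult_right_mono[OF L(2), of "norm (s n)"] by (simp add: mult.commute)
      then show "\<exists>N. \<forall>n\<ge>N. norm (g (s n)) \<le> norm (s n) * L" by blast
    qed
  qed
  then have "bounded_linear g"
    using add sc[of "of_real _"] by (intro bounded_linear_intro) (auto simp: scaleC_of_real)
  then show ?thesis using sc g(2) unfolding bounded_clinear_def by metis
qed

lemma closed_operatorD:
  assumes "closed_operator D A" "\<And>n. s n \<in> D" "s \<longlonglongrightarrow> x" "(\<lambda>n. A (s n)) \<longlonglongrightarrow> y"
  shows "x \<in> D" "A x = y"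
proof -
  have cl: "closed {(x, A x) | x. x \<in> D}" using assms(1) by (simp add: closed_operator_def)
  have "(\<lambda>n. (s n, A (s n))) \<longlonglongrightarrow> (x, y)" by (intro tendsto_Pair assms)
  then have "(x, y) \<in> {(x, A x) | x. x \<in> D}"
    by (rule closed_sequentially[OF cl, rotated]) (use assms(2) in blast)
  then show "x \<in> D" "A x = y" by auto
qed

text \<open>If \<open>x\<close> and \<open>A x + B x\<close> converge along a sequence, the estimate
  makes \<open>A x\<close> a Cauchy sequence. So \<open>A x\<close> and \<open>B x\<close> converge
  separately, and the closedness of each operator applies.\<close>

lemma closed_operator_sum:
  assumes A: "closed_operator DA A" and B: "closed_operator DB B"
    and M: "\<And>x. x \<in> DA \<inter> DB \<Longrightarrow> norm (A x) \<le> M * norm (A x + B x)"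
  shows "closed_operator (DA \<inter> DB) (\<lambda>x. A x + B x)"
proof -
  have linA: "linear_operator DA A" and linB: "linear_operator DB B"
    using A B by (auto simp: closed_operator_def)
  have lin: "linear_operator (DA \<inter> DB) (\<lambda>x. A x + B x)"
    using linA linB unfolding linear_operator_def by (simp add: scaleC_add_right)
  have "closed {(x, A x + B x) | x. x \<in> DA \<inter> DB}"
    unfolding closed_sequential_limits
  proof (intro allI impI)
    fix s :: "nat \<Rightarrow> 'a \<times> 'a" and l
    assume sl: "(\<forall>n. s n \<in> {(x, A x + B x) | x. x \<in> DA \<inter> DB}) \<and> s \<longlonglongrightarrow> l"
    have s: "fst (s n) \<in> DA" "fst (s n) \<in> DB" "snd (s n) = A (fst (s n)) + B (fst (s n))" for n
      using sl[THEN conjunct1, THEN spec, of n] by auto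
    have l: "(\<lambda>n. fst (s n)) \<longlonglongrightarrow> fst l" "(\<lambda>n. snd (s n)) \<longlonglongrightarrow> snd l"
      using tendsto_fst[OF sl[THEN conjunct2]] tendsto_snd[OF sl[THEN conjunct2]] by auto
    have diff: "norm (A (fst (s n)) - A (fst (s m))) \<le> M * norm (snd (s n) - snd (s m))" for n m
    proof -
      have neg: "(- 1) *\<^sub>C fst (s m) \<in> DA \<inter> DB" "A ((- 1) *\<^sub>C fst (s m)) = (- 1) *\<^sub>C A (fst (s m))"
        "B ((- 1) *\<^sub>C fst (s m)) = (- 1) *\<^sub>C B (fst (s m))"
        using linA linB s(1,2) unfolding linear_operator_def by blast+
      let ?x = "fst (s n) + (- 1) *\<^sub>C fst (s m)"
      have x: "?x \<in> DA \<inter> DB" using linA linB s(1,2) neg(1) unfolding linear_operator_def by blast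
      have Ax: "A ?x = A (fst (s n)) - A (fst (s m))" "B ?x = B (fst (s n)) - B (fst (s m))"
        using linA linB s(1,2) neg unfolding linear_operator_def by (auto simp: scaleC.minus_left)
      show ?thesis using M[OF x] unfolding Ax s(3) by (simp add: algebra_simps)
    qed
    have "Cauchy (\<lambda>n. snd (s n))" using l(2) by (rule LIMSEQ_imp_Cauchy)
    have "Cauchy (\<lambda>n. A (fst (s n)))"
    proof (rule CauchyI)
      fix e :: real assume e: "0 < e"
      define M' where "M' = max M 1"
      have M': "0 < M'" "M \<le> M'" by (auto simp: M'_def)
      obtain N where N: "\<And>m n. m \<ge> N \<Longrightarrow> n \<ge> N \<Longrightarrow> norm (snd (s m) - snd (s n)) < e / M'"
        using CauchyD[OF \<open>Cauchy (\<lambda>n. snd (s n))\<close>, of "e / M'"] e M' by auto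
      show "\<exists>N. \<forall>m\<ge>N. \<forall>n\<ge>N. norm (A (fst (s m)) - A (fst (s n))) < e"
      proof (intro exI allI impI)
        fix m n assume mn: "m \<ge> N" "n \<ge> N"
        have "norm (A (fst (s m)) - A (fst (s n))) \<le> M' * norm (snd (s m) - snd (s n))"
          using diff[of m n] mult_right_mono[OF M'(2), of "norm (snd (s m) - snd (s n))"] by simp
        also have "\<dots> < e" using N[OF mn] M' by (simp add: pos_less_divide_eq mult.commute)
        finally show "norm (A (fst (s m)) - A (fst (s n))) < e" .
      qed
    qed
    then obtain z where z: "(\<lambda>n. A (fst (s n))) \<longlonglongrightarrow> z" using Cauchy_convergent convergent_def by blast
    have "(\<lambda>n. B (fst (s n))) \<longlonglongrightarrow> snd l - z"
      using tendsto_diff[OF l(2) z] by (simp add: s(3))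
    note limB = closed_operatorD[OF B s(2) l(1) this]
    note limA = closed_operatorD[OF A s(1) l(1) z]
    show "l \<in> {(x, A x + B x) | x. x \<in> DA \<inter> DB}"
      using limA limB by (cases l) auto
  qed
  with lin show ?thesis by (simp add: closed_operator_def)
qed

lemma dense_range_comp:
  assumes S: "bounded_clinear S" and T: "bounded_clinear T"
    and "closure (range S) = UNIV" and "closure (range T) = UNIV"
  shows "closure (range (\<lambda>x. S (T x))) = UNIV"
proof -
  have "continuous_on (closure (range T)) S"
    using bounded_clinearD[OF S] by (rule linear_continuous_on)
  then have "S ` closure (range T) \<subseteq> closure (S ` range T)"
    by (rule image_closure_subset) (auto intro: closure_subset[THEN subsetD])
  then have "range S \<subseteq> closure (range (\<lambda>x. S (T x)))"
    using assms(4) by (simp add: image_image)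
  then have "closure (range S) \<subseteq> closure (range (\<lambda>x. S (T x)))"
    by (rule closure_minimal) simp
  then show ?thesis using assms(3) by auto
qed

text \<open>\<open>(A + B)\<^sup>-\<^sup>1\<close> lives on the range of \<open>A + B\<close>;
  therefore injectivity belongs to the claim, and \<open>T\<close> is required to agree with
  \<open>A (A + B)\<^sup>-\<^sup>1\<close> there. The norm equivalence is formulated with one
  admissible contour angle \<nu>.\<close>

theorem theorem4p1:
  fixes A B :: "'a::complex_banach \<Rightarrow> 'a" and DA DB :: "'a set"
    and \<omega>A \<omega>B \<rho> \<nu> :: real and p :: ennreal and \<phi> :: "complex \<Rightarrow> complex"
  assumes "sectorial DA A \<omega>A" and "closure DA = UNIV" and "closure (A ` DA) = UNIV"
    and "sectorial DB B \<omega>B" and "closure DB = UNIV" and "closure (B ` DB) = UNIV"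
    and "\<omega>A + \<omega>B < pi"
    and "resolvents_commute DA A DB B"
    and "\<omega>A < \<rho>" and "\<rho> < pi - \<omega>B"
    and "1 \<le> p"
    and "\<phi> \<in> H_inf_0 \<rho>" and "\<exists>z\<in>sector \<rho>. \<phi> z \<noteq> 0"
    and "\<omega>A < \<nu>" and "\<nu> < \<rho>"
    and "\<exists>c>0. \<exists>C>0. \<forall>x::'a.
           ennreal (c * norm x) \<le> Lp_norm p dt_over_t (\<lambda>t. dunford \<nu> DA (\<lambda>y. t *\<^sub>R A y) \<phi> x) \<and>
           Lp_norm p dt_over_t (\<lambda>t. dunford \<nu> DA (\<lambda>y. t *\<^sub>R A y) \<phi> x) \<le> ennreal (C * norm x)"
  shows "closed_operator (DA \<inter> DB) (\<lambda>x. A x + B x) \<and>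
         inj_on (\<lambda>x. A x + B x) (DA \<inter> DB) \<and>
         (\<exists>T. bounded_clinear T \<and>
              (\<forall>y\<in>(\<lambda>x. A x + B x) ` (DA \<inter> DB).
                 T y = A (the_inv_into (DA \<inter> DB) (\<lambda>x. A x + B x) y)))"
proof -
  note secA = assms(1) and secB = assms(4)
  have clA: "closed_operator DA A" and \<omega>A: "0 \<le> \<omega>A" and clB: "closed_operator DB B" and \<omega>B: "0 \<le> \<omega>B"
    using secA secB by (auto simp: sectorial_def)
  have linA: "linear_operator DA A" and linB: "linear_operator DB B"
    using clA clB by (auto simp: closed_operator_def)
  \<comment> \<open>\<mu> is a second height below \<rho>. \<open>\<sigma>A\<close> and
    \<open>\<sigma>B\<close> lie strictly above the angles of \<open>A\<close> and \<open>B\<close>,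
    so that the resolvent bounds hold outside closed sectors which the lines and the strip
    avoid.\<close>
  define \<mu> where "\<mu> = (\<nu> + \<rho>) / 2"
  define \<sigma>A where "\<sigma>A = (\<omega>A + \<nu>) / 2"
  define \<sigma>B where "\<sigma>B = (\<omega>B + (pi - \<rho>)) / 2"
  have angles: "0 < \<nu>" "\<nu> < \<mu>" "\<mu> < \<rho>" "\<rho> < pi"
    using assms(9,10,14,15) \<omega>A \<omega>B by (auto simp: \<mu>_def)
  have \<sigma>A: "\<omega>A < \<sigma>A" "\<sigma>A < \<nu>" "\<sigma>A < pi" "0 \<le> \<sigma>A"
    using assms(14) \<omega>A angles by (auto simp: \<sigma>A_def)
  have \<sigma>B: "\<omega>B < \<sigma>B" "\<rho> < pi - \<sigma>B" "\<sigma>B < pi" "0 \<le> \<sigma>B"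
    using assms(10) \<omega>B angles by (auto simp: \<sigma>B_def field_simps)
  \<comment> \<open>\<open>UG\<close> contains both pairs of lines and the point
    \<open>Complex 0 pi\<close>, where \<open>exp\<close> is \<open>- 1\<close>.\<close>
  define UG where "UG = {a. \<nu> \<le> \<bar>Im a\<bar> \<and> \<bar>Im a\<bar> \<le> pi}"
  define UF where "UF = {a. \<bar>Im a\<bar> < \<rho>}"
  define G where "G = log_resolvent DA A"
  define F where "F a = log_resolvent DB B (a + Complex 0 pi)" for a
  have nA: "exp a \<notin> closure (sector \<sigma>A)" if "a \<in> UG" for a
    using that \<sigma>A by (intro exp_not_in_closure_sector) (auto simp: UG_def)
  have nB: "exp (a + Complex 0 pi) \<notin> closure (sector \<sigma>B)" if "a \<in> UF" for a
    using that \<sigma>B by (intro minus_exp_not_in_closure_sector) (auto simp: UF_def)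
  have resA: "exp a \<in> resolvent_set DA A" if "a \<in> UG" for a
    by (rule sectorial_resolvent_set[OF secA \<sigma>A(1,3) nA[OF that]])
  have resB: "exp (a + Complex 0 pi) \<in> resolvent_set DB B" if "a \<in> UF" for a
    by (rule sectorial_resolvent_set[OF secB \<sigma>B(1,3) nB[OF that]])
  obtain K where K: "resolvent_family UG K G"
    using log_resolvent_family[OF secA \<sigma>A(1,3), of UG 0] nA by (auto simp: G_def)
  obtain L where L: "resolvent_family UF L F"
    using log_resolvent_family[OF secB \<sigma>B(1,3), of UF "Complex 0 pi"] nB by (auto simp: F_def[abs_def])
  have GF: "G a (F b v) = F b (G a v)" if "a \<in> UG" "b \<in> UF" for a b v
  proof -
    have lin: "bounded_clinear (resolvent DA A (exp a))" "bounded_clinear (resolvent DB B (exp (b + Complex 0 pi)))"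
      using resA[OF that(1)] resB[OF that(2)] by (auto simp: resolvent_set_def)
    have "resolvent DA A (exp a) (resolvent DB B (exp (b + Complex 0 pi)) v) =
        resolvent DB B (exp (b + Complex 0 pi)) (resolvent DA A (exp a) v)"
      using assms(8) resA[OF that(1)] resB[OF that(2)] unfolding resolvents_commute_def by (metis comp_apply)
    then show ?thesis
      by (simp add: G_def F_def log_resolvent_def bounded_clinear_simps(5)[OF lin(1)]
          bounded_clinear_simps(5)[OF lin(2)] scaleC_scaleC mult.commute)
  qed
  obtain C e where Ce: "strip_decay \<rho> C e (\<lambda>a. \<phi> (exp a))"
    using strip_decay_H_inf_0[OF assms(12)] angles by auto
  have nz: "\<exists>z. \<bar>Im z\<bar> < \<rho> \<and> \<phi> (exp z) \<noteq> 0"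
  proof -
    obtain z where z: "z \<in> sector \<rho>" "\<phi> z \<noteq> 0" using assms(13) by blast
    then have "z \<noteq> 0" "\<bar>Arg z\<bar> < \<rho>" using angles by (auto simp: sector_def)
    then show ?thesis using z by (intro exI[of _ "Ln z"]) (simp add: Arg_eq_Im_Ln)
  qed
  interpret sectorial_families G F UG UF K L \<nu> \<mu> \<rho> "\<lambda>a. \<phi> (exp a)" C e
    by standard (use angles K L GF Ce nz in \<open>auto simp: UG_def UF_def\<close>)
  have Lp: "Lp_norm p dt_over_t (\<lambda>t. dunford \<nu> DA (\<lambda>y. t *\<^sub>R A y) \<phi> x) =
      Lp_norm p lborel (\<lambda>s. norm (calc (\<Phi>t s) x))" for x
  proof (rule Lp_norm_dt_over_t)
    show "(\<lambda>s. norm (calc (\<Phi>t s) x)) \<in> borel_measurable borel"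
      by (intro borel_measurable_continuous_onI continuous_intros continuous_calc_\<Phi>t)
    fix t :: real assume "0 < t"
    have "dunford \<nu> DA (\<lambda>y. t *\<^sub>R A y) \<phi> x = calc (\<Phi>t (ln t)) x"
      unfolding calc_def \<Phi>t_def unfolding G_def
      by (rule dunford_eq_boundary_integral[OF _ _ _ Ce _ _ _ \<open>0 < t\<close>, where U = UG and K = K])
         (use angles K resA in \<open>auto simp: UG_def G_def\<close>)
    then show "norm (dunford \<nu> DA (\<lambda>y. t *\<^sub>R A y) \<phi> x) = \<bar>norm (calc (\<Phi>t (ln t)) x)\<bar>" by simp
  qed
  obtain c0 C0 where c0: "0 < c0" "0 < C0"
    "\<And>x. ennreal (c0 * norm x) \<le> Lp_norm p lborel (\<lambda>s. norm (calc (\<Phi>t s) x))"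
    "\<And>x. Lp_norm p lborel (\<lambda>s. norm (calc (\<Phi>t s) x)) \<le> ennreal (C0 * norm x)"
    using assms(16) unfolding Lp by metis
  interpret square_function_families G F UG UF K L \<nu> \<mu> \<rho> "\<lambda>a. \<phi> (exp a)" C e p c0 C0
    by standard (use assms(11) c0 in auto)
  have U0: "Complex 0 pi \<in> UG" "0 \<in> UF" using angles by (auto simp: UG_def UF_def)
  have pi1: "exp (Complex 0 pi) = - 1" using exp_plus_pi(1)[of 0] by simp
  have m1A: "- 1 \<in> resolvent_set DA A" using resA[OF U0(1)] by (simp add: pi1)
  have m1B: "- 1 \<in> resolvent_set DB B" using resB[OF U0(2)] by (simp add: pi1)
  define S where "S = G (Complex 0 pi)"
  have S: "bounded_clinear S" unfolding S_def by (rule resolvent_familyD(2)[OF K U0(1)])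
  have SA: "S q \<in> DA" "A (S q) = q - S q" "x \<in> DA \<Longrightarrow> x = S (x + A x)" for q x
    using log_resolvent_minus_one[OF linA pi1 m1A] by (auto simp: S_def G_def)
  have FB: "F 0 q \<in> DB" "B (F 0 q) = q - F 0 q" for q
    using log_resolvent_minus_one[OF linB pi1 m1B] by (auto simp: F_def)
  have rel: "G a (A x) = G a (F a (A x + B x)) - F a (B x)"
    if x: "x \<in> DA \<inter> DB" and a: "\<bar>Im a\<bar> = \<mu>" for x a
  proof -
    have aU: "a \<in> UG" "a \<in> UF" using a angles by (auto simp: UG_def UF_def)
    note linG = bounded_clinear_simps[OF resolvent_familyD(2)[OF K aU(1)]]
    note linF = bounded_clinear_simps[OF resolvent_familyD(2)[OF L aU(2)]]
    have GA: "G a (A x) = exp a *\<^sub>C (G a x - x)"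
      unfolding G_def by (rule log_resolvent_apply[OF resA[OF aU(1)]]) (use x in simp)
    have FB: "F a (B x) = exp a *\<^sub>C (x - F a x)"
      using log_resolvent_apply[OF resB[OF aU(2)], of x] x unfolding F_def
      by (simp add: exp_plus_pi scaleC_simps)
    have "G a (F a (A x + B x)) = F a (G a (A x)) + G a (F a (B x))"
      using GF[OF aU] by (simp add: linF linG)
    also have "\<dots> = exp a *\<^sub>C (F a (G a x) - F a x) + exp a *\<^sub>C (G a x - F a (G a x))"
      unfolding GA FB using GF[OF aU] by (simp add: linF linG)
    finally show ?thesis unfolding GA FB by (simp add: scaleC.diff_right algebra_simps)
  qed
  obtain M where M: "0 \<le> M"
    "\<And>x y. (\<And>a. \<bar>Im a\<bar> = \<mu> \<Longrightarrow> G a x = G a (F a (x + y)) - F a y) \<Longrightarrow> norm x \<le> M * norm (x + y)"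
    using norm_le_sum by metis
  have bound: "norm (A x) \<le> M * norm (A x + B x)" if "x \<in> DA \<inter> DB" for x
    by (rule M(2)) (rule rel[OF that])
  have A0: "A x = 0 \<Longrightarrow> x = 0" if "x \<in> DA" for x
  proof (rule eq_0_if_fixed)
    fix a assume "A x = 0" "\<bar>Im a\<bar> = \<nu>"
    then have aU: "a \<in> UG" using angles by (auto simp: UG_def)
    have "exp a *\<^sub>C (G a x - x) = 0"
      using log_resolvent_apply[OF resA[OF aU] that] \<open>A x = 0\<close>
        bounded_clinear_simps(3)[OF resolvent_familyD(2)[OF K aU]] by (simp add: G_def)
    then have "norm (exp a *\<^sub>C (G a x - x)) = 0" by simp
    then show "G a x = x" unfolding norm_scaleC by simp
  qed
  have sub: "x - y \<in> DA \<inter> DB" "A (x - y) = A x - A y" "B (x - y) = B x - B y"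
    if "x \<in> DA \<inter> DB" "y \<in> DA \<inter> DB" for x y
  proof -
    have neg: "(- 1) *\<^sub>C y \<in> DA \<inter> DB" "A ((- 1) *\<^sub>C y) = (- 1) *\<^sub>C A y" "B ((- 1) *\<^sub>C y) = (- 1) *\<^sub>C B y"
      using linA linB that(2) unfolding linear_operator_def by blast+
    have "x + (- 1) *\<^sub>C y \<in> DA \<inter> DB" "A (x + (- 1) *\<^sub>C y) = A x + (- 1) *\<^sub>C A y"
      "B (x + (- 1) *\<^sub>C y) = B x + (- 1) *\<^sub>C B y"
      using linA linB that(1) neg unfolding linear_operator_def by auto
    then show "x - y \<in> DA \<inter> DB" "A (x - y) = A x - A y" "B (x - y) = B x - B y"
      by (simp_all add: scaleC.minus_left)
  qed
  have closed: "closed_operator (DA \<inter> DB) (\<lambda>x. A x + B x)"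
    by (rule closed_operator_sum[OF clA clB bound])
  then have linAB: "linear_operator (DA \<inter> DB) (\<lambda>x. A x + B x)" by (simp add: closed_operator_def)
  have inj: "inj_on (\<lambda>x. A x + B x) (DA \<inter> DB)"
  proof (rule inj_onI)
    fix x y assume xy: "x \<in> DA \<inter> DB" "y \<in> DA \<inter> DB" "A x + B x = A y + B y"
    note s = sub[OF xy(1,2)]
    have "A (x - y) + B (x - y) = 0" using xy(3) unfolding s(2,3) by (simp add: algebra_simps)
    \<comment> \<open>The estimate reduces the injectivity of \<open>A + B\<close> to that of
      \<open>A\<close>.\<close>
    then have "A (x - y) = 0" using bound[OF s(1)] by simp
    then show "x = y" using A0[of "x - y"] s(1) by simp
  qed
  let ?Y = "(\<lambda>x. A x + B x) ` (DA \<inter> DB)"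
  have dense: "closure ?Y = UNIV"
  proof -
    \<comment> \<open>\<open>v - S v\<close> is \<open>A (S v)\<close>, so this operator has the
      range of \<open>A\<close>, which is dense. Composed with \<open>S\<close>, whose range is
      \<open>DA\<close>, it gives \<open>A (1 + A)\<^sup>-\<^sup>2\<close>, again with dense
      range.\<close>
    have IS: "bounded_clinear (\<lambda>v. v - S v)"
      unfolding bounded_clinear_def
      using bounded_linear_sub[OF bounded_linear_ident bounded_clinearD[OF S]]
      by (simp add: bounded_clinear_simps[OF S] scaleC.diff_right)
    have rS: "range S = DA" using SA(1,3) by blast
    have "range (\<lambda>v. v - S v) = A ` DA"
    proof -
      have "range (\<lambda>v. v - S v) = range (\<lambda>v. A (S v))" by (simp add: SA(2))
      then show ?thesis using rS by (metis image_image)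
    qed
    then have "closure (range (\<lambda>v. v - S v)) = UNIV" using assms(3) by simp
    moreover have "closure (range S) = UNIV" using assms(2) by (simp add: rS)
    ultimately have "closure (range (\<lambda>w. S w - S (S w))) = UNIV"
      using dense_range_comp[OF IS S] by simp
    moreover have "range (\<lambda>w. S w - S (S w)) \<subseteq> closure ?Y"
    proof clarify
      fix w
      show "S w - S (S w) \<in> closure ?Y"
        unfolding closure_approachable
      proof (intro allI impI)
        fix \<epsilon> :: real assume "0 < \<epsilon>"
        define y where "y = S w - S (S w)"
        obtain m where m: "0 \<le> m" "norm (y - boundary_integral \<mu> (\<lambda>a. approx_unit m a *\<^sub>C G a y)) < \<epsilon>"
          using approx_unit_tendsto[of "S w" w y, OF _ _ \<open>0 < \<epsilon>\<close>] by (auto simp: S_def y_def)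
        have "0 < \<rho>" using angles by simp
        obtain x q q' where x: "x = S q" "x = F 0 q'"
          "(q - x) + (q' - x) = boundary_integral \<mu> (\<lambda>a. approx_unit m a *\<^sub>C G a y)"
          using sum_range_representation[OF approx_unit_bounds(1)[OF \<open>0 < \<rho>\<close> angles(4) m(1)], of y]
          unfolding S_def by blast
        have "x \<in> DA \<inter> DB" using SA(1)[of q] FB(1)[of q'] x(1,2) by auto
        then have "A x + B x \<in> ?Y" by (rule imageI)
        moreover have "A x + B x = boundary_integral \<mu> (\<lambda>a. approx_unit m a *\<^sub>C G a y)"
          using SA(2)[of q] FB(2)[of q'] x by simp
        then have "dist (A x + B x) (S w - S (S w)) < \<epsilon>"
          using m(2) by (simp add: dist_norm norm_minus_commute y_def)
        ultimately show "\<exists>z\<in>?Y. dist z (S w - S (S w)) < \<epsilon>" by blast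
      qed
    qed
    then have "closure (range (\<lambda>w. S w - S (S w))) \<subseteq> closure ?Y"
      by (rule closure_minimal) simp
    ultimately show ?thesis by auto
  qed
  let ?inv = "the_inv_into (DA \<inter> DB) (\<lambda>x. A x + B x)"
  have inv: "?inv (A x + B x) = x" if "x \<in> DA \<inter> DB" for x
    using the_inv_into_f_f[OF inj that] .
  have "\<exists>T. bounded_clinear T \<and> (\<forall>y\<in>?Y. T y = A (?inv y))"
  proof (rule bounded_clinear_extension[OF _ _ _ _ _ dense])
    fix y z assume y: "y \<in> ?Y"
    then obtain x where x: "x \<in> DA \<inter> DB" "y = A x + B x" by blast
    show "norm (A (?inv y)) \<le> M * norm y" using bound[OF x(1)] inv[OF x(1)] x(2) by simp
    show "c *\<^sub>C y \<in> ?Y" "A (?inv (c *\<^sub>C y)) = c *\<^sub>C A (?inv y)" for c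
    proof -
      have c: "c *\<^sub>C x \<in> DA \<inter> DB" "A (c *\<^sub>C x) + B (c *\<^sub>C x) = c *\<^sub>C y"
        using linAB x(1) unfolding linear_operator_def x(2) by blast+
      show "c *\<^sub>C y \<in> ?Y" by (rule image_eqI[where x = "c *\<^sub>C x"]) (simp_all only: c)
      have "?inv (c *\<^sub>C y) = c *\<^sub>C x" using inv[OF c(1)] c(2) by simp
      moreover have "?inv y = x" using inv[OF x(1)] x(2) by simp
      moreover have "A (c *\<^sub>C x) = c *\<^sub>C A x"
        using linA x(1) unfolding linear_operator_def by blast
      ultimately show "A (?inv (c *\<^sub>C y)) = c *\<^sub>C A (?inv y)" by simp
    qed
    assume "z \<in> ?Y"
    then obtain w where w: "w \<in> DA \<inter> DB" "z = A w + B w" by blast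
    have s: "x + w \<in> DA \<inter> DB" "A (x + w) + B (x + w) = y + z"
      using linAB x(1) w(1) unfolding linear_operator_def x(2) w(2) by blast+
    show "y + z \<in> ?Y" by (rule image_eqI[where x = "x + w"]) (simp_all only: s)
    have "?inv (y + z) = x + w" using inv[OF s(1)] s(2) by simp
    moreover have "?inv y = x" "?inv z = w" using inv[OF x(1)] inv[OF w(1)] x(2) w(2) by auto
    moreover have "A (x + w) = A x + A w"
      using linA x(1) w(1) unfolding linear_operator_def by blast
    ultimately show "A (?inv (y + z)) = A (?inv y) + A (?inv z)" by simp
  qed
  with closed inj show ?thesis by blast
qed

end
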